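(* Let $\mathcal{T}$ be a primitive substitution tiling in $\mathbb{R}^d$ with expansion map $Q(x)=\theta x$, $\theta\in\mathbb{R}$, $|\theta|>1$, and let $\mu$ be the unique invariant Borel probability measure of $(X_\mathcal{T},\mathbb{R}^d)$. (i) If the system $(X_\mathcal{T},\mathbb{R}^d,\mu)$ is not weakly mixing (i.e., there exists a non-trivial eigenvalue), then $|\theta|$ is a Pisot number. (ii) If, in addition, $\mathcal{T}$ is repetitive and the tile-substitution is recognizable, then every measure-theoretic eigenvalue is also a topological eigenvalue, i.e., every eigenfunction may be chosen continuous.
   Context: Prototiles $T_i=(A_i,i)$, $1\le i\le\kappa$: $A_i\subset\mathbb{R}^d$ is nonempty, compact, and the closure of its interior; $i$ is the type. A tile of type $i$ is a translate $g+T_i=(g+A_i,i)$. A tiling is a set of tiles whose supports cover $\mathbb{R}^d$ and such that distinct tiles have supports with disjoint interiors. A patch is a finite nonempty set of tiles with mutually disjoint interiors. A tile-substitution $\omega$ with expansive linear map $Q$ (all eigenvalues of modulus $>1$) is given by finite sets $\mathcal{D}_{ij}\subset\mathbb{R}^d$ with $\omega(T_j)=\{u+T_i:u\in\mathcal{D}_{ij},i\le\kappa\}$ and $QA_j=\bigcup_{i=1}^\kappa(\mathcal{D}_{ij}+A_i)$, where all the sets $u+A_i$ ($u\in\mathcal{D}_{ij}$, $i\le\kappa$) have disjoint interiors. It is extended by $\omega(T_j+x)=\omega(T_j)+Qx$ and $\omega(S)=\bigcup_{T\in S}\omega(T)$. A substitution tiling with expansion map $Q$ is a tiling $\mathcal{T}$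 by translates of the prototiles with $\omega(\mathcal{T})=\mathcal{T}$; it is primitive if some positive power of the matrix $(\#\mathcal{D}_{ij})_{i,j}$ has no zero entries. Finite local complexity is not assumed. For a tiling $\mathcal{S}$ by translates of the prototiles let $\Lambda(\mathcal{S})=\{(x,i):x+T_i\in\mathcal{S}\}$. For coloured sets, intersection with $B_r(0)$ and addition of $B_\epsilon(0)$ are applied to the $\mathbb{R}^d$-coordinate, keeping colours. Metric: $d(\mathcal{S}_1,\mathcal{S}_2)=\min\{2^{-1/2},\inf\{\epsilon>0:B_{1/\epsilon}(0)\cap\Lambda(\mathcal{S}_2)\subset\Lambda(\mathcal{S}_1)+B_\epsilon(0),\ B_{1/\epsilon}(0)\cap\Lambda(\mathcal{S}_1)\subset\Lambda(\mathcal{S}_2)+B_\epsilon(0)\}\}$. $X_\mathcal{T}$ is the closure of $\{\mathcal{T}-g:g\in\mathbb{R}^d\}$ in the space of tilings by translates of the prototiles; it is compact, $\mathbb{R}^d$ acts by $\mathcal{S}\mapsto\mathcal{S}-g$, and for primitive $\omega$ this system is uniquely ergodic. $\omega$ extends to a continuous surjection $X_\mathcal{T}\to X_\mathcal{T}$; it is recognizable if this map is one-to-one. $\mathcal{T}$ is repetitive if for every patch $P\subset\mathcal{T}$ there is $M>0$ such that every ball of radius $M$ contains (the support of) a translate of $P$ belonging to $\mathcal{T}$. $\alpha\in\mathbb{R}^d$ is a (measure-theoretic) eigenvalue of $(X_\mathcal{T},\mathbb{R}^d,\mu)$ if there is a nonzero $f\in L^2(X_\mathcal{T},\mu)$ (an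 eigenfunction) with $f(\mathcal{S}-x)=e^{2\pi i\langle x,\alpha\rangle}f(\mathcal{S})$ for all $x\in\mathbb{R}^d$ and $\mu$-a.e. $\mathcal{S}$; it is a topological eigenvalue if there is a nonzero continuous $f$ satisfying this for all $x$ and all $\mathcal{S}\in X_\mathcal{T}$. A non-trivial eigenvalue is an eigenvalue $\alpha\ne0$. A Pisot number is a real algebraic integer $>1$ all of whose other Galois conjugates have modulus $<1$. *)

theory Defs
  imports "HOL-Probability.Probability"
begin

text \<open>
  The ambient space \<open>\<real>\<^sup>d\<close> is a type of class \<open>euclidean_space\<close> (so \<open>d = DIM('a) \<ge> 1\<close>), and the tile types
  \<open>1, ..., \<kappa>\<close> are the elements of a finite type \<open>'k\<close>, with \<open>\<kappa> = CARD('k)\<close>.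
  A tile is a pair consisting of its support and its type.
\<close>

type_synonym ('a, 'k) tile = "'a set \<times> 'k"

definition shift_tile :: "'a::euclidean_space \<Rightarrow> ('a, 'k) tile \<Rightarrow> ('a, 'k) tile" where
  "shift_tile g t = ((+) g ` fst t, snd t)"

definition shift_tiles :: "'a::euclidean_space \<Rightarrow> ('a, 'k) tile set \<Rightarrow> ('a, 'k) tile set" where
  "shift_tiles g S = shift_tile g ` S"

definition disjoint_interiors :: "('a::euclidean_space, 'k) tile set \<Rightarrow> bool" where
  "disjoint_interiors S \<longleftrightarrow>
     (\<forall>s\<in>S. \<forall>t\<in>S. s \<noteq> t \<longrightarrow> interior (fst s) \<inter> interior (fst t) = {})"


subsection \<open>Coloured point sets\<close>

definition restrict_ball :: "real \<Rightarrow> ('a::euclidean_space \<times> 'k) set \<Rightarrow> ('a \<times> 'k) set" where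
  "restrict_ball r L = {(x, i). (x, i) \<in> L \<and> x \<in> ball 0 r}"

definition thicken :: "real \<Rightarrow> ('a::euclidean_space \<times> 'k) set \<Rightarrow> ('a \<times> 'k) set" where
  "thicken r L = {(x + v, i) | x v i. (x, i) \<in> L \<and> v \<in> ball 0 r}"


subsection \<open>Prototiles, tilings and the tiling metric\<close>

locale prototiles =
  fixes A :: "'k::finite \<Rightarrow> 'a::euclidean_space set"
  assumes nonempty: "A i \<noteq> {}"
    and compact: "compact (A i)"
    and regular: "closure (interior (A i)) = A i"
begin

definition prototile :: "'k \<Rightarrow> ('a, 'k) tile" where
  "prototile i = (A i, i)"

definition tiles :: "('a, 'k) tile set" where
  "tiles = {shift_tile g (prototile i) | g i. True}"

definition tiling :: "('a, 'k) tile set \<Rightarrow> bool" where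
  "tiling S \<longleftrightarrow> S \<subseteq> tiles \<and> (\<Union>t\<in>S. fst t) = UNIV \<and> disjoint_interiors S"

definition patch :: "('a, 'k) tile set \<Rightarrow> bool" where
  "patch P \<longleftrightarrow> P \<subseteq> tiles \<and> finite P \<and> P \<noteq> {} \<and> disjoint_interiors P"

definition Lam :: "('a, 'k) tile set \<Rightarrow> ('a \<times> 'k) set" where
  "Lam S = {(x, i). shift_tile x (prototile i) \<in> S}"

definition close :: "real \<Rightarrow> ('a, 'k) tile set \<Rightarrow> ('a, 'k) tile set \<Rightarrow> bool" where
  "close e S1 S2 \<longleftrightarrow>
     restrict_ball (1 / e) (Lam S2) \<subseteq> thicken e (Lam S1) \<and>
     restrict_ball (1 / e) (Lam S1) \<subseteq> thicken e (Lam S2)"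

text \<open>
  \<open>min c (inf E)\<close> is written as \<open>inf (E \<union> {c})\<close>: the set \<open>E\<close> of admissible \<open>\<epsilon>\<close> can be
  empty, in which case its infimum has to be read as \<open>\<infinity>\<close>.
\<close>
definition tdist :: "('a, 'k) tile set \<Rightarrow> ('a, 'k) tile set \<Rightarrow> real" where
  "tdist S1 S2 = Inf (insert (1 / sqrt 2) {e. e > 0 \<and> close e S1 S2})"


lemma shift_tile_inj:
  assumes "shift_tile x (prototile i) = shift_tile y (prototile j)"
  shows "x = y \<and> i = j"
proof -
  have ij: "i = j" and eq: "(+) x ` A i = (+) y ` A i"
    using assms by (auto simp: shift_tile_def prototile_def)
  define v where "v = x - y"
  have step: "v + a \<in> A i" if "a \<in> A i" for a
  proof -
    have "x + a \<in> (+) y ` A i" using that eq by blast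
    then obtain b where "b \<in> A i" "x + a = y + b" by auto
    moreover from this have "v + a = b" by (simp add: v_def algebra_simps)
    ultimately show ?thesis by simp
  qed
  obtain a where a: "a \<in> A i" using nonempty by blast
  have iter: "real n *\<^sub>R v + a \<in> A i" for n
  proof (induction n)
    case 0 then show ?case using a by simp
  next
    case (Suc n)
    from step[OF Suc] show ?case by (simp add: algebra_simps)
  qed
  obtain B where B: "\<And>z. z \<in> A i \<Longrightarrow> norm z \<le> B"
    using compact_imp_bounded[OF compact] unfolding bounded_iff by blast
  have "v = 0"
  proof (rule ccontr)
    assume "v \<noteq> 0"
    then obtain n where n: "real n * norm v > B + norm a"
      using reals_Archimedean3[of "norm v"] by auto
    have "real n * norm v = norm ((real n *\<^sub>R v + a) - a)" by simp
    also have "\<dots> \<le> norm (real n *\<^sub>R v + a) + norm a" by (rule norm_triangle_ineq4)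
    also have "\<dots> \<le> B + norm a" using B[OF iter] by simp
    finally show False using n by simp
  qed
  then show ?thesis using ij by (simp add: v_def)
qed

lemma shift_tile_inj_iff:
  "shift_tile x (prototile i) = shift_tile y (prototile j) \<longleftrightarrow> x = y \<and> i = j"
  using shift_tile_inj[of x i y j] by blast

lemma interior_nonempty: "interior (A i) \<noteq> {}"
  using regular[of i] nonempty[of i] by auto

lemma Lam_separated:
  assumes "tiling S"
  obtains r where "r > 0"
    "\<And>x y. (x, i) \<in> Lam S \<Longrightarrow> (y, i) \<in> Lam S \<Longrightarrow> dist x y < r \<Longrightarrow> x = y"
proof -
  obtain c r where r: "r > 0" "ball c r \<subseteq> interior (A i)"
    using interior_nonempty[of i] by (meson all_not_in_conv open_contains_ball open_interior)
  show thesis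
  proof (rule that[OF r(1)], rule ccontr)
    fix x y assume xy: "(x, i) \<in> Lam S" "(y, i) \<in> Lam S" "dist x y < r" "x \<noteq> y"
    have "shift_tile x (prototile i) \<noteq> shift_tile y (prototile i)"
      using shift_tile_inj xy(4) by blast
    then have "interior ((+) x ` A i) \<inter> interior ((+) y ` A i) = {}"
      using assms xy(1,2)
      by (force simp: tiling_def disjoint_interiors_def Lam_def shift_tile_def prototile_def)
    then have disj: "((+) x ` interior (A i)) \<inter> ((+) y ` interior (A i)) = {}"
      by (simp add: interior_translation)
    have "c \<in> interior (A i)" using r by (meson centre_in_ball subsetD)
    then have "x + c \<in> (+) x ` interior (A i)" by blast
    moreover have "c + (x - y) \<in> interior (A i)"
      using r xy(3) by (auto simp: subset_iff dist_norm norm_minus_commute)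
    then have "y + (c + (x - y)) \<in> (+) y ` interior (A i)" by blast
    then have "x + c \<in> (+) y ` interior (A i)" by (simp add: algebra_simps)
    ultimately show False using disj by blast
  qed
qed

lemma closeD:
  assumes "close e S1 S2" "(x, i) \<in> Lam S1" "norm x < 1 / e"
  obtains y where "(y, i) \<in> Lam S2" "dist x y < e"
proof -
  have "(x, i) \<in> thicken e (Lam S2)"
    using assms by (auto simp: close_def restrict_ball_def)
  then show thesis using that by (auto simp: thicken_def dist_norm)
qed

lemma closeI:
  assumes "\<And>x i. (x, i) \<in> Lam S1 \<Longrightarrow> norm x < 1 / e \<Longrightarrow> \<exists>y. (y, i) \<in> Lam S2 \<and> dist x y < e"
    and "\<And>x i. (x, i) \<in> Lam S2 \<Longrightarrow> norm x < 1 / e \<Longrightarrow> \<exists>y. (y, i) \<in> Lam S1 \<and> dist x y < e"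
  shows "close e S1 S2"
proof -
  have *: "(x, i) \<in> thicken e L" if "(y, i) \<in> L" "dist x y < e" for x y i and L :: "('a \<times> 'k) set"
  proof -
    have "(x, i) = (y + (x - y), i)" "x - y \<in> ball 0 e" using that(2) by (auto simp: dist_norm norm_minus_commute)
    then show ?thesis unfolding thicken_def using that(1) by blast
  qed
  have **: "restrict_ball (1 / e) L \<subseteq> thicken e L'"
    if "\<And>x i. (x, i) \<in> L \<Longrightarrow> norm x < 1 / e \<Longrightarrow> \<exists>y. (y, i) \<in> L' \<and> dist x y < e"
    for L L' :: "('a \<times> 'k) set"
  proof
    fix p assume "p \<in> restrict_ball (1 / e) L"
    then obtain x i where p: "p = (x, i)" "(x, i) \<in> L" "norm x < 1 / e"
      by (auto simp: restrict_ball_def)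
    then show "p \<in> thicken e L'" using that[OF p(2,3)] * by blast
  qed
  show ?thesis
    unfolding close_def using **[OF assms(2)] **[OF assms(1)] by blast
qed

lemma close_sym: "close e S1 S2 \<longleftrightarrow> close e S2 S1"
  unfolding close_def by blast

lemma close_mono:
  assumes "close e S1 S2" "0 < e" "e \<le> e'"
  shows "close e' S1 S2"
proof -
  have le: "1 / e' \<le> 1 / e" using assms by (simp add: frac_le)
  show ?thesis
  proof (rule closeI)
    fix x i assume "(x, i) \<in> Lam S1" "norm x < 1 / e'"
    then obtain y where "(y, i) \<in> Lam S2" "dist x y < e"
      using closeD[OF assms(1)] less_le_trans[OF _ le] by metis
    then show "\<exists>y. (y, i) \<in> Lam S2 \<and> dist x y < e'"
      using less_le_trans[OF _ assms(3)] by blast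
  next
    fix x i assume "(x, i) \<in> Lam S2" "norm x < 1 / e'"
    then obtain y where "(y, i) \<in> Lam S1" "dist x y < e"
      using closeD[OF assms(1)[THEN close_sym[THEN iffD1]]] less_le_trans[OF _ le] by metis
    then show "\<exists>y. (y, i) \<in> Lam S1 \<and> dist x y < e'"
      using less_le_trans[OF _ assms(3)] by blast
  qed
qed

lemma close_trans_aux:
  assumes "close a S1 S2" "close b S2 S3" "0 < a" "0 < b" "a + b \<le> 1 / sqrt 2"
    and "(x, i) \<in> Lam S1" "norm x < 1 / (a + b)"
  shows "\<exists>z. (z, i) \<in> Lam S3 \<and> dist x z < a + b"
proof -
  have "1 / (a + b) < 1 / a" using assms by (simp add: frac_less2)
  then obtain y where y: "(y, i) \<in> Lam S2" "dist x y < a"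
    using closeD[OF assms(1,6)] assms(7) by force
  have "norm y \<le> norm x + dist x y"
    by (metis dist_0_norm dist_commute dist_triangle add.commute)
  then have "norm y < 1 / (a + b) + a" using y assms(7) by linarith
  also have "\<dots> \<le> 1 / b"
  proof -
    have "(a + b) * (a + b) \<le> (1 / sqrt 2) * (1 / sqrt 2)"
      using assms by (intro mult_mono) auto
    then have "(a + b) * (a + b) \<le> 1" by simp
    moreover have "b * (a + b) \<le> (a + b) * (a + b)"
      using assms by (intro mult_right_mono) auto
    ultimately have "b * (a + b) \<le> 1" by linarith
    then have "a * (b * (a + b)) \<le> a * 1" using assms by (intro mult_left_mono) auto
    then show ?thesis using assms by (simp add: field_simps)
  qed
  finally obtain z where "(z, i) \<in> Lam S3" "dist y z < b"
    using closeD[OF assms(2) y(1)] by blast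
  then show ?thesis using y(2) by (meson add_strict_mono dist_triangle le_less_trans)
qed

lemma close_trans:
  assumes "close a S1 S2" "close b S2 S3" "0 < a" "0 < b" "a + b \<le> 1 / sqrt 2"
  shows "close (a + b) S1 S3"
proof (rule closeI)
  show "\<exists>y. (y, i) \<in> Lam S3 \<and> dist x y < a + b"
    if "(x, i) \<in> Lam S1" "norm x < 1 / (a + b)" for x i
    using close_trans_aux[OF assms] that by blast
  show "\<exists>y. (y, i) \<in> Lam S1 \<and> dist x y < a + b"
    if "(x, i) \<in> Lam S3" "norm x < 1 / (a + b)" for x i
    using close_trans_aux[of b S3 S2 a S1 x i] assms that by (simp add: close_sym add.commute)
qed

lemma tdist_bdd: "bdd_below (insert (1 / sqrt 2) {e. e > 0 \<and> close e S1 S2})"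
  by (rule bdd_belowI[of _ 0]) auto

lemma tdist_nonneg: "0 \<le> tdist S1 S2"
  unfolding tdist_def by (rule cInf_greatest) auto

lemma tdist_le: "tdist S1 S2 \<le> 1 / sqrt 2"
  unfolding tdist_def by (rule cInf_lower[OF _ tdist_bdd]) simp

lemma tdist_le_close: "0 < e \<Longrightarrow> close e S1 S2 \<Longrightarrow> tdist S1 S2 \<le> e"
  unfolding tdist_def by (rule cInf_lower[OF _ tdist_bdd]) simp

lemma tdist_sym: "tdist S1 S2 = tdist S2 S1"
  unfolding tdist_def by (simp add: close_sym)

lemma tdist_less_imp_close:
  assumes "tdist S1 S2 < e" "e \<le> 1 / sqrt 2"
  shows "close e S1 S2"
proof -
  have "\<exists>x\<in>insert (1 / sqrt 2) {e. e > 0 \<and> close e S1 S2}. x < e"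
    using assms cInf_less_iff[OF _ tdist_bdd] unfolding tdist_def by blast
  then show ?thesis using assms(2) close_mono[of _ S1 S2 e] by force
qed

lemma tdist_triangle: "tdist S1 S3 \<le> tdist S1 S2 + tdist S2 S3"
proof (rule ccontr)
  assume "\<not> ?thesis"
  then have lt: "tdist S1 S2 + tdist S2 S3 < tdist S1 S3" by simp
  define h where "h = (tdist S1 S3 - (tdist S1 S2 + tdist S2 S3)) / 4"
  have h: "h > 0" using lt by (simp add: h_def)
  define a where "a = tdist S1 S2 + h"
  define b where "b = tdist S2 S3 + h"
  have sum: "a + b < tdist S1 S3"
    using lt by (simp add: a_def b_def h_def field_simps)
  have ab: "0 < a" "0 < b" "a + b \<le> 1 / sqrt 2"
    using h sum tdist_nonneg[of S1 S2] tdist_nonneg[of S2 S3] tdist_le[of S1 S3]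
    by (auto simp: a_def b_def)
  have "close a S1 S2" "close b S2 S3"
    using ab h by (auto intro!: tdist_less_imp_close simp: a_def b_def)
  then have "close (a + b) S1 S3" using close_trans ab by blast
  then show False using tdist_le_close[of "a + b"] ab sum by force
qed

lemma tdist_refl: "tdist S S = 0"
proof -
  have "tdist S S \<le> e" if "e > 0" for e
    using that by (intro tdist_le_close closeI) (auto intro!: exI)
  then have "tdist S S \<le> 0" using field_le_epsilon[of "tdist S S" 0] by simp
  then show ?thesis using tdist_nonneg[of S S] by simp
qed

lemma tdist_0_Lam:
  assumes "tiling S2" "tdist S1 S2 = 0"
  shows "Lam S1 \<subseteq> Lam S2"
proof clarify
  fix x i assume x: "(x, i) \<in> Lam S1"
  obtain r where r: "r > 0"
    "\<And>x y. (x, i) \<in> Lam S2 \<Longrightarrow> (y, i) \<in> Lam S2 \<Longrightarrow> dist x y < r \<Longrightarrow> x = y"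
    using Lam_separated[OF assms(1)] by metis
  have ex: "\<exists>y. (y, i) \<in> Lam S2 \<and> dist x y < e" if "e > 0" for e
  proof -
    define e' where "e' = min e (min (1 / sqrt 2) (1 / (norm x + 1)))"
    have e': "0 < e'" "e' \<le> e" "e' \<le> 1 / sqrt 2" "e' \<le> 1 / (norm x + 1)"
      using that by (auto simp: e'_def add_nonneg_pos)
    then have "norm x + 1 \<le> 1 / e'"
      using le_divide_eq[of e' "norm x + 1" 1] le_divide_eq[of "norm x + 1" e' 1]
      by (simp add: pos_le_divide_eq add_nonneg_pos mult.commute)
    then have "norm x < 1 / e'" by linarith
    moreover have "close e' S1 S2" using e' assms(2) by (intro tdist_less_imp_close) auto
    ultimately obtain y where "(y, i) \<in> Lam S2" "dist x y < e'"
      using closeD x by blast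
    then show ?thesis using e'(2) by force
  qed
  obtain y where y: "(y, i) \<in> Lam S2" "dist x y < r / 2" using ex[of "r / 2"] r(1) by auto
  have "x = y"
  proof (rule ccontr)
    assume "x \<noteq> y"
    then obtain z where z: "(z, i) \<in> Lam S2" "dist x z < min (r / 2) (dist x y)"
      using ex[of "min (r / 2) (dist x y)"] r(1) by auto
    have "dist y z \<le> dist x y + dist x z" by (metis dist_commute dist_triangle)
    then have "dist y z < r" using y z by simp
    then have "y = z" using r(2) y z by blast
    then show False using z by simp
  qed
  then show "(x, i) \<in> Lam S2" using y by simp
qed

lemma Lam_subset_imp:
  assumes "S1 \<subseteq> tiles" "Lam S1 \<subseteq> Lam S2"
  shows "S1 \<subseteq> S2"
  using assms unfolding tiles_def Lam_def by blast

sublocale tilings: Metric_space "Collect tiling" tdist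
proof
  fix S1 S2 assume "S1 \<in> Collect tiling" "S2 \<in> Collect tiling"
  then have t: "tiling S1" "tiling S2" by auto
  show "tdist S1 S2 = 0 \<longleftrightarrow> S1 = S2"
  proof
    assume "tdist S1 S2 = 0"
    then have "Lam S1 \<subseteq> Lam S2" "Lam S2 \<subseteq> Lam S1"
      using tdist_0_Lam t tdist_sym by metis+
    then show "S1 = S2" using Lam_subset_imp t unfolding tiling_def by blast
  qed (simp add: tdist_refl)
qed (auto simp: tdist_nonneg tdist_sym tdist_triangle)


subsection \<open>The tiling space and its invariant measures\<close>

definition tiling_space :: "('a, 'k) tile set \<Rightarrow> ('a, 'k) tile set set" where
  "tiling_space T = tilings.mtopology closure_of {shift_tiles (- g) T | g. True}"

definition X_top :: "('a, 'k) tile set \<Rightarrow> ('a, 'k) tile set topology" where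
  "X_top T = subtopology tilings.mtopology (tiling_space T)"

definition X_borel :: "('a, 'k) tile set \<Rightarrow> ('a, 'k) tile set measure" where
  "X_borel T = sigma (tiling_space T) {U. openin (X_top T) U}"

definition invariant_prob :: "('a, 'k) tile set \<Rightarrow> ('a, 'k) tile set measure \<Rightarrow> bool" where
  "invariant_prob T \<mu> \<longleftrightarrow>
     prob_space \<mu> \<and> sets \<mu> = sets (X_borel T) \<and> (\<forall>g. distr \<mu> \<mu> (shift_tiles (- g)) = \<mu>)"

definition repetitive :: "('a, 'k) tile set \<Rightarrow> bool" where
  "repetitive T \<longleftrightarrow>
     (\<forall>P. patch P \<and> P \<subseteq> T \<longrightarrow>
       (\<exists>M>0. \<forall>y. \<exists>g. shift_tiles g P \<subseteq> T \<and> (\<Union>t\<in>shift_tiles g P. fst t) \<subseteq> ball y M))"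

definition topological_eigenfunction ::
    "('a, 'k) tile set \<Rightarrow> 'a \<Rightarrow> (('a, 'k) tile set \<Rightarrow> complex) \<Rightarrow> bool" where
  "topological_eigenfunction T \<alpha> f \<longleftrightarrow>
     continuous_map (X_top T) euclidean f \<and> (\<exists>S\<in>tiling_space T. f S \<noteq> 0) \<and>
     (\<forall>x. \<forall>S\<in>tiling_space T. f (shift_tiles (- x) S) = exp (2 * pi * \<i> * of_real (x \<bullet> \<alpha>)) * f S)"

definition topological_eigenvalue :: "('a, 'k) tile set \<Rightarrow> 'a \<Rightarrow> bool" where
  "topological_eigenvalue T \<alpha> \<longleftrightarrow> (\<exists>f. topological_eigenfunction T \<alpha> f)"

end

text \<open>An eigenfunction is represented by a square-integrable function that is not almost everywhere zero.\<close>
definition eigenfunction ::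
    "('a::euclidean_space, 'k) tile set measure \<Rightarrow> 'a \<Rightarrow> (('a, 'k) tile set \<Rightarrow> complex) \<Rightarrow> bool" where
  "eigenfunction \<mu> \<alpha> f \<longleftrightarrow>
     f \<in> borel_measurable \<mu> \<and> integrable \<mu> (\<lambda>S. (cmod (f S))\<^sup>2) \<and> \<not> (AE S in \<mu>. f S = 0) \<and>
     (\<forall>x. AE S in \<mu>. f (shift_tiles (- x) S) = exp (2 * pi * \<i> * of_real (x \<bullet> \<alpha>)) * f S)"

definition eigenvalue :: "('a::euclidean_space, 'k) tile set measure \<Rightarrow> 'a \<Rightarrow> bool" where
  "eigenvalue \<mu> \<alpha> \<longleftrightarrow> (\<exists>f. eigenfunction \<mu> \<alpha> f)"


subsection \<open>Tile-substitutions\<close>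

text \<open>
  All complex eigenvalues have modulus \<open>> 1\<close>: the equations for \<open>u\<close> and \<open>v\<close> say that
  \<open>u + \<i> v\<close> is an eigenvector of the complexification of \<open>Q\<close> for the eigenvalue \<open>z\<close>.
\<close>
definition expansive :: "('a::euclidean_space \<Rightarrow> 'a) \<Rightarrow> bool" where
  "expansive Q \<longleftrightarrow>
     (\<forall>z u v. (u \<noteq> 0 \<or> v \<noteq> 0) \<and> Q u = Re z *\<^sub>R u - Im z *\<^sub>R v \<and> Q v = Im z *\<^sub>R u + Re z *\<^sub>R v
        \<longrightarrow> cmod z > 1)"

locale tile_substitution = prototiles A
  for A :: "'k::finite \<Rightarrow> 'a::euclidean_space set" +
  fixes Q :: "'a \<Rightarrow> 'a" and D :: "'k \<Rightarrow> 'k \<Rightarrow> 'a set"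
  assumes linear: "linear Q"
    and expansive: "expansive Q"
    and finite_digits: "finite (D i j)"
    and inflation: "Q ` A j = (\<Union>i. \<Union>u\<in>D i j. (+) u ` A i)"
    and inflation_disjoint:
      "u \<in> D i j \<Longrightarrow> v \<in> D k j \<Longrightarrow> (u, i) \<noteq> (v, k)
        \<Longrightarrow> interior ((+) u ` A i) \<inter> interior ((+) v ` A k) = {}"
begin

definition omega_prototile :: "'k \<Rightarrow> ('a, 'k) tile set" where
  "omega_prototile j = {shift_tile u (prototile i) | u i. u \<in> D i j}"

text \<open>The pair \<open>(x, j)\<close> with \<open>t = x + T\<^sub>j\<close> is unique for a tile \<open>t\<close>; see \<open>omega_tile_shift\<close>.\<close>
definition omega_tile :: "('a, 'k) tile \<Rightarrow> ('a, 'k) tile set" where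
  "omega_tile t = \<Union> {shift_tiles (Q x) (omega_prototile j) | x j. t = shift_tile x (prototile j)}"

lemma omega_tile_shift:
  "omega_tile (shift_tile x (prototile j)) = shift_tiles (Q x) (omega_prototile j)"
proof -
  have "{shift_tiles (Q y) (omega_prototile k) | y k.
          shift_tile x (prototile j) = shift_tile y (prototile k)} =
        {shift_tiles (Q x) (omega_prototile j)}"
    by (auto simp: shift_tile_inj_iff)
  then show ?thesis unfolding omega_tile_def by simp
qed

definition omega :: "('a, 'k) tile set \<Rightarrow> ('a, 'k) tile set" where
  "omega S = (\<Union>t\<in>S. omega_tile t)"

definition substitution_tiling :: "('a, 'k) tile set \<Rightarrow> bool" where
  "substitution_tiling T \<longleftrightarrow> tiling T \<and> omega T = T"

definition recognizable :: "('a, 'k) tile set \<Rightarrow> bool" where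
  "recognizable T \<longleftrightarrow> inj_on omega (tiling_space T)"

end

definition substitution_matrix :: "('k::finite \<Rightarrow> 'k \<Rightarrow> 'a set) \<Rightarrow> nat ^ 'k ^ 'k" where
  "substitution_matrix D = (\<chi> i j. card (D i j))"

definition primitive :: "('k::finite \<Rightarrow> 'k \<Rightarrow> 'a set) \<Rightarrow> bool" where
  "primitive D \<longleftrightarrow>
     (\<exists>n>0. \<forall>i j. (((**) (substitution_matrix D) ^^ n) (mat 1)) $ i $ j \<noteq> 0)"


subsection \<open>Pisot numbers\<close>

text \<open>An irreducible rational polynomial vanishing at \<open>x\<close> is the minimal polynomial of \<open>x\<close> up to a unit.\<close>
definition galois_conjugates :: "real \<Rightarrow> complex set" where
  "galois_conjugates x =
     {z. \<exists>p :: rat poly. irreducible p \<and> poly (map_poly of_rat p) x = 0 \<and>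
           poly (map_poly of_rat p) z = 0}"

definition pisot :: "real \<Rightarrow> bool" where
  "pisot x \<longleftrightarrow> x > 1 \<and> algebraic_int x \<and>
     (\<forall>z\<in>galois_conjugates x. z \<noteq> of_real x \<longrightarrow> cmod z < 1)"

end

theory Submission
  imports Defs
    "HOL-Library.Diagonal_Subsequence"
    "HOL-Computational_Algebra.Computational_Algebra"
    "HOL-Computational_Algebra.Field_as_Ring"
begin

text \<open>
  Let \<open>\<xi>\<close> be a vector such that pairs of tiles of a common type differing by \<open>\<xi>\<close> are relatively
  dense in \<open>T\<close>. Since \<open>T = \<omega>\<^sup>n(T)\<close>, near every position, on the scale \<open>\<theta>\<^sup>n\<close>, there is a translate \<open>S\<close>
  of the tiling that almost agrees with its translate \<open>S - \<theta>\<^sup>n \<xi>\<close>; approximating an eigenfunction by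
  a uniformly continuous function gives \<open>\<theta>\<^sup>n \<langle>\<xi>, \<alpha>\<rangle> \<rightarrow> 0\<close> modulo \<open>1\<close>. Comparing the volumes of the
  prototiles with those of their interiors shows that \<open>\<bar>\<theta>\<bar>\<^sup>d\<close> is an eigenvalue of the substitution
  matrix, so \<open>\<theta>\<close> is an algebraic integer and Pisot's theorem applies. Moreover the convergence is
  summable. Every return vector is a polynomial in a power of \<open>\<theta>\<close> with coefficients from a finite
  set of vectors that become return vectors after scaling, so the convergence is uniform over all
  return vectors. As recognizability makes \<open>\<omega>\<^sup>-\<^sup>n\<close> uniformly continuous on the orbit of \<open>T\<close>, the phase
  \<open>T - x \<mapsto> exp(2\<pi>\<i>\<langle>x, \<alpha>\<rangle>)\<close> is uniformly continuous and extends to the hull.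
\<close>

section \<open>Linear recurrences and Pisot's theorem\<close>

text \<open>A tile shared by two tilings inflates to a shared supertile covering a ball of radius of
  order \<bar>\<theta>\<bar>^n; all near-agreement in the proof comes from this, since one common
  tile suffices. An eigenfunction is only measurable, so its approximation by \<open>g\<close> is
  controlled in the mean: some tiling is good at finitely many prescribed translates at once. The
  number of translates compared must therefore be bounded independently of \<open>n\<close>; they
  are inflations of a finite set fixed beforehand, which a compactness argument supplies. That
  invariant functions are constant is shown in the same spirit: all tilings of the hull share, up to
  small errors, one finite pattern that fills a fixed proportion of a finite grid of translations.
  Boundaries of prototiles might have positive measure, so the volume relations start as two
  opposite inequalities. For continuity, convergence for each return vector separately is too weak,
  because infinitely many of them may have bounded length. A rate is needed to add up the terms of
  the polynomial expansion; it comes from the recurrence obeyed by the rounding errors, whose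
  characteristic roots avoid the unit circle.\<close>

definition shift_op :: "'b::comm_ring_1 poly \<Rightarrow> (nat \<Rightarrow> 'b) \<Rightarrow> nat \<Rightarrow> 'b" where
  "shift_op p a n = (\<Sum>k\<le>degree p. coeff p k * a (n + k))"

lemma shift_op_eq_sum:
  assumes "degree p \<le> N"
  shows "shift_op p a n = (\<Sum>k\<le>N. coeff p k * a (n + k))"
  unfolding shift_op_def
  by (rule sum.mono_neutral_left) (use assms in \<open>auto simp: coeff_eq_0\<close>)

lemma shift_op_0 [simp]: "shift_op 0 a n = 0"
  by (simp add: shift_op_def)

lemma shift_op_pCons [simp]: "shift_op (pCons c p) a n = c * a n + shift_op p a (Suc n)"
proof -
  have "shift_op (pCons c p) a n = (\<Sum>k\<le>Suc (degree p). coeff (pCons c p) k * a (n + k))"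
    by (rule shift_op_eq_sum) (simp add: degree_pCons_le)
  also have "\<dots> = c * a n + (\<Sum>k\<le>degree p. coeff p k * a (Suc n + k))"
    by (subst sum.atMost_Suc_shift) simp
  finally show ?thesis by (simp add: shift_op_def)
qed

lemma shift_op_add: "shift_op (p + q) a n = shift_op p a n + shift_op q a n"
proof -
  let ?N = "max (degree p) (degree q)"
  have "shift_op (p + q) a n = (\<Sum>k\<le>?N. coeff (p + q) k * a (n + k))"
    by (rule shift_op_eq_sum) (simp add: degree_add_le)
  then show ?thesis
    by (simp add: shift_op_eq_sum[where N = ?N] sum.distrib algebra_simps)
qed

lemma shift_op_smult: "shift_op (smult c p) a n = c * shift_op p a n"
  by (induction p arbitrary: n) (simp_all add: algebra_simps)

text \<open>Polynomials act on sequences, the variable acting as the shift. Multiplicativity turns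
  each factorisation of \<open>p\<close> into a succession of recurrences.\<close>

lemma shift_op_mult: "shift_op (p * q) a n = shift_op p (shift_op q a) n"
  by (induction p arbitrary: n) (simp_all add: mult_pCons_left shift_op_add shift_op_smult)

lemma shift_op_diff_seq: "shift_op p (\<lambda>n. a n - b n) n = shift_op p a n - shift_op p b n"
  by (simp add: shift_op_def sum_subtractf algebra_simps)

lemma shift_op_geometric: "shift_op p (\<lambda>n. t * x ^ n) n = t * x ^ n * poly p x"
  by (induction p arbitrary: n) (simp_all add: algebra_simps)

lemma shift_op_tendsto_0:
  fixes a :: "nat \<Rightarrow> complex"
  assumes "a \<longlonglongrightarrow> 0"
  shows "shift_op p a \<longlonglongrightarrow> 0"
proof (induction p)
  case 0
  then show ?case by (simp add: shift_op_def)
next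
  case (pCons c p)
  have "(\<lambda>n. c * a n + shift_op p a (Suc n)) \<longlonglongrightarrow> c * 0 + 0"
    using pCons(2)[THEN LIMSEQ_Suc] by (intro tendsto_intros assms) auto
  then show ?case by (simp add: fun_eq_iff[symmetric])
qed

lemma shift_op_Ints:
  assumes "\<forall>i. coeff p i \<in> \<int>" "\<forall>n. a n \<in> \<int>"
  shows "shift_op p a n \<in> \<int>"
  unfolding shift_op_def using assms by (auto intro!: Ints_mult Ints_sum)

lemma synthetic_div_root:
  fixes p :: "'b::comm_ring_1 poly"
  assumes "poly p x = 0"
  shows "p = [:- x, 1:] * synthetic_div p x"
  using synthetic_div_correct'[of x p] assms by simp

text \<open>By Horner's scheme the coefficients of \<open>synthetic_div p x\<close> are integer
  polynomials in \<open>x\<close>. One polynomial \<open>r\<close> serves all \<open>x\<close> at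
  once, so nonvanishing at one root of \<open>p\<close> can be carried over to a conjugate.\<close>

lemma shift_op_synthetic_div_poly:
  fixes p :: "complex poly"
  assumes "\<forall>i. coeff p i \<in> \<int>" "\<forall>n. a n \<in> \<int>"
  shows "\<exists>r. (\<forall>i. coeff r i \<in> \<int>) \<and> (\<forall>x. poly r x = shift_op (synthetic_div p x) a n)"
  using assms(1)
proof (induction p arbitrary: n)
  case 0
  then show ?case by (intro exI[of _ 0]) auto
next
  case (pCons c p)
  have p: "\<forall>i. coeff p i \<in> \<int>"
    using pCons(3) by (metis coeff_pCons_Suc)
  then obtain r where r: "\<forall>i. coeff r i \<in> \<int>"
    "\<forall>x. poly r x = shift_op (synthetic_div p x) a (Suc n)"
    using pCons(2) by blast
  show ?case
    using r p assms(2) by (intro exI[of _ "smult (a n) p + r"]) (auto simp: mult.commute)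
qed

lemma small_Int_eq_0:
  assumes "z \<in> \<int>" "cmod z < 1"
  shows "z = 0"
  using assms by (auto elim!: Ints_cases)

text \<open>The recurrence kills \<open>t * x ^ n\<close>, so applied to \<open>a\<close> it yields
  integers that tend to \<open>0\<close>.\<close>

lemma eventually_shift_op_0:
  fixes p :: "complex poly"
  assumes int: "\<forall>i. coeff p i \<in> \<int>" and root: "poly p x = 0"
    and a: "\<forall>n. a n \<in> \<int>" and lim: "(\<lambda>n. t * x ^ n - a n) \<longlonglongrightarrow> 0"
  shows "\<exists>N. \<forall>n\<ge>N. shift_op p a n = 0"
proof -
  have eq: "shift_op p (\<lambda>n. t * x ^ n - a n) n = - shift_op p a n" for n
    by (simp add: shift_op_diff_seq shift_op_geometric root)
  have "shift_op p (\<lambda>n. t * x ^ n - a n) = (\<lambda>n. - shift_op p a n)"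
    by (rule ext, rule eq)
  then have "(\<lambda>n. - shift_op p a n) \<longlonglongrightarrow> 0"
    using shift_op_tendsto_0[OF lim, of p] by metis
  from tendsto_minus[OF this] have "(\<lambda>n. shift_op p a n) \<longlonglongrightarrow> 0" by simp
  then have "eventually (\<lambda>n. cmod (shift_op p a n) < 1) sequentially"
    using tendstoD[of "shift_op p a" 0 sequentially 1] by (simp add: dist_norm)
  then show ?thesis
    using small_Int_eq_0 shift_op_Ints[OF int a] unfolding eventually_sequentially by blast
qed

text \<open>
  With \<open>p = (X - x) q\<^sub>x\<close>, the sequence \<open>q\<^sub>x(shift) a\<close> is eventually geometric with ratio \<open>x\<close> for
  every root \<open>x\<close>, and its starting value is an integer polynomial in \<open>x\<close>: that polynomial
  does not vanish at \<open>\<theta>\<close>, hence not at the conjugate \<open>z\<close>, where the sequence tends to \<open>0\<close>.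
\<close>
lemma conjugate_norm_less_1:
  fixes p :: "complex poly" and \<theta> :: complex
  assumes int: "\<forall>i. coeff p i \<in> \<int>" and roots: "poly p \<theta> = 0" "poly p z = 0" "z \<noteq> \<theta>"
    and simple: "poly (pderiv p) \<theta> \<noteq> 0" and \<theta>: "cmod \<theta> > 1" and t: "t \<noteq> 0"
    and a: "\<forall>n. a n \<in> \<int>" and lim: "(\<lambda>n. t * \<theta> ^ n - a n) \<longlonglongrightarrow> 0"
    and conj: "\<And>r. (\<forall>i. coeff r i \<in> \<int>) \<Longrightarrow> poly r z = 0 \<Longrightarrow> poly r \<theta> = 0"
  shows "cmod z < 1"
proof -
  define R where "R n x = shift_op (synthetic_div p x) a n" for n x
  obtain N where N: "\<And>n. n \<ge> N \<Longrightarrow> shift_op p a n = 0"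
    using eventually_shift_op_0[OF int roots(1) a lim] by blast
  obtain r where r: "\<forall>i. coeff r i \<in> \<int>" "\<And>x. poly r x = R N x"
    using shift_op_synthetic_div_poly[OF int a, of N] unfolding R_def by blast
  have geo: "R (N + m) x = x ^ m * R N x" if "poly p x = 0" for m x
  proof (induction m)
    case (Suc m)
    have "shift_op p a (N + m) = - x * R (N + m) x + R (Suc (N + m)) x"
      by (subst synthetic_div_root[OF that])
         (simp add: R_def shift_op_mult del: mult_pCons_left)
    then show ?case using N[of "N + m"] Suc by (simp add: algebra_simps)
  qed simp
  have err: "(\<lambda>n. t * \<theta> ^ n * poly (synthetic_div p x) \<theta> - R n x) \<longlonglongrightarrow> 0" for x
  proof -
    have "(\<lambda>n. t * \<theta> ^ n * poly (synthetic_div p x) \<theta> - R n x) = shift_op (synthetic_div p x) (\<lambda>n. t * \<theta> ^ n - a n)"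
      by (simp add: fun_eq_iff R_def shift_op_diff_seq shift_op_geometric)
    then show ?thesis using shift_op_tendsto_0[OF lim] by simp
  qed
  have "poly (synthetic_div p \<theta>) \<theta> = poly (pderiv p) \<theta>"
    by (subst (2) synthetic_div_root[OF roots(1)]) (simp add: pderiv_mult pderiv_pCons del: mult_pCons_left)
  then have s\<theta>: "poly (synthetic_div p \<theta>) \<theta> \<noteq> 0" using simple by simp
  \<comment> \<open>Otherwise \<open>R n \<theta>\<close> is \<open>0\<close> from \<open>N\<close>
    on, and \<open>err\<close> forces \<open>t * \<theta> ^ n\<close> times the derivative at
    \<theta> to tend to \<open>0\<close>, against the simplicity of the root and
    \<open>cmod \<theta> > 1\<close>.\<close>
  have "R N \<theta> \<noteq> 0"
  proof
    assume 0: "R N \<theta> = 0"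
    let ?c = "t * poly (synthetic_div p \<theta>) \<theta>"
    have "eventually (\<lambda>n. cmod (t * \<theta> ^ n * poly (synthetic_div p \<theta>) \<theta> - R n \<theta>) < cmod ?c) sequentially"
      using tendstoD[OF err[of \<theta>], of "cmod ?c"] t s\<theta> by (simp add: dist_norm)
    then obtain M where "cmod (t * \<theta> ^ n * poly (synthetic_div p \<theta>) \<theta> - R n \<theta>) < cmod ?c" if "n \<ge> M" for n
      unfolding eventually_sequentially by blast
    from this[of "N + M"] have "cmod ?c * cmod \<theta> ^ (N + M) < cmod ?c"
      using geo[OF roots(1), of M] 0 by (simp add: norm_mult norm_power algebra_simps)
    moreover have "1 \<le> cmod \<theta> ^ (N + M)" using \<theta> by (intro one_le_power) simp
    ultimately show False
      using mult_left_mono[of 1 "cmod \<theta> ^ (N + M)" "cmod ?c"] by simp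
  qed
  then have rz: "R N z \<noteq> 0" using conj[OF r(1)] r(2) by auto
  \<comment> \<open>Since \<open>z\<close> differs from \<theta>, the quotient by
    \<open>X - z\<close> still vanishes at \<theta>. The main term of \<open>err\<close> disappears,
    so the geometric sequence \<open>R n z\<close> with nonzero start tends to
    \<open>0\<close>.\<close>
  have "(\<theta> - z) * poly (synthetic_div p z) \<theta> = poly p \<theta>"
    by (subst (2) synthetic_div_root[OF roots(2)]) (simp add: algebra_simps)
  then have "poly (synthetic_div p z) \<theta> = 0" using roots by simp
  then have "(\<lambda>n. R n z) \<longlonglongrightarrow> 0" using err[of z] tendsto_minus[of "\<lambda>n. - R n z" 0] by simp
  then have "(\<lambda>m. R (m + N) z) \<longlonglongrightarrow> 0" by (rule LIMSEQ_ignore_initial_segment)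
  then have "(\<lambda>m. z ^ m * R N z) \<longlonglongrightarrow> 0" using geo[OF roots(2)] by (simp add: add.commute)
  then have "eventually (\<lambda>m. cmod (z ^ m * R N z) < cmod (R N z)) sequentially"
    using tendstoD[of "\<lambda>m. z ^ m * R N z" 0 sequentially "cmod (R N z)"] rz by (simp add: dist_norm)
  then obtain m where "cmod (z ^ m * R N z) < cmod (R N z)"
    using eventually_happens by force
  then have "cmod z ^ m < 1" using rz by (simp add: norm_mult norm_power)
  then show ?thesis by (meson not_le one_le_power)
qed

text \<open>The partial sums of \<open>cmod (e i)\<close> and \<open>cmod (e (Suc i))\<close> differ
  only by bounded boundary terms. The triangle inequality, used in one direction for
  \<open>cmod z < 1\<close> and in the other for \<open>cmod z > 1\<close>, can thus be solved for
  the partial sum.\<close>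

lemma summable_norm_recurrence:
  fixes e :: "nat \<Rightarrow> complex"
  assumes bdd: "\<And>n. cmod (e n) \<le> B" and z: "cmod z \<noteq> 1"
    and summ: "summable (\<lambda>n. cmod (e (Suc n) - z * e n))"
  shows "summable (\<lambda>n. cmod (e n))"
proof -
  define h where "h n = cmod (e (Suc n) - z * e n)" for n
  have B: "0 \<le> B" using bdd[of 0] norm_ge_zero order_trans by blast
  have hS: "(\<Sum>i<n. h i) \<le> suminf h" for n
    using summ unfolding h_def[symmetric] by (intro sum_le_suminf) (auto simp: h_def)
  have tel: "(\<Sum>i<n. cmod (e (Suc i))) = (\<Sum>i<n. cmod (e i)) + cmod (e n) - cmod (e 0)" for n
    by (induction n) auto
  have "\<exists>K. \<forall>n. (\<Sum>i<n. cmod (e i)) \<le> K"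
  proof (cases "cmod z < 1")
    case True
    have "(\<Sum>i<n. cmod (e i)) \<le> (suminf h + B) / (1 - cmod z)" for n
    proof -
      have "cmod (e (Suc i)) \<le> h i + cmod z * cmod (e i)" for i
        using norm_triangle_ineq[of "e (Suc i) - z * e i" "z * e i"] by (simp add: h_def norm_mult)
      then have "(\<Sum>i<n. cmod (e (Suc i))) \<le> (\<Sum>i<n. h i + cmod z * cmod (e i))"
        by (intro sum_mono)
      then have "(\<Sum>i<n. cmod (e i)) + cmod (e n) - cmod (e 0) \<le> suminf h + cmod z * (\<Sum>i<n. cmod (e i))"
        using hS[of n] tel by (simp add: sum.distrib sum_distrib_left)
      then have "(1 - cmod z) * (\<Sum>i<n. cmod (e i)) \<le> suminf h + B"
        using bdd[of 0] norm_ge_zero[of "e n"] unfolding left_diff_distrib by linarith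
      then show ?thesis using True by (simp add: pos_le_divide_eq mult.commute)
    qed
    then show ?thesis by blast
  next
    case False
    then have z1: "cmod z > 1" using z by simp
    have "(\<Sum>i<n. cmod (e i)) \<le> (suminf h + B) / (cmod z - 1)" for n
    proof -
      have "cmod z * cmod (e i) \<le> h i + cmod (e (Suc i))" for i
        using norm_triangle_ineq4[of "e (Suc i)" "e (Suc i) - z * e i"] by (simp add: h_def norm_mult)
      then have "(\<Sum>i<n. cmod z * cmod (e i)) \<le> (\<Sum>i<n. h i + cmod (e (Suc i)))"
        by (intro sum_mono)
      then have "cmod z * (\<Sum>i<n. cmod (e i)) \<le> suminf h + ((\<Sum>i<n. cmod (e i)) + cmod (e n) - cmod (e 0))"
        using hS[of n] tel by (simp add: sum.distrib sum_distrib_left)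
      then have "(cmod z - 1) * (\<Sum>i<n. cmod (e i)) \<le> suminf h + B"
        using bdd[of n] norm_ge_zero[of "e 0"] unfolding left_diff_distrib by linarith
      then show ?thesis using z1 by (simp add: pos_le_divide_eq mult.commute)
    qed
    then show ?thesis by blast
  qed
  then obtain K where K: "\<And>n. (\<Sum>i<n. cmod (e i)) \<le> K" by blast
  have "(\<Sum>i\<le>n. cmod (e i)) \<le> K" for n
    using K[of "Suc n"] by (simp only: lessThan_Suc_atMost)
  then show ?thesis by (intro bounded_imp_summable[of _ K]) auto
qed

text \<open>Linear factors are split off one at a time: with \<open>p = q * (X - z)\<close>, the
  sequence obtained from \<open>e\<close> by \<open>X - z\<close> is again bounded, and induction on
  the degree applies to it with \<open>q\<close>.\<close>

lemma summable_shift_op_imp: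
  fixes p :: "complex poly"
  assumes "p \<noteq> 0" "\<And>z. poly p z = 0 \<Longrightarrow> cmod z \<noteq> 1"
    and "\<And>n. cmod (e n) \<le> B" "summable (\<lambda>n. cmod (shift_op p e n))"
  shows "summable (\<lambda>n. cmod (e n))"
  using assms
proof (induction "degree p" arbitrary: p e B rule: less_induct)
  case less
  show ?case
  proof (cases "degree p = 0")
    case True
    then obtain c where c: "p = [:c:]" using degree_0_id by metis
    then have "c \<noteq> 0" using less(2) by simp
    then show ?thesis using less(5) by (simp add: c norm_mult summable_cmult_iff)
  next
    case False
    then have "\<not> constant (poly p)" by (simp add: constant_degree)
    then obtain z where z: "poly p z = 0"
      using fundamental_theorem_of_algebra by blast
    define q where "q = synthetic_div p z"
    define h where "h = shift_op [:- z, 1:] e"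
    have pq: "p = q * [:- z, 1:]"
      using synthetic_div_root[OF z] by (metis q_def mult.commute)
    have h: "h n = e (Suc n) - z * e n" for n by (simp add: h_def)
    have "summable (\<lambda>n. cmod (h n))"
    proof (rule less(1)[of q])
      show "degree q < degree p" using False by (simp add: q_def degree_synthetic_div)
      show "q \<noteq> 0" using pq less(2) by auto
      show "cmod y \<noteq> 1" if "poly q y = 0" for y
        using that less(3)[of y] by (simp add: pq)
      show "cmod (h n) \<le> B + cmod z * B" for n
        unfolding h
        by (rule order_trans[OF norm_triangle_ineq4])
           (use less(4) in \<open>auto simp: norm_mult intro!: add_mono mult_left_mono\<close>)
      show "summable (\<lambda>n. cmod (shift_op q h n))"
        using less(5) by (simp only: pq shift_op_mult h_def)
    qed
    then show ?thesis
      by (intro summable_norm_recurrence[OF less(4) less(3)[OF z]]) (simp add: h)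
  qed
qed

section \<open>Rational polynomials, their integer multiples and conjugate roots\<close>

lemma poly_of_rat_add:
  "poly (map_poly (of_rat :: rat \<Rightarrow> 'b::field_char_0) (p + q)) x = poly (map_poly of_rat p) x + poly (map_poly of_rat q) x"
proof (induction p arbitrary: q)
  case (pCons a p)
  obtain b r where q: "q = pCons b r" by (cases q)
  have "poly (map_poly (of_rat :: rat \<Rightarrow> 'b) (pCons a p + q)) x
      = of_rat a + of_rat b + x * (poly (map_poly of_rat p) x + poly (map_poly of_rat r) x)"
    using pCons(2)[of r] by (simp add: q map_poly_pCons of_rat_add)
  then show ?case by (simp add: q map_poly_pCons algebra_simps)
qed simp

lemma poly_of_rat_smult:
  "poly (map_poly (of_rat :: rat \<Rightarrow> 'b::field_char_0) (smult c p)) x = of_rat c * poly (map_poly of_rat p) x"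
  by (induction p) (simp_all add: map_poly_pCons of_rat_mult algebra_simps)

lemma poly_of_rat_mult:
  "poly (map_poly (of_rat :: rat \<Rightarrow> 'b::field_char_0) (p * q)) x = poly (map_poly of_rat p) x * poly (map_poly of_rat q) x"
  by (induction p) (simp_all add: map_poly_pCons poly_of_rat_add poly_of_rat_smult mult_pCons_left algebra_simps)

lemma poly_of_rat_complex_of_real:
  "poly (map_poly of_rat p) (complex_of_real x) = of_real (poly (map_poly of_rat p) x)"
proof (induction p)
  case (pCons a p)
  have "complex_of_rat a = complex_of_real (real_of_rat a)"
    by (cases a) (simp add: of_rat_rat)
  then show ?case using pCons by (simp add: map_poly_pCons)
qed simp

lemma pderiv_map_of_rat:
  "pderiv (map_poly (of_rat :: rat \<Rightarrow> 'b::field_char_0) p) = map_poly of_rat (pderiv p)"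
  by (rule poly_eqI) (simp add: coeff_pderiv coeff_map_poly of_rat_mult of_rat_add)

text \<open>Otherwise \<open>p\<close> and \<open>r\<close> are coprime, and a Bezout identity
  evaluated at \<open>x\<close> reads \<open>0 = 1\<close>.\<close>

lemma irreducible_dvd_if_common_root:
  fixes x :: "'b::field_char_0"
  assumes "irreducible p" "poly (map_poly of_rat p) x = 0" "poly (map_poly of_rat r) x = 0"
  shows "p dvd r"
proof (rule ccontr)
  assume "\<not> p dvd r"
  moreover have "prime_elem p"
    using assms(1) by (rule irreducible_imp_prime_poly)
  ultimately have "coprime p r" by (simp add: prime_elem_imp_coprime)
  then have "gcd p r = 1" by simp
  then obtain u v where uv: "u * p + v * r = 1"
    using bezout_coefficients_fst_snd[of p r] by metis
  have "poly (map_poly of_rat (u * p + v * r)) x = 0"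
    by (simp add: poly_of_rat_add poly_of_rat_mult assms(2,3))
  then show False unfolding uv by (simp add: map_poly_1)
qed

lemma common_denominator:
  fixes p :: "rat poly"
  obtains c :: int where "c \<noteq> 0" "\<forall>i. of_int c * coeff p i \<in> \<int>"
proof -
  have "\<exists>c::int. c \<noteq> 0 \<and> (\<forall>i. of_int c * coeff p i \<in> \<int>)"
  proof (induction p)
    case 0
    then show ?case by (intro exI[of _ 1]) auto
  next
    case (pCons a p)
    then obtain c :: int where c: "c \<noteq> 0" "\<forall>i. of_int c * coeff p i \<in> \<int>" by blast
    obtain m n where mn: "quotient_of a = (m, n)" by force
    have n: "n > 0" "a = of_int m / of_int n"
      using quotient_of_denom_pos[OF mn] quotient_of_div[OF mn] by auto
    have "of_int (n * c) * coeff (pCons a p) i \<in> \<int>" for i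
    proof (cases i)
      case 0
      have "of_int (n * c) * a = of_int (c * m)" using n by simp
      then show ?thesis using 0 by (metis Ints_of_int coeff_pCons_0)
    next
      case (Suc j)
      have "of_int c * coeff p j \<in> \<int>" using c by blast
      then have "of_int n * (of_int c * coeff p j) \<in> \<int>"
        by (rule Ints_mult[OF Ints_of_int])
      then show ?thesis unfolding Suc coeff_pCons_Suc by (simp only: of_int_mult mult.assoc)
    qed
    moreover have "n * c \<noteq> 0" using n c by simp
    ultimately show ?case by blast
  qed
  then show thesis using that by blast
qed

text \<open>Denominators are cleared, and roots are simple because a common root with the derivative
  would make \<open>p\<close> divide a nonzero polynomial of smaller degree. The result is a complex
  polynomial with integral coefficients, the form to which \<open>shift_op\<close> and the
  fundamental theorem of algebra apply.\<close>

lemma integer_multiple_of_rat_poly: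
  fixes p :: "rat poly"
  assumes "irreducible p"
  obtains P :: "complex poly" where "\<forall>i. coeff P i \<in> \<int>" "P \<noteq> 0"
    "\<And>x. poly P x = 0 \<longleftrightarrow> poly (map_poly of_rat p) x = 0"
    "\<And>x. poly (map_poly of_rat p) x = 0 \<Longrightarrow> poly (pderiv P) x \<noteq> 0"
proof -
  obtain c :: int where c: "c \<noteq> 0" "\<forall>i. of_int c * coeff p i \<in> \<int>"
    using common_denominator[of p] .
  define P :: "complex poly" where "P = map_poly of_rat (smult (of_int c) p)"
  have deg: "degree p > 0"
  proof (rule ccontr)
    assume "\<not> degree p > 0"
    then have "is_unit p" using assms by (auto simp: is_unit_iff_degree irreducible_def)
    then show False using assms by (simp add: irreducible_def)
  qed
  show thesis
  proof (rule that[of P])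
    show "\<forall>i. coeff P i \<in> \<int>"
    proof
      fix i
      obtain k where "of_int c * coeff p i = of_int k" using c(2) Ints_cases by metis
      then have "coeff P i = of_int k" by (simp add: P_def coeff_map_poly)
      then show "coeff P i \<in> \<int>" by simp
    qed
    have "coeff P (degree p) \<noteq> 0" using c deg by (auto simp: P_def coeff_map_poly)
    then show "P \<noteq> 0" by auto
    show "poly P x = 0 \<longleftrightarrow> poly (map_poly of_rat p) x = 0" for x
      using c(1) by (simp add: P_def poly_of_rat_smult)
    show "poly (pderiv P) x \<noteq> 0" if "poly (map_poly of_rat p) x = 0" for x
    proof
      assume "poly (pderiv P) x = 0"
      then have "poly (map_poly of_rat (pderiv p)) x = 0"
        using c(1) by (simp add: P_def pderiv_map_of_rat pderiv_smult poly_of_rat_smult)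
      then have "p dvd pderiv p" using irreducible_dvd_if_common_root[OF assms that] by blast
      moreover have "pderiv p \<noteq> 0" using deg by (simp add: pderiv_eq_0_iff)
      ultimately have "degree p \<le> degree (pderiv p)" by (rule dvd_imp_degree_le)
      then show False using deg by (simp add: degree_pderiv)
    qed
  qed
qed

text \<open>The algebraic substitute for a Galois automorphism; it discharges the hypothesis
  \<open>conj\<close> of \<open>conjugate_norm_less_1\<close>.\<close>

lemma integer_poly_conjugate_root:
  fixes r :: "complex poly"
  assumes "irreducible p" "poly (map_poly of_rat p) z = 0" "poly (map_poly of_rat p) x = 0"
    and "\<forall>i. coeff r i \<in> \<int>" "poly r z = 0"
  shows "poly r x = 0"
proof -
  \<comment> \<open>The floor of the real part merely reads off the integer behind each complex
    coefficient.\<close>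
  define R :: "rat poly" where "R = map_poly (\<lambda>y. of_int \<lfloor>Re y\<rfloor>) r"
  have "coeff (map_poly of_rat R) i = coeff r i" for i
  proof -
    obtain k where "coeff r i = of_int k" using assms(4) Ints_cases by metis
    then show ?thesis by (simp add: R_def coeff_map_poly)
  qed
  then have R: "map_poly of_rat R = r" by (rule poly_eqI)
  then have "p dvd R" using irreducible_dvd_if_common_root assms by metis
  then obtain s where "R = p * s" by auto
  then show ?thesis using R poly_of_rat_mult[of p s x] assms(3) by simp
qed

text \<open>The chord from \<open>1\<close> to the point of the unit circle at angle
  \<open>2 * pi * t\<close>. It is comparable with the distance from \<open>t\<close> to the nearest
  integer, is subadditive, and is what an eigenfunction equation produces directly.\<close>

definition circle_dist :: "real \<Rightarrow> real" where
  "circle_dist t = cmod (cis (2 * pi * t) - 1)"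

lemma circle_dist_nonneg [simp]: "circle_dist t \<ge> 0"
  by (simp add: circle_dist_def)

lemma circle_dist_minus [simp]: "circle_dist (- t) = circle_dist t"
proof -
  have "cnj (cis (2 * pi * t) - 1) = cis (2 * pi * (- t)) - 1" by (simp add: cis_cnj)
  then show ?thesis unfolding circle_dist_def by (metis complex_mod_cnj)
qed

lemma circle_dist_add: "circle_dist (s + t) \<le> circle_dist s + circle_dist t"
proof -
  have "cis (2 * pi * (s + t)) - 1 = cis (2 * pi * s) * (cis (2 * pi * t) - 1) + (cis (2 * pi * s) - 1)"
    by (simp add: algebra_simps cis_mult)
  also have "cmod \<dots> \<le> cmod (cis (2 * pi * s) * (cis (2 * pi * t) - 1)) + cmod (cis (2 * pi * s) - 1)"
    by (rule norm_triangle_ineq)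
  finally show ?thesis by (simp add: circle_dist_def norm_mult)
qed

lemma circle_dist_sum: "circle_dist (\<Sum>i\<in>I. f i) \<le> (\<Sum>i\<in>I. circle_dist (f i))"
proof (induction I rule: infinite_finite_induct)
  case (insert i I)
  then show ?case using circle_dist_add[of "f i" "sum f I"] by simp
qed (simp_all add: circle_dist_def)

lemma circle_dist_diff: "circle_dist (s - t) = cmod (cis (2 * pi * s) - cis (2 * pi * t))"
proof -
  have "cis (2 * pi * s) - cis (2 * pi * t) = cis (2 * pi * t) * (cis (2 * pi * (s - t)) - 1)"
    by (simp add: algebra_simps cis_mult)
  then show ?thesis by (simp add: circle_dist_def norm_mult)
qed

lemma circle_dist_eq_sin: "circle_dist t = 2 * \<bar>sin (pi * t)\<bar>"
proof -
  have "cis (2 * pi * t) - 1 = cis (pi * t) * (cis (pi * t) - cis (- (pi * t)))"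
    by (simp add: algebra_simps cis_mult)
  also have "cis (pi * t) - cis (- (pi * t)) = 2 * \<i> * sin (pi * t)"
    by (simp add: complex_eq_iff)
  finally show ?thesis by (simp add: circle_dist_def norm_mult)
qed

lemma circle_dist_le: "circle_dist t \<le> 2 * pi * \<bar>t\<bar>"
  using abs_sin_x_le_abs_x[of "pi * t"] by (simp add: circle_dist_eq_sin abs_mult)

text \<open>The constant is the one that gives \<open>\<bar>s\<bar> \<le> circle_dist s\<close>
  after substituting \<open>y = pi * s\<close>; it is generous enough for a crude Taylor
  estimate.\<close>

lemma abs_le_abs_sin:
  assumes "\<bar>y\<bar> \<le> pi / 2"
  shows "\<bar>y\<bar> \<le> 2 * pi * \<bar>sin y\<bar>"
proof -
  have pos: "y \<le> 2 * pi * sin y" if y: "0 \<le> y" "y \<le> pi / 2" for y :: real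
  proof -
    \<comment> \<open>Halving brings the angle into the unit interval, where the cubic Taylor error
      is at most \<open>x / 6\<close>; monotonicity of the sine returns to \<open>y\<close>.\<close>
    define x where "x = y / 2"
    have x: "0 \<le> x" "x \<le> 1" using y pi_less_4 by (auto simp: x_def)
    have "\<bar>sin x - x\<bar> \<le> inverse 6 * x ^ 3"
      using Maclaurin_sin_bound[of x 3] x by (simp add: eval_nat_numeral sin_coeff_def)
    moreover have "x ^ 3 \<le> x" using x power_decreasing[of 1 3 x] by simp
    then have "inverse 6 * x ^ 3 \<le> x / 6" by simp
    ultimately have "x \<le> 2 * sin x" using x by linarith
    moreover have "sin x \<le> sin y" using y by (intro sin_monotone_2pi_le) (auto simp: x_def)
    ultimately have "y \<le> 4 * sin y" by (simp add: x_def)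
    also have "\<dots> \<le> 2 * pi * sin y"
      using pi_ge_two y by (intro mult_right_mono sin_ge_zero) auto
    finally show ?thesis .
  qed
  show ?thesis
  proof (cases "0 \<le> y")
    case True
    then show ?thesis using pos[of y] assms sin_ge_zero[of y] by simp
  next
    case False
    then show ?thesis using pos[of "- y"] assms sin_ge_zero[of "- y"] by simp
  qed
qed

lemma circle_dist_nearest_int:
  "\<bar>t - of_int (round t)\<bar> \<le> circle_dist t" "circle_dist t \<le> 2 * pi * \<bar>t - of_int (round t)\<bar>"
proof -
  define s where "s = t - of_int (round t)"
  have "cis (2 * pi * t) = cis (2 * pi * s + 2 * pi * of_int (round t))"
    by (simp add: s_def algebra_simps)
  also have "\<dots> = cis (2 * pi * s)"
    by (simp add: cis_multiple_2pi flip: cis_mult)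
  finally have eq: "circle_dist t = circle_dist s" by (simp add: circle_dist_def)
  have "\<bar>s\<bar> \<le> 1 / 2" using of_int_round_abs_le[of t] by (simp add: s_def abs_minus_commute)
  then have "pi * \<bar>s\<bar> \<le> pi * (1 / 2)" by (intro mult_left_mono) auto
  then have "\<bar>pi * s\<bar> \<le> pi / 2" by (simp add: abs_mult)
  from abs_le_abs_sin[OF this] have "\<bar>s\<bar> \<le> circle_dist s"
    by (simp add: circle_dist_eq_sin abs_mult)
  then show "\<bar>t - of_int (round t)\<bar> \<le> circle_dist t" by (simp add: eq flip: s_def)
  show "circle_dist t \<le> 2 * pi * \<bar>t - of_int (round t)\<bar>"
    using circle_dist_le[of s] by (simp add: eq flip: s_def)
qed

text \<open>\<open>conjugate_norm_less_1\<close> for the integers nearest to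
  \<open>t * \<theta> ^ n\<close>. Negative \<theta> is included, as summability is later needed for
  \<theta> itself.\<close>

lemma pisot_conjugates:
  fixes \<theta> t :: real
  assumes \<theta>: "\<bar>\<theta>\<bar> > 1" and t: "t \<noteq> 0" and lim: "(\<lambda>n. circle_dist (t * \<theta> ^ n)) \<longlonglongrightarrow> 0"
    and p: "irreducible p" "poly (map_poly of_rat p) \<theta> = 0" "poly (map_poly of_rat p) z = 0"
    and z: "z \<noteq> complex_of_real \<theta>"
  shows "cmod z < 1"
proof -
  obtain P :: "complex poly" where P: "\<forall>i. coeff P i \<in> \<int>" "P \<noteq> 0"
    "\<And>x. poly P x = 0 \<longleftrightarrow> poly (map_poly of_rat p) x = 0"
    "\<And>x. poly (map_poly of_rat p) x = 0 \<Longrightarrow> poly (pderiv P) x \<noteq> 0"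
    using integer_multiple_of_rat_poly[OF p(1)] by metis
  have p\<theta>: "poly (map_poly of_rat p) (complex_of_real \<theta>) = 0"
    using p(2) by (simp add: poly_of_rat_complex_of_real)
  define a :: "nat \<Rightarrow> complex" where "a n = of_int (round (t * \<theta> ^ n))" for n
  have "(\<lambda>n. complex_of_real t * of_real \<theta> ^ n - a n) \<longlonglongrightarrow> 0"
  proof (rule Lim_null_comparison[OF _ lim], rule always_eventually, rule allI)
    fix n
    have "complex_of_real t * of_real \<theta> ^ n - a n = of_real (t * \<theta> ^ n - of_int (round (t * \<theta> ^ n)))"
      by (simp add: a_def)
    then show "cmod (complex_of_real t * of_real \<theta> ^ n - a n) \<le> circle_dist (t * \<theta> ^ n)"
      using circle_dist_nearest_int(1) by (simp only: norm_of_real)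
  qed
  then show ?thesis
    using P p p\<theta> z \<theta> t
    by (intro conjugate_norm_less_1[of P "complex_of_real \<theta>" z "of_real t" a])
       (auto simp: a_def intro: integer_poly_conjugate_root[OF p(1,3) p\<theta>])
qed

lemma pisot_if_circle_dist_tendsto_0:
  fixes \<theta> t :: real
  assumes \<theta>: "\<bar>\<theta>\<bar> > 1" "algebraic_int \<theta>" and t: "t \<noteq> 0"
    and lim: "(\<lambda>n. circle_dist (t * \<theta> ^ n)) \<longlonglongrightarrow> 0"
  shows "pisot \<bar>\<theta>\<bar>"
  unfolding pisot_def
proof (intro conjI ballI impI)
  \<comment> \<open>The powers of \<theta> and of its absolute value agree up to sign, and
    \<open>circle_dist\<close> is even.\<close>
  have lim_abs: "(\<lambda>n. circle_dist (t * \<bar>\<theta>\<bar> ^ n)) \<longlonglongrightarrow> 0"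
  proof -
    have "circle_dist (t * \<bar>\<theta>\<bar> ^ n) = circle_dist (t * \<theta> ^ n)" for n
    proof -
      have "\<bar>\<theta>\<bar> ^ n = \<bar>\<theta> ^ n\<bar>" by (simp add: power_abs)
      then show ?thesis by (auto simp: abs_if)
    qed
    then show ?thesis using lim by simp
  qed
  show "cmod z < 1" if "z \<in> galois_conjugates \<bar>\<theta>\<bar>" "z \<noteq> of_real \<bar>\<theta>\<bar>" for z
    using that pisot_conjugates[of "\<bar>\<theta>\<bar>" t _ z] \<theta> t lim_abs
    unfolding galois_conjugates_def by auto
qed (use \<theta> in auto)

text \<open>A monic integer polynomial vanishing at \<theta> is factored over the rationals, and
  some prime factor must vanish there.\<close>

lemma irreducible_annihilator:
  assumes "algebraic_int (\<theta> :: real)"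
  obtains p :: "rat poly" where "irreducible p" "poly (map_poly of_rat p) \<theta> = 0"
proof -
  obtain P :: "int poly" where P: "poly (map_poly of_int P) \<theta> = 0" "lead_coeff P = 1"
    using assms by (auto simp: algebraic_int_altdef_ipoly)
  define p0 :: "rat poly" where "p0 = map_poly of_int P"
  have "map_poly of_rat p0 = (map_poly of_int P :: real poly)"
    by (rule poly_eqI) (simp add: p0_def coeff_map_poly)
  then have root: "poly (map_poly of_rat p0) \<theta> = 0" using P by simp
  have "coeff p0 (degree P) \<noteq> 0" using P by (simp add: p0_def coeff_map_poly)
  then have "p0 \<noteq> 0" by auto
  define A where "A = prime_factorization p0"
  have A: "prime_elem q" if "q \<in># A" for q
    using that in_prime_factors_imp_prime[of q p0] by (simp add: A_def)
  have "normalize (prod_mset A) = normalize p0"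
    using \<open>p0 \<noteq> 0\<close> by (simp add: A_def prod_mset_prime_factorization_weak)
  then have "p0 dvd prod_mset A" using associatedD1 by metis
  then have "poly (map_poly of_rat (prod_mset A)) \<theta> = 0"
    using root by (auto elim!: dvdE simp: poly_of_rat_mult)
  then have "\<exists>q\<in>#A. poly (map_poly of_rat q) \<theta> = 0"
    by (induction A) (auto simp: poly_of_rat_mult map_poly_1)
  then show thesis using A that prime_elem_imp_irreducible by blast
qed

text \<open>The rounding errors eventually satisfy the recurrence of \<open>P\<close>. Its roots are
  \<theta>, of modulus greater than \<open>1\<close>, and conjugates of modulus less than
  \<open>1\<close>, so this bounded solution is summable.\<close>

lemma summable_circle_dist:
  fixes \<theta> t :: real
  assumes \<theta>: "\<bar>\<theta>\<bar> > 1" "algebraic_int \<theta>"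
    and lim: "(\<lambda>n. circle_dist (t * \<theta> ^ n)) \<longlonglongrightarrow> 0"
  shows "summable (\<lambda>n. circle_dist (t * \<theta> ^ n))"
proof (cases "t = 0")
  case True
  then show ?thesis by (simp add: circle_dist_def)
next
  case False
  obtain p where p: "irreducible p" "poly (map_poly of_rat p) \<theta> = 0"
    using irreducible_annihilator[OF \<theta>(2)] .
  obtain P :: "complex poly" where P: "\<forall>i. coeff P i \<in> \<int>" "P \<noteq> 0"
    "\<And>x. poly P x = 0 \<longleftrightarrow> poly (map_poly of_rat p) x = 0"
    using integer_multiple_of_rat_poly[OF p(1)] by metis
  have root: "poly P (complex_of_real \<theta>) = 0"
    using p(2) by (simp add: P poly_of_rat_complex_of_real)
  define e where "e n = t * \<theta> ^ n - of_int (round (t * \<theta> ^ n))" for n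
  define a :: "nat \<Rightarrow> complex" where "a n = of_int (round (t * \<theta> ^ n))" for n
  have e: "complex_of_real (e n) = of_real t * of_real \<theta> ^ n - a n" for n
    by (simp add: e_def a_def)
  have e_le: "\<bar>e n\<bar> \<le> circle_dist (t * \<theta> ^ n)" "circle_dist (t * \<theta> ^ n) \<le> 2 * pi * \<bar>e n\<bar>" for n
    unfolding e_def by (rule circle_dist_nearest_int)+
  have "(\<lambda>n. complex_of_real (e n)) \<longlonglongrightarrow> 0"
    by (rule Lim_null_comparison[OF _ lim]) (use e_le in auto)
  then obtain N where "\<forall>n\<ge>N. shift_op P a n = 0"
    using eventually_shift_op_0[OF P(1) root, of a "of_real t"] by (auto simp: e a_def)
  then have N: "shift_op P (\<lambda>n. of_real (e n)) n = 0" if "n \<ge> N" for n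
    using that by (simp add: e shift_op_diff_seq shift_op_geometric root)
  have "summable (\<lambda>n. cmod (complex_of_real (e n)))"
  proof (rule summable_shift_op_imp[OF P(2)])
    show "cmod z \<noteq> 1" if "poly P z = 0" for z
      using pisot_conjugates[OF \<theta>(1) False lim p, of z] that \<theta>(1) by (cases "z = of_real \<theta>") (auto simp: P)
    show "cmod (complex_of_real (e n)) \<le> 1 / 2" for n
      unfolding norm_of_real using of_int_round_abs_le[of "t * \<theta> ^ n"]
      by (simp add: e_def abs_minus_commute)
    show "summable (\<lambda>n. cmod (shift_op P (\<lambda>n. complex_of_real (e n)) n))"
      by (rule summable_finite[of "{..<N}"]) (use N in auto)
  qed
  then have "summable (\<lambda>n. 2 * pi * \<bar>e n\<bar>)" by (intro summable_mult) simp
  then show ?thesis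
    by (rule summable_comparison_test'[where N = 0]) (use e_le in auto)
qed

section \<open>Tilings as coloured point sets\<close>

context prototiles
begin

lemma shift_tile_add [simp]: "shift_tile g (shift_tile h t) = shift_tile (g + h) t"
  by (simp add: shift_tile_def image_image add.assoc)

lemma shift_tile_0 [simp]: "shift_tile 0 t = t"
  by (simp add: shift_tile_def)

lemma shift_tiles_add [simp]: "shift_tiles g (shift_tiles h S) = shift_tiles (g + h) S"
  by (simp add: shift_tiles_def image_image)

lemma shift_tiles_0 [simp]: "shift_tiles 0 S = S"
  by (simp add: shift_tiles_def)

lemma Lam_shift [simp]: "(x, i) \<in> Lam (shift_tiles g S) \<longleftrightarrow> (x - g, i) \<in> Lam S"
proof -
  have "shift_tile x (prototile i) \<in> shift_tiles g S \<longleftrightarrow> shift_tile (x - g) (prototile i) \<in> S"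
  proof
    assume "shift_tile x (prototile i) \<in> shift_tiles g S"
    then obtain t where t: "t \<in> S" "shift_tile x (prototile i) = shift_tile g t"
      by (auto simp: shift_tiles_def)
    then have "shift_tile (- g) (shift_tile x (prototile i)) = shift_tile (- g) (shift_tile g t)"
      by (simp only:)
    then show "shift_tile (x - g) (prototile i) \<in> S"
      using t(1) by (simp add: uminus_add_conv_diff)
  next
    assume "shift_tile (x - g) (prototile i) \<in> S"
    then have "shift_tile g (shift_tile (x - g) (prototile i)) \<in> shift_tiles g S"
      unfolding shift_tiles_def by blast
    then show "shift_tile x (prototile i) \<in> shift_tiles g S" by simp
  qed
  then show ?thesis by (simp add: Lam_def)
qed

lemma subset_tilesE:
  assumes "S \<subseteq> tiles" "t \<in> S"
  obtains x i where "t = shift_tile x (prototile i)" "(x, i) \<in> Lam S"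
  using assms unfolding tiles_def Lam_def by blast

lemma shift_tile_prototile: "shift_tile x (prototile i) = ((+) x ` A i, i)"
  by (simp add: shift_tile_def prototile_def)

lemma mem_translation_iff: "z \<in> (+) x ` B \<longleftrightarrow> z - x \<in> B" for z x :: 'a
  by (auto simp: image_iff intro: bexI[of _ "z - x"])

lemma mem_interior_translation_iff: "z \<in> interior ((+) x ` B) \<longleftrightarrow> z - x \<in> interior B" for z x :: 'a
  by (simp add: interior_translation mem_translation_iff)

text \<open>Disjointness of interiors is phrased through a common interior point \<open>z\<close>,
  relative to each position; in this form it survives small perturbations of the positions and hence
  limits.\<close>

definition separated :: "('a \<times> 'k) set \<Rightarrow> bool" where
  "separated L \<longleftrightarrow> (\<forall>x i y j z. (x, i) \<in> L \<and> (y, j) \<in> L \<and> z - x \<in> interior (A i) \<and> z - y \<in> interior (A j) \<longrightarrow>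
     x = y \<and> i = j)"

definition covering :: "('a \<times> 'k) set \<Rightarrow> bool" where
  "covering L \<longleftrightarrow> (\<forall>z. \<exists>x i. (x, i) \<in> L \<and> z - x \<in> A i)"

lemma tiling_iff: "tiling S \<longleftrightarrow> S \<subseteq> tiles \<and> covering (Lam S) \<and> separated (Lam S)"
proof (cases "S \<subseteq> tiles")
  case True
  have "(\<Union>t\<in>S. fst t) = UNIV \<longleftrightarrow> covering (Lam S)"
  proof
    assume *: "(\<Union>t\<in>S. fst t) = UNIV"
    show "covering (Lam S)" unfolding covering_def
    proof
      fix z
      obtain t where t: "t \<in> S" "z \<in> fst t" using * by blast
      obtain x i where x: "t = shift_tile x (prototile i)" "(x, i) \<in> Lam S"
        using subset_tilesE[OF True t(1)] .
      with t(2) have "z - x \<in> A i" by (simp add: shift_tile_prototile mem_translation_iff)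
      with x show "\<exists>x i. (x, i) \<in> Lam S \<and> z - x \<in> A i" by blast
    qed
  next
    assume *: "covering (Lam S)"
    have "\<exists>t\<in>S. z \<in> fst t" for z
    proof -
      obtain x i where "(x, i) \<in> Lam S" "z - x \<in> A i" using * unfolding covering_def by blast
      then have "shift_tile x (prototile i) \<in> S" "z \<in> fst (shift_tile x (prototile i))"
        by (simp_all add: Lam_def shift_tile_prototile mem_translation_iff)
      then show ?thesis by blast
    qed
    then show "(\<Union>t\<in>S. fst t) = UNIV" by blast
  qed
  moreover have "disjoint_interiors S \<longleftrightarrow> separated (Lam S)"
  proof
    assume *: "disjoint_interiors S"
    show "separated (Lam S)" unfolding separated_def
    proof (intro allI impI, elim conjE)
      fix x i y j z
      assume L: "(x, i) \<in> Lam S" "(y, j) \<in> Lam S"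
        and z: "z - x \<in> interior (A i)" "z - y \<in> interior (A j)"
      have "z \<in> interior (fst (shift_tile x (prototile i))) \<inter> interior (fst (shift_tile y (prototile j)))"
        using z by (simp add: shift_tile_prototile mem_interior_translation_iff)
      then have "shift_tile x (prototile i) = shift_tile y (prototile j)"
        using * L unfolding disjoint_interiors_def Lam_def by blast
      then show "x = y \<and> i = j" by (simp add: shift_tile_inj_iff)
    qed
  next
    assume *: "separated (Lam S)"
    show "disjoint_interiors S" unfolding disjoint_interiors_def
    proof (intro ballI impI, rule ccontr)
      fix s t assume st: "s \<in> S" "t \<in> S" "s \<noteq> t" "interior (fst s) \<inter> interior (fst t) \<noteq> {}"
      obtain x i where x: "s = shift_tile x (prototile i)" "(x, i) \<in> Lam S"
        using subset_tilesE[OF True st(1)] .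
      obtain y j where y: "t = shift_tile y (prototile j)" "(y, j) \<in> Lam S"
        using subset_tilesE[OF True st(2)] .
      obtain z where "z - x \<in> interior (A i)" "z - y \<in> interior (A j)"
        using st(4) x(1) y(1) by (auto simp: shift_tile_prototile mem_interior_translation_iff)
      then have "x = y \<and> i = j" using * x(2) y(2) unfolding separated_def by blast
      then show False using st(3) x(1) y(1) by simp
    qed
  qed
  ultimately show ?thesis using True by (simp add: tiling_def)
qed (simp add: tiling_def)

definition tiles_of :: "('a \<times> 'k) set \<Rightarrow> ('a, 'k) tile set" where
  "tiles_of L = (\<lambda>(x, i). shift_tile x (prototile i)) ` L"

lemma Lam_tiles_of [simp]: "Lam (tiles_of L) = L"
  by (auto simp: Lam_def tiles_of_def shift_tile_inj_iff)

lemma tiles_of_subset: "tiles_of L \<subseteq> tiles"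
  by (auto simp: tiles_of_def tiles_def)

lemma tiling_tiles_of: "covering L \<Longrightarrow> separated L \<Longrightarrow> tiling (tiles_of L)"
  by (simp add: tiling_iff tiles_of_subset)

lemma Lam_inj:
  assumes "S1 \<subseteq> tiles" "S2 \<subseteq> tiles" "Lam S1 = Lam S2"
  shows "S1 = S2"
  using assms Lam_subset_imp by blast

lemma tiling_cover:
  assumes "tiling S"
  obtains x i where "(x, i) \<in> Lam S" "z - x \<in> A i"
  using assms unfolding tiling_iff covering_def by blast

text \<open>A tile is the closure of its interior, so an interior point of one tile lying in another
  is approximated by interior points of the other, and the interiors meet. It suffices to know that
  the second tile contains the point, possibly on its boundary.\<close>

lemma tiling_unique:
  assumes "tiling S" "(x, i) \<in> Lam S" "(y, j) \<in> Lam S" "z - x \<in> interior (A i)" "z - y \<in> A j"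
  shows "x = y \<and> i = j"
proof -
  have "z - y \<in> closure (interior (A j))" using assms(5) regular by simp
  moreover have "open ((\<lambda>w. w + y - x) -` interior (A i))"
    by (intro open_vimage continuous_intros) auto
  moreover have "z - y \<in> (\<lambda>w. w + y - x) -` interior (A i)" using assms(4) by simp
  ultimately obtain w where "w \<in> (\<lambda>w. w + y - x) -` interior (A i)" "w \<in> interior (A j)"
    by (meson closure_iff_nhds_not_empty disjoint_iff order_refl)
  then have "(w + y) - x \<in> interior (A i)" "(w + y) - y \<in> interior (A j)" by auto
  then show ?thesis using assms(1,2,3) unfolding tiling_iff separated_def by blast
qed

lemma tiling_shift [simp]: "tiling (shift_tiles g S) \<longleftrightarrow> tiling S"
proof -
  have *: "tiling (shift_tiles g S)" if "tiling S" for g S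
    unfolding tiling_iff
  proof (intro conjI)
    show "shift_tiles g S \<subseteq> tiles"
    proof
      fix t assume "t \<in> shift_tiles g S"
      then obtain s where s: "s \<in> S" "t = shift_tile g s" by (auto simp: shift_tiles_def)
      obtain x i where "s = shift_tile x (prototile i)"
        using s(1) \<open>tiling S\<close> by (auto simp: tiling_def tiles_def)
      then show "t \<in> tiles" using s(2) by (auto simp: tiles_def)
    qed
    show "covering (Lam (shift_tiles g S))"
      unfolding covering_def
    proof
      fix z
      obtain x i where "(x, i) \<in> Lam S" "z - g - x \<in> A i" using tiling_cover[OF \<open>tiling S\<close>] .
      then show "\<exists>x i. (x, i) \<in> Lam (shift_tiles g S) \<and> z - x \<in> A i"
        by (intro exI[of _ "x + g"] exI[of _ i]) (simp add: algebra_simps)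
    qed
    show "separated (Lam (shift_tiles g S))"
      unfolding separated_def Lam_shift
    proof (intro allI impI, elim conjE)
      fix x i y j z
      assume "(x - g, i) \<in> Lam S" "(y - g, j) \<in> Lam S" "z - x \<in> interior (A i)" "z - y \<in> interior (A j)"
      moreover from this have "(z - g) - (x - g) \<in> interior (A i)" "(z - g) - (y - g) \<in> interior (A j)"
        by (simp_all add: algebra_simps)
      ultimately have "x - g = y - g \<and> i = j"
        using that unfolding tiling_iff separated_def by blast
      then show "x = y \<and> i = j" by simp
    qed
  qed
  show ?thesis using *[of S g] *[of "shift_tiles g S" "- g"] by auto
qed

definition support_bound :: real where
  "support_bound = (SOME c. c > 0 \<and> (\<forall>i. \<forall>a\<in>A i. norm a \<le> c))"

lemma support_bound: "support_bound > 0" "a \<in> A i \<Longrightarrow> norm a \<le> support_bound"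
proof -
  have "bounded (\<Union>i. A i)"
    by (intro bounded_UN finite ballI compact_imp_bounded compact)
  then obtain c where "c > 0" "\<forall>a\<in>(\<Union>i. A i). norm a \<le> c"
    unfolding bounded_pos by blast
  then have "\<exists>c. c > 0 \<and> (\<forall>i. \<forall>a\<in>A i. norm a \<le> c)" by blast
  from someI_ex[OF this] show "support_bound > 0" "a \<in> A i \<Longrightarrow> norm a \<le> support_bound"
    unfolding support_bound_def by blast+
qed

lemma tiling_cover_norm:
  assumes "tiling S"
  obtains x i where "(x, i) \<in> Lam S" "z - x \<in> A i" "norm (z - x) \<le> support_bound"
  using tiling_cover[OF assms] support_bound(2) by metis

text \<open>The distance \<open>r\<close> is the radius of balls inside the prototiles, hence the
  same for all tilings: the centre of such a ball would lie in both tiles.\<close>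

lemma uniform_separation:
  obtains r where "r > 0"
    "\<And>S i x y. tiling S \<Longrightarrow> (x, i) \<in> Lam S \<Longrightarrow> (y, i) \<in> Lam S \<Longrightarrow> dist x y < r \<Longrightarrow> x = y"
proof -
  have "\<exists>c r. r > 0 \<and> ball c r \<subseteq> interior (A i)" for i
    using interior_nonempty[of i] by (meson all_not_in_conv open_contains_ball open_interior)
  then obtain c r where r: "\<And>i. r i > 0" "\<And>i. ball (c i) (r i) \<subseteq> interior (A i)" by metis
  define r0 where "r0 = Min (range r)"
  have r0: "r0 > 0" "\<And>i. r0 \<le> r i" using r(1) by (auto simp: r0_def)
  show thesis
  proof (rule that[OF r0(1)])
    fix S i x y assume S: "tiling S" "(x, i) \<in> Lam S" "(y, i) \<in> Lam S" "dist x y < r0"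
    have "dist (c i) (x + c i - y) < r i"
      using S(4) r0(2)[of i] by (simp add: dist_norm norm_minus_commute algebra_simps)
    then have "x + c i - y \<in> A i" using r(2)[of i] interior_subset by fastforce
    moreover have "x + c i - x \<in> interior (A i)" using r[of i] by (auto simp: subset_iff)
    ultimately show "x = y" using tiling_unique[OF S(1-3)] by blast
  qed
qed

lemma finite_Lam_bounded:
  assumes "tiling S"
  shows "finite {(x, i). (x, i) \<in> Lam S \<and> norm x \<le> b}"
proof -
  obtain r where r: "r > 0"
    "\<And>i x y. (x, i) \<in> Lam S \<Longrightarrow> (y, i) \<in> Lam S \<Longrightarrow> dist x y < r \<Longrightarrow> x = y"
    using uniform_separation assms by metis
  have fin: "finite {x. (x, i) \<in> Lam S \<and> norm x \<le> b}" for i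
  proof -
    have "uniform_discrete {x. (x, i) \<in> Lam S \<and> norm x \<le> b}"
      unfolding uniform_discrete_def using r by (intro exI[of _ r]) auto
    moreover have "bounded {x. (x, i) \<in> Lam S \<and> norm x \<le> b}" by (auto simp: bounded_iff)
    ultimately show ?thesis using uniform_discrete_finite_iff by blast
  qed
  have "finite (\<Union>i. (\<lambda>x. (x, i)) ` {x. (x, i) \<in> Lam S \<and> norm x \<le> b})" using fin by simp
  then show ?thesis by (rule finite_subset[rotated]) auto
qed

section \<open>Continuity of translations and description of the hull\<close>

lemma tdist_shift_le: "tdist S (shift_tiles v S) \<le> norm v"
proof (rule field_le_epsilon)
  fix e :: real assume "e > 0"
  then have pos: "norm v + e > 0" by (simp add: add_nonneg_pos)
  have lt: "dist x (x + v) < norm v + e" "dist x (x - v) < norm v + e" for x :: 'a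
    using \<open>e > 0\<close> by (simp_all add: dist_norm)
  show "tdist S (shift_tiles v S) \<le> norm v + e"
  proof (intro tdist_le_close closeI pos)
    show "\<exists>y. (y, i) \<in> Lam (shift_tiles v S) \<and> dist x y < norm v + e" if "(x, i) \<in> Lam S" for x i
      using that lt(1)[of x] by (intro exI[of _ "x + v"]) simp
    show "\<exists>y. (y, i) \<in> Lam S \<and> dist x y < norm v + e" if "(x, i) \<in> Lam (shift_tiles v S)" for x i
      using that lt(2)[of x] by (intro exI[of _ "x - v"]) simp
  qed
qed

text \<open>Comparing the shifted tilings in the ball of radius \<open>1 / e\<close> means comparing
  the original ones in that ball moved by \<open>- v\<close>, which the last hypothesis places
  inside the ball of radius \<open>1 / d\<close>.\<close>

lemma tdist_shift_close:
  assumes "tdist S1 S2 < d" "0 < d" "d \<le> 1 / sqrt 2" "d \<le> e" "norm v + 1 / e \<le> 1 / d"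
  shows "tdist (shift_tiles v S1) (shift_tiles v S2) \<le> e"
proof -
  have main: "\<exists>y. (y, i) \<in> Lam (shift_tiles v S2) \<and> dist x y < e"
    if c: "close d S1 S2" and x: "(x, i) \<in> Lam (shift_tiles v S1)" "norm x < 1 / e" for S1 S2 x i
  proof -
    have "norm (x - v) < 1 / d" using x(2) assms(5) norm_triangle_ineq4[of x v] by linarith
    then obtain y where y: "(y, i) \<in> Lam S2" "dist (x - v) y < d"
      using closeD[OF c] x(1) by auto
    then show ?thesis
      using assms(4) by (intro exI[of _ "y + v"]) (auto simp: dist_norm algebra_simps)
  qed
  have c: "close d S1 S2" using assms tdist_less_imp_close by blast
  have "e > 0" using assms by linarith
  moreover have "close e (shift_tiles v S1) (shift_tiles v S2)"
    by (rule closeI) (use main[OF c] main[of S2 S1] c close_sym in blast)+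
  ultimately show ?thesis by (rule tdist_le_close)
qed

lemma tdist_shift_uniform:
  assumes "e > 0"
  obtains d where "d > 0" "\<And>S1 S2 v. tdist S1 S2 < d \<Longrightarrow> norm v \<le> b \<Longrightarrow>
    tdist (shift_tiles v S1) (shift_tiles v S2) \<le> e"
proof -
  define d where "d = min e (min (1 / sqrt 2) (1 / (\<bar>b\<bar> + 1 / e)))"
  have p: "\<bar>b\<bar> + 1 / e > 0" using assms by (simp add: add_nonneg_pos)
  then have d: "0 < d" "d \<le> e" "d \<le> 1 / sqrt 2" "d \<le> 1 / (\<bar>b\<bar> + 1 / e)" using assms by (auto simp: d_def)
  have "\<bar>b\<bar> + 1 / e \<le> 1 / d"
    using d(1,4) p by (simp add: pos_le_divide_eq mult.commute)
  then show thesis using d by (intro that[of d] tdist_shift_close) auto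
qed

lemma tdist_le_if_agree:
  assumes "e > 0" "\<And>x i. norm x < 1 / e \<Longrightarrow> (x, i) \<in> Lam S1 \<longleftrightarrow> (x, i) \<in> Lam S2"
  shows "tdist S1 S2 \<le> e"
  using assms by (intro tdist_le_close closeI) (auto intro!: exI)

lemma tiling_space_iff:
  assumes "tiling T"
  shows "S \<in> tiling_space T \<longleftrightarrow> tiling S \<and> (\<forall>e>0. \<exists>g. tdist S (shift_tiles (- g) T) < e)"
proof -
  have *: "shift_tiles (- g) T \<in> tilings.mball S e \<longleftrightarrow> tiling S \<and> tdist S (shift_tiles (- g) T) < e" for g e
    using assms by (simp add: tilings.in_mball)
  have "(\<exists>y\<in>{shift_tiles (- g) T |g. True}. y \<in> tilings.mball S e) \<longleftrightarrow>
      tiling S \<and> (\<exists>g. tdist S (shift_tiles (- g) T) < e)" for e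
    unfolding mem_Collect_eq Bex_def using * by blast
  then show ?thesis
    unfolding tiling_space_def tilings.metric_closure_of by auto
qed

lemma orbit_in_tiling_space: "tiling T \<Longrightarrow> shift_tiles g T \<in> tiling_space T"
  by (subst tiling_space_iff) (auto intro!: exI[of _ "- g"] simp: tdist_refl)

lemma tiling_space_tiling: "tiling T \<Longrightarrow> S \<in> tiling_space T \<Longrightarrow> tiling S"
  by (simp add: tiling_space_iff)

lemma shift_in_tiling_space:
  assumes "tiling T" "S \<in> tiling_space T"
  shows "shift_tiles v S \<in> tiling_space T"
  unfolding tiling_space_iff[OF assms(1)]
proof (intro conjI allI impI)
  show "tiling (shift_tiles v S)" using tiling_space_tiling[OF assms] by simp
  fix e :: real assume "e > 0"
  then have "e / 2 > 0" by simp
  then obtain d where d: "d > 0"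
    "\<And>S1 S2 w. tdist S1 S2 < d \<Longrightarrow> norm w \<le> norm v \<Longrightarrow>
      tdist (shift_tiles w S1) (shift_tiles w S2) \<le> e / 2"
    using tdist_shift_uniform[of "e / 2" "norm v"] by blast
  obtain g where "tdist S (shift_tiles (- g) T) < d"
    using assms d(1) by (auto simp: tiling_space_iff)
  then have "tdist (shift_tiles v S) (shift_tiles v (shift_tiles (- g) T)) \<le> e / 2"
    by (rule d) simp
  then show "\<exists>g. tdist (shift_tiles v S) (shift_tiles (- g) T) < e"
    using \<open>e > 0\<close> by (intro exI[of _ "g - v"]) simp
qed

end

section \<open>The inflation factor is an algebraic integer\<close>

lemma coeff_prod_Ints:
  fixes f :: "'i \<Rightarrow> real poly"
  assumes "\<And>i k. i \<in> I \<Longrightarrow> coeff (f i) k \<in> \<int>"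
  shows "coeff (prod f I) k \<in> \<int>"
  using assms
proof (induction I arbitrary: k rule: infinite_finite_induct)
  case (insert i I)
  have "coeff (f i) l \<in> \<int>" "coeff (prod f I) l \<in> \<int>" for l
    using insert by simp_all
  then show ?case using insert(1,2) by (auto simp: coeff_mult intro!: Ints_sum Ints_mult)
qed (auto simp: one_pCons coeff_pCons split: nat.splits)

text \<open>Used on the terms of the Leibniz formula, where \<open>g i\<close> bounds the degree of
  a single matrix entry.\<close>

lemma coeff_prod_top:
  fixes f :: "'i \<Rightarrow> real poly"
  assumes "finite I" "\<And>i. i \<in> I \<Longrightarrow> degree (f i) \<le> g i"
  shows "coeff (prod f I) (sum g I) = (\<Prod>i\<in>I. coeff (f i) (g i)) \<and> degree (prod f I) \<le> sum g I"
  using assms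
proof (induction I)
  case (insert i I)
  then have d: "degree (f i) \<le> g i" "degree (prod f I) \<le> sum g I" by auto
  have "degree (f i * prod f I) \<le> g i + sum g I"
    using d degree_mult_le[of "f i" "prod f I"] by linarith
  moreover have "coeff (f i * prod f I) (g i + sum g I) = coeff (f i) (g i) * coeff (prod f I) (sum g I)"
  proof -
    have "coeff (f i) k * coeff (prod f I) (g i + sum g I - k) = 0" if "k \<noteq> g i" for k
      using d that by (cases "k < g i") (auto simp: coeff_eq_0)
    then have "(\<Sum>k\<in>{..g i + sum g I} - {g i}. coeff (f i) k * coeff (prod f I) (g i + sum g I - k)) = 0"
      by (intro sum.neutral) blast
    then show ?thesis
      unfolding coeff_mult by (subst sum.remove[of _ "g i"]) auto
  qed
  ultimately show ?case using insert by simp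
qed simp

text \<open>The characteristic polynomial of an integer matrix is monic with integer coefficients.\<close>
lemma algebraic_int_eigenvalue:
  fixes N :: "'n::finite \<Rightarrow> 'n \<Rightarrow> int" and w :: "'n \<Rightarrow> real" and l :: real
  assumes eig: "\<And>j. l * w j = (\<Sum>i\<in>UNIV. of_int (N i j) * w i)" and w: "w j0 \<noteq> 0"
  shows "algebraic_int l"
proof -
  let ?n = "CARD('n)"
  define B :: "'n \<Rightarrow> 'n \<Rightarrow> real poly" where
    "B i j = (if i = j then [:0, 1:] else 0) - [:of_int (N i j):]" for i j
  define P where "P = {\<pi>. \<pi> permutes (UNIV :: 'n set)}"
  define p where "p = (\<Sum>\<pi>\<in>P. of_int (sign \<pi>) * (\<Prod>i\<in>UNIV. B i (\<pi> i)))"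
  have finP: "finite P" by (simp add: P_def finite_permutations)
  have int: "coeff p k \<in> \<int>" for k
  proof -
    have "coeff (B i j) k \<in> \<int>" for i j k
      by (cases k) (auto simp: B_def coeff_pCons split: nat.splits)
    then have "coeff (\<Prod>i\<in>UNIV. B i (\<pi> i)) k \<in> \<int>" for \<pi> k by (intro coeff_prod_Ints)
    then show ?thesis
      unfolding p_def coeff_sum
      by (intro Ints_sum) (auto simp: sign_def)
  qed
  \<comment> \<open>An entry has degree \<open>1\<close> only on the diagonal, so the term of a
    permutation has degree at most its number of fixed points. Only the identity reaches
    \<open>CARD('n)\<close>, and the determinant is monic.\<close>
  define g where "g \<pi> i = (if \<pi> i = i then 1 else 0 :: nat)" for \<pi> :: "'n \<Rightarrow> 'n" and i
  have degB: "degree (B i (\<pi> i)) \<le> g \<pi> i" for \<pi> i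
    by (simp add: B_def g_def)
  have top: "coeff (\<Prod>i\<in>UNIV. B i (\<pi> i)) ?n = (if \<pi> = id then 1 else 0)" and
    deg: "degree (\<Prod>i\<in>UNIV. B i (\<pi> i)) \<le> ?n" for \<pi>
  proof -
    have *: "coeff (\<Prod>i\<in>UNIV. B i (\<pi> i)) (sum (g \<pi>) UNIV) = (\<Prod>i\<in>UNIV. coeff (B i (\<pi> i)) (g \<pi> i))"
      "degree (\<Prod>i\<in>UNIV. B i (\<pi> i)) \<le> sum (g \<pi>) UNIV"
      using coeff_prod_top[of UNIV "\<lambda>i. B i (\<pi> i)" "g \<pi>"] degB by auto
    have le: "sum (g \<pi>) UNIV \<le> (\<Sum>i\<in>(UNIV::'n set). 1)" by (intro sum_mono) (simp add: g_def)
    then show "degree (\<Prod>i\<in>UNIV. B i (\<pi> i)) \<le> ?n" using *(2) by simp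
    show "coeff (\<Prod>i\<in>UNIV. B i (\<pi> i)) ?n = (if \<pi> = id then 1 else 0)"
    proof (cases "\<pi> = id")
      case True
      then have "sum (g \<pi>) UNIV = ?n" by (simp add: g_def)
      moreover have "(\<Prod>i\<in>UNIV. coeff (B i (\<pi> i)) (g \<pi> i)) = 1"
        by (rule prod.neutral) (simp add: True B_def g_def)
      ultimately show ?thesis using *(1) True by simp
    next
      case False
      then obtain i0 where "\<pi> i0 \<noteq> i0" by (auto simp: fun_eq_iff)
      then have "sum (g \<pi>) UNIV < (\<Sum>i\<in>(UNIV::'n set). 1)"
        by (intro sum_strict_mono_ex1) (auto simp: g_def)
      then have "coeff (\<Prod>i\<in>UNIV. B i (\<pi> i)) ?n = 0"
        using *(2) by (intro coeff_eq_0) simp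
      then show ?thesis using False by simp
    qed
  qed
  have coeff_sign: "coeff (of_int (sign \<pi>) * q) k = of_int (sign \<pi>) * coeff q k"
    for \<pi> :: "'n \<Rightarrow> 'n" and q :: "real poly" and k
    by (simp add: sign_def)
  have "id \<in> P" by (simp add: P_def permutes_id)
  have "coeff p ?n = (\<Sum>\<pi>\<in>P. if \<pi> = id then 1 else 0)"
    unfolding p_def coeff_sum coeff_sign top by (intro sum.cong) (auto simp: sign_id)
  also have "\<dots> = 1" using finP \<open>id \<in> P\<close> by simp
  finally have cn: "coeff p ?n = 1" .
  have "degree p \<le> ?n" unfolding p_def
  proof (intro degree_sum_le finP)
    fix \<pi> show "degree (of_int (sign \<pi>) * (\<Prod>i\<in>UNIV. B i (\<pi> i))) \<le> ?n"
      using deg[of \<pi>] by (simp add: sign_def)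
  qed
  moreover have "?n \<le> degree p" using cn by (intro le_degree) simp
  ultimately have lead: "lead_coeff p = 1" using cn by simp
  define C :: "real^'n^'n" where "C = (\<chi> i j. poly (B i j) l)"
  \<comment> \<open>The relation \<open>eig\<close> sums over the row index, so \<open>w\<close> is
    a left eigenvector and lies in the kernel of the transpose.\<close>
  have "transpose C *v (\<chi> i. w i) = 0"
  proof -
    have "(\<Sum>i\<in>UNIV. poly (B i j) l * w i) = 0" for j
    proof -
      have "poly (B i j) l * w i = (if i = j then l * w i else 0) - of_int (N i j) * w i" for i
        by (simp add: B_def algebra_simps)
      then have "(\<Sum>i\<in>UNIV. poly (B i j) l * w i)
          = (\<Sum>i\<in>UNIV. if i = j then l * w i else 0) - (\<Sum>i\<in>UNIV. of_int (N i j) * w i)"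
        by (simp add: sum_subtractf)
      then show ?thesis using eig[of j] by simp
    qed
    then show ?thesis
      by (simp add: vec_eq_iff matrix_vector_mult_def transpose_def C_def)
  qed
  moreover have "(\<chi> i. w i) \<noteq> 0" using w by (auto simp: vec_eq_iff)
  ultimately have "\<not> invertible (transpose C)"
    using matrix_left_invertible_ker[of "transpose C"] unfolding invertible_def by blast
  then have "det C = 0" using invertible_det_nz[of "transpose C"] by (simp add: det_transpose)
  moreover have "poly p l = det C"
    by (simp add: p_def det_def C_def P_def poly_sum poly_prod)
  ultimately show ?thesis using int lead by (intro algebraic_int.intros[of p]) auto
qed

section \<open>Substitutions whose expansion is a scalar multiple of the identity\<close>

locale scaling_substitution =
  tile_substitution A "\<lambda>x. \<theta> *\<^sub>R x" D
  for A :: "'k::finite \<Rightarrow> 'a::euclidean_space set" and \<theta> :: real and D +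
  assumes abs_theta: "\<bar>\<theta>\<bar> > 1"
    and primitive: "primitive D"
begin

lemma theta_nz [simp]: "\<theta> \<noteq> 0" using abs_theta by auto

lemma inflationE:
  assumes "x \<in> A j"
  obtains i u where "u \<in> D i j" "\<theta> *\<^sub>R x - u \<in> A i"
proof -
  have "\<theta> *\<^sub>R x \<in> (\<Union>i. \<Union>u\<in>D i j. (+) u ` A i)" using inflation[of j] assms by blast
  then show thesis using that by (auto simp: mem_translation_iff)
qed

lemma Lam_omega: "(y, i) \<in> Lam (omega S) \<longleftrightarrow> (\<exists>x j u. (x, j) \<in> Lam S \<and> u \<in> D i j \<and> y = \<theta> *\<^sub>R x + u)"
proof
  assume "(y, i) \<in> Lam (omega S)"
  then obtain t where t: "t \<in> S" "shift_tile y (prototile i) \<in> omega_tile t"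
    by (auto simp: Lam_def omega_def)
  then obtain x j where x: "t = shift_tile x (prototile j)"
    "shift_tile y (prototile i) \<in> shift_tiles (\<theta> *\<^sub>R x) (omega_prototile j)"
    by (auto simp: omega_tile_def)
  then obtain u i' where "u \<in> D i' j" "shift_tile y (prototile i) = shift_tile (\<theta> *\<^sub>R x + u) (prototile i')"
    by (auto simp: shift_tiles_def omega_prototile_def)
  then show "\<exists>x j u. (x, j) \<in> Lam S \<and> u \<in> D i j \<and> y = \<theta> *\<^sub>R x + u"
    using x(1) t(1) by (auto simp: shift_tile_inj_iff Lam_def)
next
  assume "\<exists>x j u. (x, j) \<in> Lam S \<and> u \<in> D i j \<and> y = \<theta> *\<^sub>R x + u"
  then obtain x j u where x: "(x, j) \<in> Lam S" "u \<in> D i j" "y = \<theta> *\<^sub>R x + u" by blast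
  have "shift_tile u (prototile i) \<in> omega_prototile j" using x by (auto simp: omega_prototile_def)
  then have "shift_tile (\<theta> *\<^sub>R x) (shift_tile u (prototile i)) \<in> omega_tile (shift_tile x (prototile j))"
    unfolding omega_tile_shift shift_tiles_def by blast
  then show "(y, i) \<in> Lam (omega S)"
    using x by (auto simp: Lam_def omega_def)
qed

lemma omega_subset_tiles: "omega S \<subseteq> tiles"
proof -
  have "shift_tile (\<theta> *\<^sub>R x) (shift_tile u (prototile i)) \<in> tiles" for x u i
    unfolding tiles_def by auto
  then show ?thesis
    unfolding omega_def omega_tile_def shift_tiles_def omega_prototile_def by blast
qed

lemma interior_inflation:
  assumes "u \<in> D i j" "z - u \<in> interior (A i)"
  shows "(1 / \<theta>) *\<^sub>R z \<in> interior (A j)"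
proof -
  have "z \<in> interior ((+) u ` A i)" using assms(2) by (simp add: mem_interior_translation_iff)
  moreover have "(+) u ` A i \<subseteq> (\<lambda>x. \<theta> *\<^sub>R x) ` A j" using inflation[of j] assms(1) by blast
  ultimately have "z \<in> interior ((\<lambda>x. \<theta> *\<^sub>R x) ` A j)" using interior_mono by blast
  then have "z \<in> (\<lambda>x. \<theta> *\<^sub>R x) ` interior (A j)" 
    by (simp add: interior_injective_linear_image linear inj_on_def)
  then show ?thesis by auto
qed

text \<open>Overlapping tiles of the image lie in overlapping inflated tiles, so they have the same
  parent; within one inflated tile \<open>inflation_disjoint\<close> applies.\<close>

lemma tiling_omega:
  assumes "tiling S"
  shows "tiling (omega S)"
  unfolding tiling_iff
proof (intro conjI omega_subset_tiles)
  show "covering (Lam (omega S))" unfolding covering_def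
  proof
    fix z
    obtain x j where x: "(x, j) \<in> Lam S" "(1 / \<theta>) *\<^sub>R z - x \<in> A j" using tiling_cover[OF assms] .
    obtain i u where u: "u \<in> D i j" "\<theta> *\<^sub>R ((1 / \<theta>) *\<^sub>R z - x) - u \<in> A i" using inflationE[OF x(2)] .
    have "(\<theta> *\<^sub>R x + u, i) \<in> Lam (omega S)" using x u by (auto simp: Lam_omega)
    moreover have "z - (\<theta> *\<^sub>R x + u) \<in> A i" using u(2) by (simp add: algebra_simps)
    ultimately show "\<exists>x i. (x, i) \<in> Lam (omega S) \<and> z - x \<in> A i" by blast
  qed
  show "separated (Lam (omega S))" unfolding separated_def
  proof (intro allI impI, elim conjE)
    fix y i y' i' z
    assume "(y, i) \<in> Lam (omega S)" "(y', i') \<in> Lam (omega S)"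
      and z: "z - y \<in> interior (A i)" "z - y' \<in> interior (A i')"
    then obtain x j u x' j' u' where x: "(x, j) \<in> Lam S" "u \<in> D i j" "y = \<theta> *\<^sub>R x + u"
      "(x', j') \<in> Lam S" "u' \<in> D i' j'" "y' = \<theta> *\<^sub>R x' + u'"
      by (auto simp: Lam_omega)
    have "(1 / \<theta>) *\<^sub>R (z - \<theta> *\<^sub>R x) \<in> interior (A j)"
      using z x by (intro interior_inflation[OF x(2)]) (simp add: algebra_simps)
    then have "(1 / \<theta>) *\<^sub>R z - x \<in> interior (A j)" by (simp add: algebra_simps)
    moreover have "(1 / \<theta>) *\<^sub>R (z - \<theta> *\<^sub>R x') \<in> interior (A j')"
      using z x by (intro interior_inflation[OF x(5)]) (simp add: algebra_simps)
    then have "(1 / \<theta>) *\<^sub>R z - x' \<in> interior (A j')" by (simp add: algebra_simps)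
    ultimately have eq: "x = x'" "j = j'"
      using assms x(1,4) unfolding tiling_iff separated_def by blast+
    have "z - \<theta> *\<^sub>R x \<in> interior ((+) u ` A i) \<inter> interior ((+) u' ` A i')"
      using z x eq unfolding Int_iff mem_interior_translation_iff by (simp add: diff_diff_eq)
    then have "(u, i) = (u', i')"
      using inflation_disjoint[of u i j u' i'] x(2,5) eq by blast
    then show "y = y' \<and> i = i'" using x eq by simp
  qed
qed

lemma omega_shift:
  assumes "tiling S"
  shows "omega (shift_tiles v S) = shift_tiles (\<theta> *\<^sub>R v) (omega S)"
proof (rule Lam_inj)
  show "shift_tiles (\<theta> *\<^sub>R v) (omega S) \<subseteq> tiles"
    using tiling_omega[OF assms] tiling_shift[of "\<theta> *\<^sub>R v" "omega S"] unfolding tiling_iff by blast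
  have "(y, i) \<in> Lam (omega (shift_tiles v S)) \<longleftrightarrow> (y, i) \<in> Lam (shift_tiles (\<theta> *\<^sub>R v) (omega S))" for y i
  proof
    assume "(y, i) \<in> Lam (omega (shift_tiles v S))"
    then obtain x j u where "(x - v, j) \<in> Lam S" "u \<in> D i j" "y = \<theta> *\<^sub>R x + u"
      by (auto simp: Lam_omega)
    then show "(y, i) \<in> Lam (shift_tiles (\<theta> *\<^sub>R v) (omega S))"
      unfolding Lam_shift Lam_omega
      by (intro exI[of _ "x - v"] exI[of _ j] exI[of _ u]) (simp add: algebra_simps)
  next
    assume "(y, i) \<in> Lam (shift_tiles (\<theta> *\<^sub>R v) (omega S))"
    then obtain x j u where "(x, j) \<in> Lam S" "u \<in> D i j" "y - \<theta> *\<^sub>R v = \<theta> *\<^sub>R x + u"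
      unfolding Lam_shift Lam_omega by blast
    then show "(y, i) \<in> Lam (omega (shift_tiles v S))"
      unfolding Lam_shift Lam_omega
      by (intro exI[of _ "x + v"] exI[of _ j] exI[of _ u]) (simp add: algebra_simps)
  qed
  then show "Lam (omega (shift_tiles v S)) = Lam (shift_tiles (\<theta> *\<^sub>R v) (omega S))" by auto
qed (rule omega_subset_tiles)

text \<open>The positions of the type \<open>i\<close> tiles in the \<open>n\<close>-th substitute
  of prototile \<open>j\<close>; the outermost substitution step contributes the summand from
  \<open>D i k\<close>.\<close>

primrec digits :: "nat \<Rightarrow> 'k \<Rightarrow> 'k \<Rightarrow> 'a set" where
  "digits 0 i j = (if i = j then {0} else {})"
| "digits (Suc n) i j = (\<Union>k. \<Union>u\<in>digits n k j. (\<lambda>v. \<theta> *\<^sub>R u + v) ` D i k)"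

lemma finite_digits_iterate [simp]: "finite (digits n i j)"
  by (induction n arbitrary: i) (auto intro!: finite_digits)

lemma Lam_omega_iterate:
  "(y, i) \<in> Lam ((omega ^^ n) S) \<longleftrightarrow> (\<exists>x j. \<exists>u\<in>digits n i j. (x, j) \<in> Lam S \<and> y = \<theta> ^ n *\<^sub>R x + u)"
proof (induction n arbitrary: y i)
  case 0
  then show ?case by auto
next
  case (Suc n)
  have "(y, i) \<in> Lam ((omega ^^ Suc n) S) \<longleftrightarrow>
    (\<exists>x k v. (\<exists>x' j. \<exists>u\<in>digits n k j. (x', j) \<in> Lam S \<and> x = \<theta> ^ n *\<^sub>R x' + u) \<and> v \<in> D i k \<and> y = \<theta> *\<^sub>R x + v)"
    by (simp add: Lam_omega Suc)
  also have "\<dots> \<longleftrightarrow> (\<exists>x' j k. \<exists>u\<in>digits n k j. \<exists>v\<in>D i k. (x', j) \<in> Lam S \<and>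
      y = \<theta> *\<^sub>R (\<theta> ^ n *\<^sub>R x' + u) + v)" by blast
  also have "\<dots> \<longleftrightarrow> (\<exists>x' j k. \<exists>u\<in>digits n k j. \<exists>v\<in>D i k. (x', j) \<in> Lam S \<and>
      y = \<theta> ^ Suc n *\<^sub>R x' + (\<theta> *\<^sub>R u + v))"
    by (simp only: scaleR_add_right scaleR_scaleR power_Suc add.assoc)
  also have "\<dots> \<longleftrightarrow> (\<exists>x j. \<exists>u\<in>digits (Suc n) i j. (x, j) \<in> Lam S \<and> y = \<theta> ^ Suc n *\<^sub>R x + u)"
    unfolding digits.simps by blast
  finally show ?case .
qed

lemma inflation_iterateE:
  assumes "x \<in> A j"
  obtains i u where "u \<in> digits n i j" "\<theta> ^ n *\<^sub>R x - u \<in> A i"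
proof -
  have "\<exists>i. \<exists>u\<in>digits n i j. \<theta> ^ n *\<^sub>R x - u \<in> A i"
  proof (induction n)
    case 0
    then show ?case using assms by (intro exI[of _ j]) simp
  next
    case (Suc n)
    then obtain k u where u: "u \<in> digits n k j" "\<theta> ^ n *\<^sub>R x - u \<in> A k" by blast
    obtain i v where v: "v \<in> D i k" "\<theta> *\<^sub>R (\<theta> ^ n *\<^sub>R x - u) - v \<in> A i"
      using inflationE[OF u(2)] .
    have "\<theta> *\<^sub>R u + v \<in> digits (Suc n) i j" using u v by auto
    moreover have "\<theta> ^ Suc n *\<^sub>R x - (\<theta> *\<^sub>R u + v) \<in> A i" using v by (simp add: algebra_simps)
    ultimately show ?case by blast
  qed
  then show thesis using that by blast
qed

text \<open>Only the vanishing pattern is compared. The matrix entry counts digit expansions,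
  whereas \<open>digits\<close> is a set of positions.\<close>

lemma substitution_matrix_power:
  "(((**) (substitution_matrix D) ^^ n) (mat 1)) $ i $ j \<noteq> 0 \<longleftrightarrow> digits n i j \<noteq> {}"
proof (induction n arbitrary: i)
  case 0
  then show ?case by (simp add: mat_def)
next
  case (Suc n)
  have "(((**) (substitution_matrix D) ^^ Suc n) (mat 1)) $ i $ j
      = (\<Sum>k\<in>UNIV. card (D i k) * (((**) (substitution_matrix D) ^^ n) (mat 1)) $ k $ j)"
    by (simp add: matrix_matrix_mult_def substitution_matrix_def)
  also have "\<dots> \<noteq> 0 \<longleftrightarrow> (\<exists>k. D i k \<noteq> {} \<and> digits n k j \<noteq> {})"
    using Suc finite_digits by simp
  also have "\<dots> \<longleftrightarrow> digits (Suc n) i j \<noteq> {}" by auto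
  finally show ?case .
qed

definition level :: nat where
  "level = (SOME n. n > 0 \<and> (\<forall>i j. digits n i j \<noteq> {}))"

lemma level: "level > 0" "digits level i j \<noteq> {}"
proof -
  have "\<exists>n. n > 0 \<and> (\<forall>i j. digits n i j \<noteq> {})"
    using primitive unfolding primitive_def substitution_matrix_power by blast
  from someI_ex[OF this] show "level > 0" "digits level i j \<noteq> {}"
    unfolding level_def by blast+
qed

text \<open>Comparing volumes, with the boundaries not known to be null: the volumes
  \<open>v\<close> of prototiles satisfy the eigenvalue equation with \<le>, the volumes
  \<open>w\<close> of interiors with \<ge>. Where \<open>v / w\<close> is maximal both are
  equalities, and primitivity spreads this to all types, so \<open>v\<close> is a left
  eigenvector.\<close>

lemma algebraic_int_theta: "algebraic_int \<theta>"
proof -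
  define v where "v j = measure lebesgue (A j)" for j
  define w where "w j = measure lebesgue (interior (A j))" for j
  let ?d = "DIM('a)"
  let ?I = "\<lambda>j. Sigma UNIV (\<lambda>i. D i j)"
  have finI: "finite (?I j)" for j by (intro finite_SigmaI finite_digits) simp
  have bI: "bounded (interior (A j))" for j
    using compact_imp_bounded[OF compact] bounded_interior by blast
  have Alm: "A j \<in> lmeasurable" and Ilm: "interior (A j) \<in> lmeasurable" for j
    using compact bI by (auto intro: lmeasurable_compact lmeasurable_open)
  have w_pos: "w j > 0" for j
  proof -
    obtain c r where c: "r > 0" "ball c r \<subseteq> interior (A j)"
      using interior_nonempty[of j] by (meson all_not_in_conv open_contains_ball open_interior)
    have "0 < measure lebesgue (ball c r)" using c(1) by (simp add: content_ball_pos)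
    also have "\<dots> \<le> w j" unfolding w_def by (rule measure_mono_fmeasurable[OF c(2)]) (use Ilm in auto)
    finally show ?thesis .
  qed
  have scale: "measure lebesgue ((\<lambda>x. \<theta> *\<^sub>R x) ` S) = \<bar>\<theta>\<bar> ^ ?d * measure lebesgue S" for S :: "'a set"
    using measure_lebesgue_affine[of \<theta> 0 S] by simp
  have sum_I: "(\<Sum>(i, u)\<in>?I j. h i) = (\<Sum>i\<in>UNIV. real (card (D i j)) * h i)" for j and h :: "'k \<Rightarrow> real"
    by (simp add: sum.Sigma[symmetric] finite_digits)
  have v_le: "\<bar>\<theta>\<bar> ^ ?d * v j \<le> (\<Sum>i\<in>UNIV. real (card (D i j)) * v i)" for j
  proof -
    have "\<bar>\<theta>\<bar> ^ ?d * v j = measure lebesgue (\<Union>(i, u)\<in>?I j. (+) u ` A i)"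
      unfolding v_def scale[symmetric] inflation by (rule arg_cong[where f = "measure lebesgue"]) auto
    also have "\<dots> \<le> (\<Sum>(i, u)\<in>?I j. measure lebesgue ((+) u ` A i))"
      unfolding split_def
      using Alm by (intro measure_UNION_le finI) (auto intro!: fmeasurableD measurable_translation)
    also have "\<dots> = (\<Sum>i\<in>UNIV. real (card (D i j)) * v i)"
      by (simp add: measure_translation sum_I v_def)
    finally show ?thesis .
  qed
  have w_ge: "(\<Sum>i\<in>UNIV. real (card (D i j)) * w i) \<le> \<bar>\<theta>\<bar> ^ ?d * w j" for j
  proof -
    have lm: "(+) u ` interior (A i) \<in> lmeasurable" for i u
      using Ilm by (rule measurable_translation)
    have lm2: "emeasure lebesgue ((+) u ` interior (A i)) \<noteq> \<infinity>" for i u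
      using fmeasurableD2[OF lm] by simp
    have dj: "disjoint_family_on (\<lambda>(i, u). (+) u ` interior (A i)) (?I j)"
      unfolding disjoint_family_on_def
      using inflation_disjoint[of _ _ j] by (fastforce simp: interior_translation)
    have "(\<Sum>i\<in>UNIV. real (card (D i j)) * w i) = (\<Sum>(i, u)\<in>?I j. measure lebesgue ((+) u ` interior (A i)))"
      by (simp add: measure_translation sum_I w_def)
    also have "\<dots> = (\<Sum>p\<in>?I j. measure lebesgue ((\<lambda>(i, u). (+) u ` interior (A i)) p))"
      by (simp add: split_def)
    also have "\<dots> = measure lebesgue (\<Union>p\<in>?I j. (\<lambda>(i, u). (+) u ` interior (A i)) p)"
    proof (intro measure_finite_Union[symmetric] finI dj)
      show "(\<lambda>(i, u). (+) u ` interior (A i)) ` ?I j \<subseteq> sets lebesgue"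
        using lm by (auto intro!: fmeasurableD)
      show "emeasure lebesgue ((\<lambda>(i, u). (+) u ` interior (A i)) p) \<noteq> \<infinity>" for p
        using lm2 by (cases p) (simp only: prod.case not_False_eq_True)
    qed
    also have "\<dots> \<le> measure lebesgue ((\<lambda>x. \<theta> *\<^sub>R x) ` interior (A j))"
    proof (rule measure_mono_fmeasurable)
      show "(\<Union>p\<in>?I j. (\<lambda>(i, u). (+) u ` interior (A i)) p) \<subseteq> (\<lambda>x. \<theta> *\<^sub>R x) ` interior (A j)"
      proof clarify
        fix i u x assume "u \<in> D i j" "x \<in> interior (A i)"
        then have "(1 / \<theta>) *\<^sub>R (u + x) \<in> interior (A j)" by (intro interior_inflation[of u i j]) auto
        moreover have "u + x = \<theta> *\<^sub>R ((1 / \<theta>) *\<^sub>R (u + x))" by simp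
        ultimately show "u + x \<in> (\<lambda>x. \<theta> *\<^sub>R x) ` interior (A j)" by blast
      qed
      show "(\<Union>p\<in>?I j. (\<lambda>(i, u). (+) u ` interior (A i)) p) \<in> sets lebesgue"
        using lm by (intro sets.finite_UN finI) (auto intro!: fmeasurableD)
      show "(\<lambda>x. \<theta> *\<^sub>R x) ` interior (A j) \<in> lmeasurable"
        using bI by (intro lmeasurable_open bounded_scaling open_scaling) auto
    qed
    also have "\<dots> = \<bar>\<theta>\<bar> ^ ?d * w j" by (simp add: scale w_def)
    finally show ?thesis .
  qed
  define c where "c = Max (range (\<lambda>j. v j / w j))"
  have v_cw: "v j \<le> c * w j" for j
  proof -
    have "v j / w j \<le> c" unfolding c_def by (intro Max_ge) auto
    then show ?thesis using w_pos[of j] by (simp add: pos_divide_le_eq)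
  qed
  have "c \<in> range (\<lambda>j. v j / w j)" unfolding c_def by (intro Max_in) auto
  then obtain j0 where "c = v j0 / w j0" by auto
  then have j0: "v j0 = c * w j0" using w_pos[of j0] by simp
  have c_pos: "c > 0"
  proof -
    have "w j0 \<le> v j0" unfolding v_def w_def
      by (rule measure_mono_fmeasurable[OF interior_subset]) (use Alm Ilm in auto)
    then have "0 < c * w j0" using j0 w_pos[of j0] by linarith
    then show ?thesis using w_pos[of j0] by (simp add: zero_less_mult_iff)
  qed
  \<comment> \<open>With \<open>v j = c * w j\<close>, the chain \<open>\<bar>\<theta>\<bar> ^ ?d *
    v j \<ge> c * (sum of w) \<ge> (sum of v) \<ge> \<bar>\<theta>\<bar> ^ ?d * v j\<close> over the
    tiles of the inflated prototile collapses. Equality term by term gives the extremal ratio for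
    every type that occurs.\<close>
  have extremal: "(\<forall>i. D i j \<noteq> {} \<longrightarrow> v i = c * w i) \<and> \<bar>\<theta>\<bar> ^ ?d * v j = (\<Sum>i\<in>UNIV. real (card (D i j)) * v i)"
    if j: "v j = c * w j" for j
  proof -
    have "(\<Sum>i\<in>UNIV. real (card (D i j)) * (c * w i)) = c * (\<Sum>i\<in>UNIV. real (card (D i j)) * w i)"
      by (simp add: sum_distrib_left algebra_simps)
    also have "\<dots> \<le> c * (\<bar>\<theta>\<bar> ^ ?d * w j)" using w_ge c_pos by (intro mult_left_mono) auto
    also have "\<dots> = \<bar>\<theta>\<bar> ^ ?d * v j" using j by simp
    finally have le: "(\<Sum>i\<in>UNIV. real (card (D i j)) * (c * w i)) \<le> \<bar>\<theta>\<bar> ^ ?d * v j" .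
    have nn: "0 \<le> real (card (D i j)) * (c * w i) - real (card (D i j)) * v i" for i
      using v_cw[of i] by (simp add: mult_left_mono flip: right_diff_distrib)
    have "(\<Sum>i\<in>UNIV. real (card (D i j)) * (c * w i) - real (card (D i j)) * v i) \<le> 0"
      using le v_le[of j] by (simp add: sum_subtractf)
    then have zero: "(\<Sum>i\<in>UNIV. real (card (D i j)) * (c * w i) - real (card (D i j)) * v i) = 0"
      using nn by (intro antisym sum_nonneg) auto
    then have term_0: "real (card (D i j)) * (c * w i) - real (card (D i j)) * v i = 0" for i
      using nn sum_nonneg_eq_0_iff[of UNIV "\<lambda>i. real (card (D i j)) * (c * w i) - real (card (D i j)) * v i"] by simp
    have "v i = c * w i" if "D i j \<noteq> {}" for i
    proof -
      have "card (D i j) \<noteq> 0" using that finite_digits by simp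
      then show ?thesis using term_0[of i] by simp
    qed
    moreover have "\<bar>\<theta>\<bar> ^ ?d * v j = (\<Sum>i\<in>UNIV. real (card (D i j)) * v i)"
      using zero le v_le[of j] by (simp add: sum_subtractf)
    ultimately show ?thesis by blast
  qed
  have "digits n i j0 \<noteq> {} \<Longrightarrow> v i = c * w i" for n i
  proof (induction n arbitrary: i)
    case 0
    then show ?case using j0 by (auto split: if_splits)
  next
    case (Suc n)
    then obtain k where "digits n k j0 \<noteq> {}" "D i k \<noteq> {}" by auto
    then show ?case using Suc.IH extremal by blast
  qed
  then have "v j = c * w j" for j using level(2) by blast
  then have "\<bar>\<theta>\<bar> ^ ?d * v j = (\<Sum>i\<in>UNIV. of_int (int (card (D i j))) * v i)" for j
    using extremal by simp
  moreover have "v j0 \<noteq> 0" using j0 c_pos w_pos[of j0] by simp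
  ultimately have "algebraic_int (\<bar>\<theta>\<bar> ^ ?d)" by (rule algebraic_int_eigenvalue)
  \<comment> \<open>A \<open>?d\<close>-th root of an algebraic integer is one too.\<close>
  then have "algebraic_int \<bar>\<theta>\<bar>"
    by (rule algebraic_int_root[where p = "monom 1 ?d"])
       (auto simp: poly_monom degree_monom_eq)
  then show ?thesis by simp
qed

end

section \<open>Compactness of the space of tilings\<close>

context prototiles
begin

text \<open>A diagonal sequence over the countably many pairs of a set from \<open>B\<close> and a
  type: infinitely many hits allow thinning to constant hits, finitely many are eventually
  over.\<close>

lemma stabilising_subsequence:
  fixes S :: "nat \<Rightarrow> ('a, 'k) tile set" and B :: "'a set set"
  assumes "countable B" "B \<noteq> {}"
  obtains r where "strict_mono r"
    "\<And>b i. b \<in> B \<Longrightarrow> (\<forall>\<^sub>F n in sequentially. \<exists>x\<in>b. (x, i) \<in> Lam (S (r n))) \<or>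
      (\<forall>\<^sub>F n in sequentially. \<not> (\<exists>x\<in>b. (x, i) \<in> Lam (S (r n))))"
proof -
  let ?I = "B \<times> (UNIV :: 'k set)"
  define e where "e = from_nat_into ?I"
  define hit where "hit n m \<longleftrightarrow> (\<exists>x\<in>fst (e n). (x, snd (e n)) \<in> Lam (S m))" for n m
  define P where "P n s \<longleftrightarrow> (\<forall>\<^sub>F k in sequentially. hit n (s k)) \<or> (\<forall>\<^sub>F k in sequentially. \<not> hit n (s k))" for n s
  interpret subseqs P
  proof
    fix n and s :: "nat \<Rightarrow> nat"
    assume "strict_mono s"
    show "\<exists>r'. strict_mono r' \<and> P n (s \<circ> r')"
    proof (cases "infinite {k. hit n (s k)}")
      case True
      then obtain r' :: "nat \<Rightarrow> nat" where "strict_mono r'" "\<forall>k. r' k \<in> {k. hit n (s k)}"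
        using infinite_enumerate by blast
      then show ?thesis by (intro exI[of _ r']) (auto simp: P_def)
    next
      case False
      then have "\<forall>\<^sub>F k in sequentially. \<not> hit n (s k)"
        by (simp add: eventually_cofinite flip: cofinite_eq_sequentially)
      then show ?thesis by (intro exI[of _ id]) (auto simp: P_def strict_mono_def)
    qed
  qed
  have stable: "P n (s \<circ> r)" if "strict_mono r" "P n s" for n s r
    using that eventually_compose_filterlim[OF _ filterlim_subseq[OF that(1)]] unfolding P_def by auto
  have diag: "P n diagseq" for n
  proof -
    have "P n (diagseq \<circ> (+) (Suc n))" using stable by (rule diagseq_holds)
    then have "(\<forall>\<^sub>F k in sequentially. hit n (diagseq (k + Suc n))) \<or>
        (\<forall>\<^sub>F k in sequentially. \<not> hit n (diagseq (k + Suc n)))"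
      unfolding P_def o_def by (simp only: add.commute)
    then show ?thesis
      unfolding P_def
        eventually_sequentially_seg[of "\<lambda>k. hit n (diagseq k)" "Suc n"]
        eventually_sequentially_seg[of "\<lambda>k. \<not> hit n (diagseq k)" "Suc n"] .
  qed
  have "range e = ?I" unfolding e_def using assms by (intro range_from_nat_into) auto
  then have ex: "\<exists>n. e n = (b, i)" if "b \<in> B" for b i
    using that by (metis SigmaI UNIV_I imageE)
  show thesis
  proof (rule that[OF subseq_diagseq])
    fix b i assume "b \<in> B"
    then obtain n where "e n = (b, i)" using ex by blast
    then show "(\<forall>\<^sub>F n in sequentially. \<exists>x\<in>b. (x, i) \<in> Lam (S (diagseq n))) \<or>
      (\<forall>\<^sub>F n in sequentially. \<not> (\<exists>x\<in>b. (x, i) \<in> Lam (S (diagseq n))))"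
      using diag[of n] by (simp add: P_def hit_def)
  qed
qed

text \<open>Sequential compactness of the space of tilings by translates of the prototiles.
  Positions along the subsequence converge without having to become constant, so the limit is built
  as a set of accumulation points.\<close>

lemma convergent_subsequence:
  fixes S :: "nat \<Rightarrow> ('a, 'k) tile set"
  assumes S: "\<And>n. tiling (S n)"
  obtains r S' where "strict_mono r" "tiling S'" "(\<lambda>n. tdist (S (r n)) S') \<longlonglongrightarrow> 0"
proof -
  obtain B :: "'a set set" where B: "countable B" "topological_basis B"
    using ex_countable_basis by blast
  have "B \<noteq> {}" using B(2) topological_basisE[OF B(2) open_UNIV] by blast
  then obtain r where r: "strict_mono r"
    "\<And>b i. b \<in> B \<Longrightarrow> (\<forall>\<^sub>F n in sequentially. \<exists>x\<in>b. (x, i) \<in> Lam (S (r n))) \<or>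
      (\<forall>\<^sub>F n in sequentially. \<not> (\<exists>x\<in>b. (x, i) \<in> Lam (S (r n))))"
    using stabilising_subsequence[OF B(1), of S] by blast
  define L where "L = {(x, i). \<forall>b\<in>B. x \<in> b \<longrightarrow> (\<forall>\<^sub>F n in sequentially. \<exists>y\<in>b. (y, i) \<in> Lam (S (r n)))}"
  have near: "\<forall>\<^sub>F n in sequentially. \<exists>y. dist y x < e \<and> (y, i) \<in> Lam (S (r n))"
    if "(x, i) \<in> L" "e > 0" for x i e
  proof -
    obtain b where b: "b \<in> B" "x \<in> b" "b \<subseteq> ball x e"
      using topological_basisE[OF B(2) open_ball, of x x e] \<open>e > 0\<close> by auto
    have "\<forall>\<^sub>F n in sequentially. \<exists>y\<in>b. (y, i) \<in> Lam (S (r n))" using that b by (auto simp: L_def)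
    then show ?thesis
      by eventually_elim (use b(3) in \<open>auto simp: subset_iff dist_commute\<close>)
  qed
  \<comment> \<open>This is where stabilisation enters: a basic neighbourhood that is not eventually
    always hit is eventually never hit, which excludes hits along a further subsequence.\<close>
  have limit: "(x, i) \<in> L"
    if f: "strict_mono f" "xs \<longlonglongrightarrow> x" "\<And>n. (xs n, i) \<in> Lam (S (r (f n)))" for f :: "nat \<Rightarrow> nat" and xs x i
  proof (rule ccontr)
    assume "(x, i) \<notin> L"
    then obtain b where b: "b \<in> B" "x \<in> b" "\<forall>\<^sub>F n in sequentially. \<not> (\<exists>y\<in>b. (y, i) \<in> Lam (S (r n)))"
      using r(2) by (auto simp: L_def)
    have "\<forall>\<^sub>F n in sequentially. \<not> (\<exists>y\<in>b. (y, i) \<in> Lam (S (r (f n))))"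
      using b(3) eventually_compose_filterlim filterlim_subseq[OF f(1)] by fast
    moreover have "\<forall>\<^sub>F n in sequentially. xs n \<in> b"
      using topological_tendstoD[OF f(2) topological_basis_open[OF B(2) b(1)] b(2)] .
    ultimately have "\<forall>\<^sub>F n in sequentially. False"
      by eventually_elim (use f(3) in blast)
    then show False by simp
  qed
  \<comment> \<open>The common extraction: pigeonhole over the finitely many types, then compactness
    of the ball of radius \<open>c\<close>. The predicate \<open>Q\<close> is the property to be
    inspected at the limit.\<close>
  have limit_of: "\<exists>f xs i x. strict_mono (f :: nat \<Rightarrow> nat) \<and> xs \<longlonglongrightarrow> x \<and> (x, i) \<in> L \<and> (\<forall>n. Q (f n) (xs n) i)"
    if "\<exists>\<^sub>F n in sequentially. \<exists>x i. (x, i) \<in> Lam (S (r n)) \<and> norm x \<le> c \<and> Q n x i" for c Q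
  proof -
    have "infinite {n. \<exists>x i. (x, i) \<in> Lam (S (r n)) \<and> norm x \<le> c \<and> Q n x i}"
      using that by (simp add: frequently_cofinite flip: cofinite_eq_sequentially)
    moreover have "{n. \<exists>x i. (x, i) \<in> Lam (S (r n)) \<and> norm x \<le> c \<and> Q n x i}
        = (\<Union>i. {n. \<exists>x. (x, i) \<in> Lam (S (r n)) \<and> norm x \<le> c \<and> Q n x i})" by blast
    ultimately obtain i where "infinite {n. \<exists>x. (x, i) \<in> Lam (S (r n)) \<and> norm x \<le> c \<and> Q n x i}"
      by auto
    then obtain f :: "nat \<Rightarrow> nat" where f: "strict_mono f"
      "\<forall>n. \<exists>x. (x, i) \<in> Lam (S (r (f n))) \<and> norm x \<le> c \<and> Q (f n) x i"
      using infinite_enumerate by (smt (verit) mem_Collect_eq)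
    then obtain xs where xs: "\<And>n. (xs n, i) \<in> Lam (S (r (f n)))" "\<And>n. norm (xs n) \<le> c" "\<And>n. Q (f n) (xs n) i"
      by metis
    have "compact (cball (0::'a) c)" by simp
    then obtain x g where g: "strict_mono (g :: nat \<Rightarrow> nat)" "(xs \<circ> g) \<longlonglongrightarrow> x"
      using xs(2) unfolding compact_def by (metis mem_cball_0)
    have fg: "strict_mono (f \<circ> g)" using f(1) g(1) by (rule strict_mono_o)
    have "(x, i) \<in> L" by (rule limit[OF fg g(2)]) (simp add: xs)
    then show ?thesis using fg g(2) xs(3)
      by (intro exI[of _ "f \<circ> g"] exI[of _ "xs \<circ> g"] exI[of _ i] exI[of _ x]) simp
  qed
  have "covering L" unfolding covering_def
  proof
    fix z
    have "\<exists>x i. (x, i) \<in> Lam (S (r n)) \<and> norm x \<le> norm z + support_bound \<and> z - x \<in> A i" for n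
    proof -
      obtain x i where x: "(x, i) \<in> Lam (S (r n))" "z - x \<in> A i" "norm (z - x) \<le> support_bound"
        using tiling_cover_norm[OF S] .
      have "norm x \<le> norm z + norm (z - x)" using norm_triangle_ineq4[of z "z - x"] by simp
      then show ?thesis using x by (intro exI[of _ x] exI[of _ i]) auto
    qed
    then have "\<exists>\<^sub>F n in sequentially. \<exists>x i. (x, i) \<in> Lam (S (r n)) \<and> norm x \<le> norm z + support_bound \<and> z - x \<in> A i"
      by (intro eventually_frequently always_eventually) auto
    from limit_of[OF this] obtain f xs i x where
      x: "xs \<longlonglongrightarrow> x" "(x, i) \<in> L" "\<forall>n. z - xs n \<in> A i" by blast
    have "(\<lambda>n. z - xs n) \<longlonglongrightarrow> z - x" by (intro tendsto_intros x)
    then have "z - x \<in> A i"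
      using x(3) compact_imp_closed[OF compact] by (meson closed_sequentially)
    then show "\<exists>x i. (x, i) \<in> L \<and> z - x \<in> A i" using x by blast
  qed
  moreover have "separated L" unfolding separated_def
  proof (intro allI impI, elim conjE)
    fix x i y j z
    assume xy: "(x, i) \<in> L" "(y, j) \<in> L" and z: "z - x \<in> interior (A i)" "z - y \<in> interior (A j)"
    obtain d1 where d1: "d1 > 0" "ball (z - x) d1 \<subseteq> interior (A i)"
      using z(1) open_contains_ball open_interior by blast
    obtain d2 where d2: "d2 > 0" "ball (z - y) d2 \<subseteq> interior (A j)"
      using z(2) open_contains_ball open_interior by blast
    \<comment> \<open>Membership in the interiors is an open condition, so nearby tiles of some
      \<open>S (r n)\<close> already overlap and coincide.\<close>
    have "i = j \<and> dist x y < e" if "e > 0" for e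
    proof -
      define d where "d = min (e / 2) (min d1 d2)"
      have d: "d > 0" "d \<le> e / 2" "d \<le> d1" "d \<le> d2" using d1(1) d2(1) \<open>e > 0\<close> by (auto simp: d_def)
      have "\<forall>\<^sub>F n in sequentially. (\<exists>x'. dist x' x < d \<and> (x', i) \<in> Lam (S (r n))) \<and>
          (\<exists>y'. dist y' y < d \<and> (y', j) \<in> Lam (S (r n)))"
        by (intro eventually_conj near xy d(1))
      then obtain n x' y' where n: "dist x' x < d" "(x', i) \<in> Lam (S (r n))"
          "dist y' y < d" "(y', j) \<in> Lam (S (r n))"
        using eventually_happens by force
      have "z - x' \<in> ball (z - x) d1" "z - y' \<in> ball (z - y) d2"
        using n d by (auto simp: dist_norm)
      then have "z - x' \<in> interior (A i)" "z - y' \<in> interior (A j)" using d1 d2 by blast+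
      then have "x' = y' \<and> i = j"
        using S n unfolding tiling_iff separated_def by blast
      moreover have "dist x y \<le> dist x' x + dist x' y" by (metis dist_commute dist_triangle)
      ultimately show ?thesis using n d by auto
    qed
    then show "x = y \<and> i = j" by (metis dist_pos_lt less_irrefl zero_less_one)
  qed
  ultimately have tiling: "tiling (tiles_of L)" by (rule tiling_tiles_of)
  have "(\<lambda>n. tdist (S (r n)) (tiles_of L)) \<longlonglongrightarrow> 0"
  proof (rule LIMSEQ_I)
    fix e0 :: real assume "e0 > 0"
    \<comment> \<open>Closeness at \<open>e\<close> bounds the distance only by \<open>e\<close>,
      while the limit asks for a strict inequality.\<close>
    define e where "e = e0 / 2"
    have e: "e > 0" "e < e0" using \<open>e0 > 0\<close> by (auto simp: e_def)
    have one: "\<forall>\<^sub>F n in sequentially. \<forall>x i. (x, i) \<in> Lam (S (r n)) \<and> norm x < 1 / e \<longrightarrow> (\<exists>y. (y, i) \<in> L \<and> dist x y < e)"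
    proof (rule ccontr)
      assume "\<not> ?thesis"
      then have "\<exists>\<^sub>F n in sequentially. \<exists>x i. (x, i) \<in> Lam (S (r n)) \<and> norm x \<le> 1 / e \<and>
          \<not> (\<exists>y. (y, i) \<in> L \<and> dist x y < e)"
        unfolding not_eventually by (rule frequently_elim1) force
      from limit_of[OF this] obtain f xs i x where x: "xs \<longlonglongrightarrow> x" "(x, i) \<in> L"
        "\<forall>n. \<not> (\<exists>y. (y, i) \<in> L \<and> dist (xs n) y < e)" by blast
      have "\<forall>\<^sub>F n in sequentially. dist (xs n) x < e" using tendstoD[OF x(1) e(1)] .
      then obtain n where "dist (xs n) x < e" using eventually_happens by force
      then show False using x by blast
    qed
    \<comment> \<open>The reverse inclusion is uniform in the point because only finitely many tiles
      of the limit lie in the window.\<close>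
    have fin: "finite {(x, i). (x, i) \<in> L \<and> norm x \<le> 1 / e}"
      using finite_Lam_bounded[OF tiling, of "1 / e"] by simp
    have "\<forall>\<^sub>F n in sequentially. \<forall>p\<in>{(x, i). (x, i) \<in> L \<and> norm x \<le> 1 / e}.
        \<exists>y. dist y (fst p) < e \<and> (y, snd p) \<in> Lam (S (r n))"
      using fin by (rule eventually_ball_finite) (auto intro: near e)
    with one have "\<forall>\<^sub>F n in sequentially. close e (S (r n)) (tiles_of L)"
    proof eventually_elim
      case (elim n)
      show ?case
      proof (rule closeI)
        show "\<exists>y. (y, i) \<in> Lam (tiles_of L) \<and> dist x y < e" if "(x, i) \<in> Lam (S (r n))" "norm x < 1 / e" for x i
          using elim(1) that by simp
        show "\<exists>y. (y, i) \<in> Lam (S (r n)) \<and> dist x y < e" if "(x, i) \<in> Lam (tiles_of L)" "norm x < 1 / e" for x i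
          using elim(2) that by (fastforce simp: dist_commute)
      qed
    qed
    then obtain N where "\<forall>n\<ge>N. close e (S (r n)) (tiles_of L)"
      unfolding eventually_sequentially by blast
    then have "\<forall>n\<ge>N. tdist (S (r n)) (tiles_of L) \<le> e" using tdist_le_close e(1) by blast
    then show "\<exists>N. \<forall>n\<ge>N. norm (tdist (S (r n)) (tiles_of L) - 0) < e0"
      using e(2) tdist_nonneg by (auto intro!: exI[of _ N] intro: le_less_trans)
  qed
  then show thesis using that r(1) tiling by blast
qed

end

section \<open>Approximation by uniformly continuous functions\<close>

text \<open>Stated for a bare distance on a set, since the metric of the hull lives on a set of
  tilings and not on a type.\<close>

definition unif_cont :: "'b set \<Rightarrow> ('b \<Rightarrow> 'b \<Rightarrow> real) \<Rightarrow> ('b \<Rightarrow> complex) \<Rightarrow> bool" where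
  "unif_cont M d g \<longleftrightarrow> (\<forall>e>0. \<exists>r>0. \<forall>x\<in>M. \<forall>y\<in>M. d x y < r \<longrightarrow> cmod (g x - g y) \<le> e)"

lemma unif_cont_const: "unif_cont M d (\<lambda>x. c)"
  by (auto simp: unif_cont_def intro: exI[of _ 1])

lemma unif_cont_add:
  assumes "unif_cont M d f" "unif_cont M d g"
  shows "unif_cont M d (\<lambda>x. f x + g x)"
  unfolding unif_cont_def
proof (intro allI impI)
  fix e :: real assume "e > 0"
  then have e2: "e / 2 > 0" by simp
  obtain r where r: "r > 0" "\<And>x y. x \<in> M \<Longrightarrow> y \<in> M \<Longrightarrow> d x y < r \<Longrightarrow> cmod (f x - f y) \<le> e / 2"
    using assms(1) e2 unfolding unif_cont_def by metis
  obtain s where s: "s > 0" "\<And>x y. x \<in> M \<Longrightarrow> y \<in> M \<Longrightarrow> d x y < s \<Longrightarrow> cmod (g x - g y) \<le> e / 2"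
    using assms(2) e2 unfolding unif_cont_def by metis
  have "cmod ((f x + g x) - (f y + g y)) \<le> e" if "x \<in> M" "y \<in> M" "d x y < min r s" for x y
  proof -
    have "cmod ((f x - f y) + (g x - g y)) \<le> e / 2 + e / 2"
      using that by (intro norm_triangle_le add_mono r(2) s(2)) auto
    then show ?thesis by (simp add: algebra_simps)
  qed
  then show "\<exists>r>0. \<forall>x\<in>M. \<forall>y\<in>M. d x y < r \<longrightarrow> cmod ((f x + g x) - (f y + g y)) \<le> e"
    using r(1) s(1) by (intro exI[of _ "min r s"]) auto
qed

lemma unif_cont_cmult:
  assumes "unif_cont M d f"
  shows "unif_cont M d (\<lambda>x. c * f x)"
  unfolding unif_cont_def
proof (intro allI impI)
  fix e :: real assume "e > 0"
  then have "e / (cmod c + 1) > 0" by (simp add: add_nonneg_pos)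
  then obtain r where r: "r > 0" "\<And>x y. x \<in> M \<Longrightarrow> y \<in> M \<Longrightarrow> d x y < r \<Longrightarrow> cmod (f x - f y) \<le> e / (cmod c + 1)"
    using assms unfolding unif_cont_def by metis
  have "cmod (c * f x - c * f y) \<le> e" if "x \<in> M" "y \<in> M" "d x y < r" for x y
  proof -
    have "cmod (c * f x - c * f y) = cmod c * cmod (f x - f y)"
      by (simp add: norm_mult flip: right_diff_distrib)
    also have "\<dots> \<le> (cmod c + 1) * (e / (cmod c + 1))"
      using r(2)[OF that] by (intro mult_mono) auto
    also have "\<dots> = e" using norm_ge_zero[of c] by (simp add: add_nonneg_eq_0_iff)
    finally show ?thesis .
  qed
  then show "\<exists>r>0. \<forall>x\<in>M. \<forall>y\<in>M. d x y < r \<longrightarrow> cmod (c * f x - c * f y) \<le> e"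
    using r(1) by blast
qed

context Metric_space
begin

lemma unif_cont_imp_continuous_map:
  assumes "unif_cont M d g"
  shows "continuous_map mtopology euclidean g"
  unfolding continuous_map_def
proof (intro conjI allI impI)
  fix W :: "complex set" assume "openin euclidean W"
  then have W: "open W" by simp
  have "openin mtopology {x \<in> M. g x \<in> W}"
    unfolding openin_mtopology
  proof (intro conjI allI impI)
    fix x assume x: "x \<in> {x \<in> M. g x \<in> W}"
    then obtain e where e: "e > 0" "cball (g x) e \<subseteq> W"
      using W open_contains_cball by blast
    obtain r where r: "r > 0" "\<forall>x\<in>M. \<forall>y\<in>M. d x y < r \<longrightarrow> cmod (g x - g y) \<le> e"
      using assms e(1) unfolding unif_cont_def by blast
    have "mball x r \<subseteq> {x \<in> M. g x \<in> W}"
      using x r(2) e(2) by (auto simp: dist_norm subset_iff)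
    then show "\<exists>r>0. mball x r \<subseteq> {x \<in> M. g x \<in> W}" using r(1) by blast
  qed simp
  then show "openin mtopology {x \<in> topspace mtopology. g x \<in> W}" by simp
qed simp

lemma unif_cont_measurable:
  assumes "unif_cont M d g" "space N = M" "sets N = sigma_sets M {U. openin mtopology U}"
  shows "g \<in> borel_measurable N"
proof (rule borel_measurableI)
  fix W :: "complex set" assume "open W"
  then have "openin mtopology {x \<in> M. g x \<in> W}"
    using unif_cont_imp_continuous_map[OF assms(1)] by (simp add: continuous_map_def)
  moreover have "g -` W \<inter> M = {x \<in> M. g x \<in> W}" by auto
  ultimately show "g -` W \<inter> space N \<in> sets N" unfolding assms by (intro sigma_sets.Basic) simp
qed

text \<open>The functions \<open>min 1 (k * D x)\<close>, with \<open>D\<close> the distance to the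
  complement of \<open>U\<close>, increase to the indicator of \<open>U\<close>; each is uniformly
  continuous as \<open>D\<close> is 1-Lipschitz.\<close>

lemma integral_approx_open:
  assumes N: "finite_measure N" "space N = M" "sets N = sigma_sets M {U. openin mtopology U}"
    and U: "openin mtopology U" and e: "e > (0 :: real)"
  shows "\<exists>g. integrable N g \<and> unif_cont M d g \<and> (\<integral>x. cmod (indicator U x - g x) \<partial>N) < e"
proof -
  interpret finite_measure N by (rule N)
  have UM: "U \<subseteq> M" using U unfolding openin_mtopology by blast
  \<comment> \<open>The value \<open>1\<close> replaces the infimum over an empty complement and
    gives the constant \<open>1\<close> for every positive \<open>k\<close>.\<close>
  define D where "D x = (if M \<subseteq> U then 1 else (INF y\<in>M - U. d x y))" for x
  have bdd: "bdd_below ((\<lambda>y. d x y) ` (M - U))" for x by (rule bdd_belowI[of _ 0]) auto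
  have D0: "D x \<ge> 0" for x
    unfolding D_def by (auto intro!: cINF_greatest)
  have Dlip: "D x \<le> D y + d x y" if "x \<in> M" "y \<in> M" for x y
  proof (cases "M \<subseteq> U")
    case False
    have "D x - d x y \<le> d y z" if "z \<in> M - U" for z
    proof -
      have "D x \<le> d x z" using False bdd that by (auto simp: D_def intro!: cINF_lower)
      also have "\<dots> \<le> d x y + d y z" using that \<open>x \<in> M\<close> \<open>y \<in> M\<close> by (intro triangle) auto
      finally show ?thesis by simp
    qed
    then have "D x - d x y \<le> D y"
      using False unfolding D_def[of y] by (auto intro!: cINF_greatest)
    then show ?thesis by simp
  qed (simp add: D_def)
  have Dpos: "D x > 0" if "x \<in> U" for x
  proof (cases "M \<subseteq> U")
    case False
    obtain r where r: "r > 0" "mball x r \<subseteq> U" using U \<open>x \<in> U\<close> unfolding openin_mtopology by blast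
    have "r \<le> d x z" if "z \<in> M - U" for z
    proof (rule ccontr)
      assume "\<not> r \<le> d x z"
      then have "z \<in> mball x r" using that \<open>x \<in> U\<close> UM by auto
      then show False using r(2) that by blast
    qed
    then have "r \<le> D x" using False unfolding D_def by (auto intro!: cINF_greatest)
    then show ?thesis using r(1) by simp
  qed (simp add: D_def)
  have Dzero: "D x = 0" if "x \<in> M - U" for x
  proof -
    have "\<not> M \<subseteq> U" using that by blast
    then have "D x \<le> d x x" unfolding D_def using cINF_lower[OF bdd that] by simp
    then show ?thesis using D0[of x] that by simp
  qed
  define g where "g k x = complex_of_real (min 1 (real k * D x))" for k x
  have uc: "unif_cont M d (g k)" for k
    unfolding unif_cont_def
  proof (intro allI impI)
    fix e :: real assume "e > 0"
    have "cmod (g k x - g k y) \<le> e" if "x \<in> M" "y \<in> M" "d x y < e / (real k + 1)" for x y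
    proof -
      have "\<bar>D x - D y\<bar> \<le> d x y" using Dlip[OF that(1,2)] Dlip[OF that(2,1)] commute[of x y] by auto
      have "cmod (g k x - g k y) = \<bar>min 1 (real k * D x) - min 1 (real k * D y)\<bar>"
        unfolding g_def of_real_diff[symmetric] by (rule norm_of_real)
      also have "\<dots> \<le> \<bar>real k * D x - real k * D y\<bar>" by (auto simp: min_def)
      also have "\<dots> = real k * \<bar>D x - D y\<bar>" by (simp add: abs_mult flip: right_diff_distrib)
      also have "\<dots> \<le> (real k + 1) * (e / (real k + 1))"
        using \<open>\<bar>D x - D y\<bar> \<le> d x y\<close> that(3) by (intro mult_mono) auto
      also have "\<dots> = e" by (simp add: add_nonneg_eq_0_iff)
      finally show ?thesis .
    qed
    moreover have "e / (real k + 1) > 0" using \<open>e > 0\<close> by simp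
    ultimately show "\<exists>r>0. \<forall>x\<in>M. \<forall>y\<in>M. d x y < r \<longrightarrow> cmod (g k x - g k y) \<le> e" by blast
  qed
  have meas: "g k \<in> borel_measurable N" for k by (rule unif_cont_measurable[OF uc N(2,3)])
  have norm_g: "cmod (g k x) \<le> 1" for k x
    using D0[of x] unfolding g_def norm_of_real by (auto simp: min_def)
  have int: "integrable N (g k)" for k
    using norm_g meas by (intro integrable_const_bound[of _ 1]) auto
  have Us: "U \<in> sets N" unfolding N(3) using U by (intro sigma_sets.Basic) simp
  have "(\<lambda>k. \<integral>x. cmod (indicator U x - g k x) \<partial>N) \<longlonglongrightarrow> (\<integral>x. 0 \<partial>N)"
  proof (rule integral_dominated_convergence[where w = "\<lambda>x. 2"])
    show "AE x in N. (\<lambda>k. cmod (indicator U x - g k x)) \<longlonglongrightarrow> 0"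
    proof (rule AE_I2)
      fix x assume x: "x \<in> space N"
      have "\<forall>\<^sub>F k in sequentially. cmod (indicator U x - g k x) = 0"
      proof (cases "x \<in> U")
        case True
        obtain k0 :: nat where "1 / D x < real k0" using reals_Archimedean2 by blast
        then have "1 \<le> real k * D x" if "k \<ge> k0" for k
        proof -
          have "1 / D x \<le> real k" using \<open>1 / D x < real k0\<close> that by linarith
          then show ?thesis using Dpos[OF True] by (simp add: pos_divide_le_eq)
        qed
        then show ?thesis using True
          unfolding eventually_sequentially by (intro exI[of _ k0]) (simp add: g_def min_def)
      next
        case False
        then show ?thesis using Dzero[of x] x N(2) by (simp add: g_def)
      qed
      then show "(\<lambda>k. cmod (indicator U x - g k x)) \<longlonglongrightarrow> 0" by (rule tendsto_eventually)
    qed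
    show "AE x in N. norm (cmod (indicator U x - g k x)) \<le> 2" for k
    proof (rule AE_I2)
      fix x
      have "cmod (indicator U x - g k x) \<le> cmod (indicator U x) + cmod (g k x)" by (rule norm_triangle_ineq4)
      also have "\<dots> \<le> 1 + 1" using norm_g by (intro add_mono) (auto simp: indicator_def)
      finally show "norm (cmod (indicator U x - g k x)) \<le> 2" by simp
    qed
  qed (use meas Us in auto)
  then have "\<forall>\<^sub>F k in sequentially. (\<integral>x. cmod (indicator U x - g k x) \<partial>N) < e"
    using e by (intro order_tendstoD(2)) auto
  then obtain k where "(\<integral>x. cmod (indicator U x - g k x) \<partial>N) < e"
    using eventually_happens by force
  then show ?thesis using int uc by blast
qed

text \<open>The approximable functions \<open>P\<close> are closed under sums, multiples and limits
  in the mean. A Dynkin argument extends indicators from the intersection-stable open sets to all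
  measurable sets, and induction over integrable functions does the rest.\<close>

lemma integral_approx_unif_cont:
  fixes f :: "'a \<Rightarrow> complex"
  assumes N: "finite_measure N" "space N = M" "sets N = sigma_sets M {U. openin mtopology U}"
    and f: "integrable N f" and e: "e > 0"
  shows "\<exists>g. integrable N g \<and> unif_cont M d g \<and> (\<integral>x. cmod (f x - g x) \<partial>N) < e"
proof -
  interpret finite_measure N by (rule N)
  define P where "P f \<longleftrightarrow> integrable N f \<and>
    (\<forall>e>0. \<exists>g. integrable N g \<and> unif_cont M d g \<and> (\<integral>x. cmod (f x - g x) \<partial>N) < e)" for f
  have P_add: "P (\<lambda>x. f x + g x)" if Pf: "P f" and Pg: "P g" for f g
    unfolding P_def
  proof (intro conjI allI impI)
    have f: "integrable N f" and g: "integrable N g" using that by (auto simp: P_def)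
    then show "integrable N (\<lambda>x. f x + g x)" by simp
    fix e :: real assume "e > 0"
    then have "e / 2 > 0" by simp
    obtain f' where f': "integrable N f'" "unif_cont M d f'" "(\<integral>x. cmod (f x - f' x) \<partial>N) < e / 2"
      using Pf \<open>e / 2 > 0\<close> unfolding P_def by blast
    obtain g' where g': "integrable N g'" "unif_cont M d g'" "(\<integral>x. cmod (g x - g' x) \<partial>N) < e / 2"
      using Pg \<open>e / 2 > 0\<close> unfolding P_def by blast
    note fg = f' g'
    have "(\<integral>x. cmod ((f x + g x) - (f' x + g' x)) \<partial>N) \<le> (\<integral>x. cmod (f x - f' x) + cmod (g x - g' x) \<partial>N)"
    proof (rule integral_mono)
      show "cmod ((f x + g x) - (f' x + g' x)) \<le> cmod (f x - f' x) + cmod (g x - g' x)" for x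
        using norm_triangle_ineq[of "f x - f' x" "g x - g' x"] by (simp add: algebra_simps)
    qed (use f g fg in auto)
    also have "\<dots> < e" using f g fg by simp
    finally show "\<exists>h. integrable N h \<and> unif_cont M d h \<and> (\<integral>x. cmod ((f x + g x) - h x) \<partial>N) < e"
      using fg by (intro exI[of _ "\<lambda>x. f' x + g' x"]) (auto intro: unif_cont_add)
  qed
  have P_cmult: "P (\<lambda>x. c * f x)" if Pf: "P f" for f c
    unfolding P_def
  proof (intro conjI allI impI)
    have f: "integrable N f" using that by (auto simp: P_def)
    then show "integrable N (\<lambda>x. c * f x)" by simp
    fix e :: real assume "e > 0"
    then have pos: "e / (cmod c + 1) > 0" by (simp add: add_nonneg_pos)
    obtain g where g: "integrable N g" "unif_cont M d g" "(\<integral>x. cmod (f x - g x) \<partial>N) < e / (cmod c + 1)"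
      using Pf pos unfolding P_def by blast
    have "(\<integral>x. cmod (c * f x - c * g x) \<partial>N) = cmod c * (\<integral>x. cmod (f x - g x) \<partial>N)"
      by (simp add: norm_mult flip: right_diff_distrib)
    also have "\<dots> \<le> cmod c * (e / (cmod c + 1))" using g(3) by (intro mult_left_mono) auto
    also have "\<dots> < e"
      using \<open>e > 0\<close> norm_ge_zero[of c] by (simp add: pos_divide_less_eq add_nonneg_pos distrib_left)
    finally show "\<exists>h. integrable N h \<and> unif_cont M d h \<and> (\<integral>x. cmod (c * f x - h x) \<partial>N) < e"
      using g by (intro exI[of _ "\<lambda>x. c * g x"]) (auto intro: unif_cont_cmult)
  qed
  have P_lim: "P f" if f: "integrable N f" and s: "\<And>i. P (s i)" "(\<lambda>i. \<integral>x. cmod (f x - s i x) \<partial>N) \<longlonglongrightarrow> 0"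
    for f and s :: "nat \<Rightarrow> 'a \<Rightarrow> complex"
    unfolding P_def
  proof (intro conjI allI impI f)
    fix e :: real assume "e > 0"
    then have "e / 2 > 0" by simp
    then have "\<forall>\<^sub>F i in sequentially. (\<integral>x. cmod (f x - s i x) \<partial>N) < e / 2"
      using s(2) by (intro order_tendstoD(2)) auto
    then obtain i where i: "(\<integral>x. cmod (f x - s i x) \<partial>N) < e / 2" using eventually_happens by force
    obtain g where g: "integrable N g" "unif_cont M d g" "(\<integral>x. cmod (s i x - g x) \<partial>N) < e / 2"
      using s(1)[of i] \<open>e / 2 > 0\<close> unfolding P_def by blast
    have si: "integrable N (s i)" using s(1) by (simp add: P_def)
    have "(\<integral>x. cmod (f x - g x) \<partial>N) \<le> (\<integral>x. cmod (f x - s i x) + cmod (s i x - g x) \<partial>N)"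
    proof (rule integral_mono)
      show "cmod (f x - g x) \<le> cmod (f x - s i x) + cmod (s i x - g x)" for x
        using norm_triangle_ineq[of "f x - s i x" "s i x - g x"] by simp
    qed (use f g si in auto)
    also have "\<dots> < e" using f g si i by simp
    finally show "\<exists>g. integrable N g \<and> unif_cont M d g \<and> (\<integral>x. cmod (f x - g x) \<partial>N) < e"
      using g by blast
  qed
  have P_const: "P (\<lambda>x. c)" for c
    unfolding P_def by (auto intro!: exI[of _ "\<lambda>x. c"] unif_cont_const)
  have P_cong: "P g" if "P f" "\<And>x. x \<in> space N \<Longrightarrow> f x = g x" for f g
  proof -
    have "integrable N g \<longleftrightarrow> integrable N f" by (rule Bochner_Integration.integrable_cong) (auto simp: that(2))
    moreover have "(\<integral>x. cmod (g x - h x) \<partial>N) = (\<integral>x. cmod (f x - h x) \<partial>N)" for h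
      by (rule Bochner_Integration.integral_cong) (auto simp: that(2))
    ultimately show ?thesis using that(1) by (simp add: P_def)
  qed
  have P_ind: "P (indicator E)" if E: "E \<in> sets N" for E
  proof -
    let ?G = "{U. openin mtopology U}"
    have "Int_stable ?G" by (auto simp: Int_stable_def)
    moreover have "?G \<subseteq> Pow M" unfolding openin_mtopology by auto
    moreover have "E \<in> sigma_sets M ?G" using E N(3) by simp
    ultimately show ?thesis
    proof (induction rule: sigma_sets_induct_disjoint)
      case (basic U)
      then have "U \<in> sets N" unfolding N(3) by (intro sigma_sets.Basic)
      then have "integrable N (indicator U :: 'a \<Rightarrow> complex)"
        by (intro integrable_const_bound[of _ 1]) (auto simp: indicator_def intro!: borel_measurable_indicator)
      then show ?case
        using basic integral_approx_open[OF N] unfolding P_def by auto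
    next
      case empty
      show ?case using P_const[of 0] by (simp add: indicator_def)
    next
      case (compl E)
      have "P (\<lambda>x. 1 + (- 1) * indicator E x)" by (intro P_add P_const P_cmult compl)
      then show ?case by (rule P_cong) (auto simp: N(2) indicator_def)
    next
      case (union F)
      have F: "F i \<in> sets N" for i using union(2) N(3) by auto
      have finsum: "P (\<lambda>x. \<Sum>i<n. indicator (F i) x)" for n
        using union(3) by (induction n) (auto intro: P_add P_const)
      have int: "integrable N (indicator (\<Union>i. F i) :: 'a \<Rightarrow> complex)"
        using F by (intro integrable_const_bound[of _ 1]) (auto simp: indicator_def intro!: borel_measurable_indicator)
      show ?case
      proof (rule P_lim[OF int finsum])
        \<comment> \<open>By disjointness the mean error is the tail of a convergent series of
          measures.\<close>
        have eq: "(\<integral>x. cmod (indicator (\<Union>i. F i) x - (\<Sum>i<n. indicator (F i) x)) \<partial>N)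
            = measure N (\<Union>i. F i) - (\<Sum>i<n. measure N (F i))" for n
        proof -
          have disj: "disjoint_family_on F {..<n}" using union(1) by (auto simp: disjoint_family_on_def)
          have sum_ind: "(\<Sum>i<n. indicator (F i) x) = (indicator (\<Union>i<n. F i) x :: real)" for x
            using disj by (simp add: indicator_UN_disjoint)
          have le1: "(indicator (\<Union>i<n. F i) x :: real) \<le> indicator (\<Union>i. F i) x" for x
            by (auto simp: indicator_def)
          have "cmod (indicator (\<Union>i. F i) x - (\<Sum>i<n. indicator (F i) x))
              = indicator (\<Union>i. F i) x - (\<Sum>i<n. indicator (F i) x)" for x
          proof -
            have "indicator (\<Union>i. F i) x - (\<Sum>i<n. indicator (F i) x)
                = complex_of_real (indicator (\<Union>i. F i) x - (\<Sum>i<n. indicator (F i) x))"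
              by (simp add: of_real_indicator)
            then have "cmod (indicator (\<Union>i. F i) x - (\<Sum>i<n. indicator (F i) x))
                = \<bar>indicator (\<Union>i. F i) x - (\<Sum>i<n. indicator (F i) x)\<bar>" by (simp only: norm_of_real)
            then show ?thesis using le1[of x] sum_ind[of x] by simp
          qed
          moreover have "integrable N (indicator (F i) :: _ \<Rightarrow> real)" "integrable N (indicator (\<Union>i. F i) :: _ \<Rightarrow> real)" for i
            using F by (auto intro!: integrable_real_indicator simp: less_top[symmetric])
          ultimately show ?thesis using F by simp
        qed
        have "(\<lambda>i. measure N (F i)) sums measure N (\<Union>i. F i)"
          using F union(1) by (intro finite_measure_UNION) auto
        then have "(\<lambda>n. measure N (\<Union>i. F i) - (\<Sum>i<n. measure N (F i))) \<longlonglongrightarrow> 0"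
          unfolding sums_def using tendsto_diff[OF tendsto_const[of "measure N (\<Union>i. F i)"]] by fastforce
        then show "(\<lambda>n. \<integral>x. cmod (indicator (\<Union>i. F i) x - (\<Sum>i<n. indicator (F i) x)) \<partial>N) \<longlonglongrightarrow> 0"
          by (simp only: eq)
      qed
    qed
  qed
  have "P f" using f
  proof (induction rule: integrable_induct)
    case (base E c)
    have "P (\<lambda>x. c * indicator E x)" by (intro P_cmult P_ind base)
    then show ?case by (rule P_cong) (simp add: scaleR_conv_of_real of_real_indicator)
  next
    case (add f g)
    then show ?case by (intro P_add)
  next
    case (lim f s)
    have "(\<lambda>i. \<integral>x. cmod (f x - s i x) \<partial>N) \<longlonglongrightarrow> (\<integral>x. 0 \<partial>N)"
    proof (rule integral_dominated_convergence[where w = "\<lambda>x. 3 * cmod (f x)"])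
      show "AE x in N. (\<lambda>i. cmod (f x - s i x)) \<longlonglongrightarrow> 0"
      proof (rule AE_I2)
        fix x assume "x \<in> space N"
        then have "(\<lambda>i. s i x) \<longlonglongrightarrow> f x" by (rule lim.hyps(2))
        then have "(\<lambda>i. f x - s i x) \<longlonglongrightarrow> f x - f x" by (intro tendsto_intros)
        then show "(\<lambda>i. cmod (f x - s i x)) \<longlonglongrightarrow> 0" by (intro tendsto_norm_zero) simp
      qed
      show "AE x in N. norm (cmod (f x - s i x)) \<le> 3 * cmod (f x)" for i
      proof (rule AE_I2)
        fix x assume "x \<in> space N"
        then show "norm (cmod (f x - s i x)) \<le> 3 * cmod (f x)"
          using lim.hyps(3)[of x i] norm_triangle_ineq4[of "f x" "s i x"] by simp
      qed
    qed (use lim in auto)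
    then show ?case using lim by (intro P_lim[of f s]) auto
  qed
  then show ?thesis using e by (simp add: P_def)
qed

end

section \<open>Invariant measures\<close>

locale tiling_system = prototiles A
  for A :: "'k::finite \<Rightarrow> 'a::euclidean_space set" +
  fixes T :: "('a, 'k) tile set" and \<mu> :: "('a, 'k) tile set measure"
  assumes is_tiling: "tiling T" and invariant: "invariant_prob T \<mu>"
begin

sublocale prob_space \<mu>
  using invariant by (simp add: invariant_prob_def)

sublocale X: Metric_space "tiling_space T" tdist
  by (rule tilings.subspace) (auto intro: tiling_space_tiling[OF is_tiling])

lemma X_mtopology: "X.mtopology = X_top T"
proof -
  interpret sub: Submetric "Collect tiling" tdist "tiling_space T"
    by unfold_locales (auto intro: tiling_space_tiling[OF is_tiling])
  show ?thesis using sub.mtopology_submetric by (simp add: X_top_def)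
qed

lemma open_subset_space: "{U. openin (X_top T) U} \<subseteq> Pow (tiling_space T)"
  unfolding X_mtopology[symmetric] X.openin_mtopology by auto

lemma space_\<mu>: "space \<mu> = tiling_space T"
  and sets_\<mu>: "sets \<mu> = sigma_sets (tiling_space T) {U. openin X.mtopology U}"
proof -
  have *: "sets \<mu> = sets (sigma (tiling_space T) {U. openin (X_top T) U})"
    using invariant by (simp add: invariant_prob_def X_borel_def)
  from sets_eq_imp_space_eq[OF this] show "space \<mu> = tiling_space T"
    using open_subset_space by (simp add: space_measure_of)
  show "sets \<mu> = sigma_sets (tiling_space T) {U. openin X.mtopology U}"
    unfolding * X_mtopology using open_subset_space by (rule sets_measure_of)
qed

lemma shift_in_X: "S \<in> tiling_space T \<Longrightarrow> shift_tiles v S \<in> tiling_space T"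
  using shift_in_tiling_space[OF is_tiling] .

lemma shift_measurable [measurable]: "shift_tiles v \<in> measurable \<mu> \<mu>"
proof (rule measurable_sigma_sets[OF sets_\<mu>])
  show "{U. openin X.mtopology U} \<subseteq> Pow (tiling_space T)"
    using open_subset_space by (simp add: X_mtopology)
  show "shift_tiles v \<in> space \<mu> \<rightarrow> tiling_space T" by (simp add: space_\<mu> shift_in_X)
  fix U assume "U \<in> {U. openin X.mtopology U}"
  then have U: "openin X.mtopology U" by simp
  have "openin X.mtopology (shift_tiles v -` U \<inter> tiling_space T)"
    unfolding X.openin_mtopology
  proof (intro conjI allI impI)
    fix S assume S: "S \<in> shift_tiles v -` U \<inter> tiling_space T"
    then obtain e where e: "e > 0" "X.mball (shift_tiles v S) e \<subseteq> U"
      using U unfolding X.openin_mtopology by auto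
    have "e / 2 > 0" using e(1) by simp
    obtain d where d: "d > 0" "\<And>S1 S2 w. tdist S1 S2 < d \<Longrightarrow> norm w \<le> norm v \<Longrightarrow>
        tdist (shift_tiles w S1) (shift_tiles w S2) \<le> e / 2"
      using tdist_shift_uniform[OF \<open>e / 2 > 0\<close>, of "norm v"] by blast
    have "X.mball S d \<subseteq> shift_tiles v -` U \<inter> tiling_space T"
    proof
      fix S' assume S': "S' \<in> X.mball S d"
      then have X': "S' \<in> tiling_space T" "tdist S S' < d" by auto
      have "tdist (shift_tiles v S) (shift_tiles v S') \<le> e / 2" using d(2)[OF X'(2)] by simp
      then have "shift_tiles v S' \<in> X.mball (shift_tiles v S) e"
        using e(1) S X' by (simp add: shift_in_X)
      then show "S' \<in> shift_tiles v -` U \<inter> tiling_space T" using e(2) X' by auto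
    qed
    then show "\<exists>r>0. X.mball S r \<subseteq> shift_tiles v -` U \<inter> tiling_space T" using d(1) by blast
  qed simp
  then show "shift_tiles v -` U \<inter> space \<mu> \<in> sets \<mu>"
    unfolding space_\<mu> sets_\<mu> by (intro sigma_sets.Basic) simp
qed

lemma distr_shift: "distr \<mu> \<mu> (shift_tiles v) = \<mu>"
  using invariant unfolding invariant_prob_def by (metis minus_minus)

lemma AE_shift:
  assumes "AE S in \<mu>. P S"
  shows "AE S in \<mu>. P (shift_tiles v S)"
  using assms AE_distrD[OF shift_measurable[of v], of P] by (simp only: distr_shift)

lemma integral_shift:
  fixes f :: "('a, 'k) tile set \<Rightarrow> 'b::{banach, second_countable_topology}"
  assumes "f \<in> borel_measurable \<mu>"
  shows "(\<integral>S. f (shift_tiles v S) \<partial>\<mu>) = (\<integral>S. f S \<partial>\<mu>)"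
  using integral_distr[OF shift_measurable[of v] assms] by (simp only: distr_shift)

lemma integrable_shift:
  fixes f :: "('a, 'k) tile set \<Rightarrow> 'b::{banach, second_countable_topology}"
  assumes "integrable \<mu> f"
  shows "integrable \<mu> (\<lambda>S. f (shift_tiles v S))"
  using assms integrable_distr_eq[OF shift_measurable[of v] borel_measurable_integrable[OF assms]]
  by (simp only: distr_shift)

lemma approx_unif_cont:
  fixes f :: "('a, 'k) tile set \<Rightarrow> complex"
  assumes "integrable \<mu> f" "e > 0"
  shows "\<exists>g. integrable \<mu> g \<and> unif_cont (tiling_space T) tdist g \<and> (\<integral>S. cmod (f S - g S) \<partial>\<mu>) < e"
  using X.integral_approx_unif_cont[OF finite_measure_axioms space_\<mu> sets_\<mu> assms] .

text \<open>Selects one actual tiling that satisfies finitely many almost-everywhere identities and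
  has small approximation error.\<close>

lemma ex_less_if_integral_less:
  fixes h :: "('a, 'k) tile set \<Rightarrow> real"
  assumes "AE S in \<mu>. P S" "integrable \<mu> h" "(\<integral>S. h S \<partial>\<mu>) < c"
  shows "\<exists>S\<in>tiling_space T. P S \<and> h S < c"
proof (rule ccontr)
  assume "\<not> ?thesis"
  then have "AE S in \<mu>. P S \<longrightarrow> c \<le> h S"
    by (intro AE_I2) (auto simp: space_\<mu> not_less)
  with assms(1) have "AE S in \<mu>. c \<le> h S" by (rule AE_mp)
  then have "c \<le> (\<integral>S. h S \<partial>\<mu>)" by (rule integral_ge_const[OF assms(2)])
  then show False using assms(3) by simp
qed

text \<open>With errors \<open>(1 / 2) ^ n\<close>, Borel-Cantelli makes the approximating constants
  \<open>c n\<close> converge to \<open>h S\<close> for almost every \<open>S\<close>; a limit of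
  constants is constant.\<close>

lemma AE_constI:
  fixes h :: "('a, 'k) tile set \<Rightarrow> complex"
  assumes h: "h \<in> borel_measurable \<mu>"
    and ex: "\<And>e. e > 0 \<Longrightarrow> \<exists>c. measure \<mu> {S \<in> space \<mu>. cmod (h S - c) > e} \<le> e"
  shows "\<exists>c. AE S in \<mu>. h S = c"
proof -
  have "\<forall>n. \<exists>c. measure \<mu> {S \<in> space \<mu>. cmod (h S - c) > (1 / 2) ^ n} \<le> (1 / 2) ^ n"
    using ex by simp
  from choice[OF this] obtain c where
    c: "\<forall>n. measure \<mu> {S \<in> space \<mu>. cmod (h S - c n) > (1 / 2) ^ n} \<le> (1 / 2) ^ n" ..
  let ?B = "\<lambda>n. {S \<in> space \<mu>. cmod (h S - c n) > (1 / 2) ^ n}"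
  have "AE S in \<mu>. \<forall>\<^sub>F n in sequentially. S \<in> space \<mu> - ?B n"
  proof (rule borel_cantelli_AE1)
    show "?B n \<in> sets \<mu>" for n using h by measurable
    show "emeasure \<mu> (?B n) < \<infinity>" for n by (simp add: less_top[symmetric])
    show "summable (\<lambda>n. measure \<mu> (?B n))"
      by (rule summable_comparison_test'[where g = "\<lambda>n. (1 / 2) ^ n" and N = 0]) (use c in auto)
  qed
  then have lim: "AE S in \<mu>. c \<longlonglongrightarrow> h S"
  proof eventually_elim
    case (elim S)
    have "(\<lambda>n. (1 / 2 :: real) ^ n) \<longlonglongrightarrow> 0" by (intro LIMSEQ_power_zero) simp
    then have "(\<lambda>n. c n - h S) \<longlonglongrightarrow> 0"
      by (rule Lim_null_comparison[rotated])
         (use elim in \<open>eventually_elim, auto simp: norm_minus_commute\<close>)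
    then show ?case by (simp add: LIM_zero_iff)
  qed
  then show ?thesis
    by (intro exI[of _ "lim c"], eventually_elim) (simp add: limI)
qed

end

section \<open>Recurrence of patterns\<close>

text \<open>The points of the lattice of mesh \<delta> in a cube of half-side
  \<open>\<delta> * K\<close>. Counting them replaces volumes of sets of translations and keeps the
  number of exceptional null sets finite.\<close>

definition grid :: "real \<Rightarrow> nat \<Rightarrow> 'a::euclidean_space set" where
  "grid \<delta> K = (\<lambda>k. \<Sum>b\<in>Basis. (\<delta> * of_int (k b)) *\<^sub>R b) ` (PiE Basis (\<lambda>_. {- int K..int K}))"

lemma finite_grid [simp]: "finite (grid \<delta> K)"
  unfolding grid_def by (intro finite_imageI finite_PiE) auto

lemma grid_inner: "b \<in> Basis \<Longrightarrow> (\<Sum>b\<in>Basis. (\<delta> * of_int (k b)) *\<^sub>R b) \<bullet> b = \<delta> * of_int (k b)"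
  for b :: "'a::euclidean_space"
  by (rule inner_sum_left_Basis)

lemma card_grid:
  assumes "\<delta> > 0"
  shows "card (grid \<delta> K :: 'a::euclidean_space set) = (2 * K + 1) ^ DIM('a)"
proof -
  have "inj_on (\<lambda>k. \<Sum>b\<in>Basis. (\<delta> * of_int (k b)) *\<^sub>R b) (PiE (Basis :: 'a set) (\<lambda>_. {- int K..int K}))"
  proof (rule inj_onI)
    fix k l :: "'a \<Rightarrow> int"
    assume kl: "k \<in> PiE Basis (\<lambda>_. {- int K..int K})" "l \<in> PiE Basis (\<lambda>_. {- int K..int K})"
      and eq: "(\<Sum>b\<in>Basis. (\<delta> * of_int (k b)) *\<^sub>R b) = (\<Sum>b\<in>Basis. (\<delta> * of_int (l b)) *\<^sub>R b)"
    show "k = l"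
    proof (rule PiE_ext[OF kl])
      fix b :: 'a assume "b \<in> Basis"
      then have "\<delta> * of_int (k b) = \<delta> * of_int (l b)" using eq grid_inner by metis
      then show "k b = l b" using assms by simp
    qed
  qed
  then have "card (grid \<delta> K :: 'a set) = card (PiE (Basis :: 'a set) (\<lambda>_. {- int K..int K}))"
    unfolding grid_def by (rule card_image)
  also have "\<dots> = (2 * K + 1) ^ DIM('a)"
    by (simp add: card_PiE nat_add_distrib nat_mult_distrib)
  finally show ?thesis .
qed

lemma grid_add:
  assumes "x \<in> grid \<delta> K" "y \<in> grid \<delta> L"
  shows "x + y \<in> grid \<delta> (K + L)"
proof -
  obtain k where k: "k \<in> PiE Basis (\<lambda>_. {- int K..int K})" "x = (\<Sum>b\<in>Basis. (\<delta> * of_int (k b)) *\<^sub>R b)"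
    using assms(1) by (auto simp: grid_def)
  obtain l where l: "l \<in> PiE Basis (\<lambda>_. {- int L..int L})" "y = (\<Sum>b\<in>Basis. (\<delta> * of_int (l b)) *\<^sub>R b)"
    using assms(2) by (auto simp: grid_def)
  let ?m = "restrict (\<lambda>b. k b + l b) Basis"
  have "?m \<in> PiE Basis (\<lambda>_. {- int (K + L)..int (K + L)})"
  proof (rule restrict_PiE_iff[THEN iffD2], rule ballI)
    fix b :: 'a assume "b \<in> Basis"
    then have "k b \<in> {- int K..int K}" "l b \<in> {- int L..int L}" using k(1) l(1) by (auto dest: PiE_mem)
    then show "k b + l b \<in> {- int (K + L)..int (K + L)}" by auto
  qed
  moreover have "x + y = (\<Sum>b\<in>Basis. (\<delta> * of_int (?m b)) *\<^sub>R b)"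
    unfolding k(2) l(2) sum.distrib[symmetric] by (intro sum.cong) (auto simp: algebra_simps)
  ultimately show ?thesis unfolding grid_def by blast
qed

lemma norm_grid:
  assumes "\<delta> > 0" "(x :: 'a::euclidean_space) \<in> grid \<delta> K"
  shows "norm x \<le> real DIM('a) * (\<delta> * real K)"
proof -
  obtain k where k: "k \<in> PiE Basis (\<lambda>_. {- int K..int K})" "x = (\<Sum>b\<in>Basis. (\<delta> * of_int (k b)) *\<^sub>R b)"
    using assms(2) by (auto simp: grid_def)
  have "norm x \<le> (\<Sum>b\<in>Basis. \<bar>x \<bullet> b\<bar>)" by (rule norm_le_l1)
  also have "\<dots> \<le> (\<Sum>b\<in>(Basis :: 'a set). \<delta> * real K)"
  proof (rule sum_mono)
    fix b :: 'a assume b: "b \<in> Basis"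
    then have "k b \<in> {- int K..int K}" using k(1) by (auto dest: PiE_mem)
    then have "\<bar>real_of_int (k b)\<bar> \<le> K" by auto
    then show "\<bar>x \<bullet> b\<bar> \<le> \<delta> * K"
      using assms(1) b by (simp add: k(2) grid_inner abs_mult del: inner_sum_left_Basis)
  qed
  finally show ?thesis by simp
qed

lemma grid_approx:
  fixes x :: "'a::euclidean_space"
  assumes "\<delta> > 0" "norm x \<le> \<delta> * real K"
  obtains y where "y \<in> grid \<delta> K" "norm (y - x) \<le> real DIM('a) * \<delta>"
proof -
  define k where "k = restrict (\<lambda>b. \<lfloor>(x \<bullet> b) / \<delta>\<rfloor>) Basis"
  have "k \<in> PiE Basis (\<lambda>_. {- int K..int K})"
    unfolding k_def
  proof (rule restrict_PiE_iff[THEN iffD2], rule ballI)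
    fix b :: 'a assume "b \<in> Basis"
    then have "\<bar>x \<bullet> b\<bar> \<le> \<delta> * K" using Basis_le_norm assms(2) order_trans by blast
    then have "- (\<delta> * K) \<le> x \<bullet> b" "x \<bullet> b \<le> \<delta> * K" by auto
    then have "- real K \<le> (x \<bullet> b) / \<delta>" "(x \<bullet> b) / \<delta> \<le> K"
      using assms(1) by (auto simp: pos_le_divide_eq pos_divide_le_eq mult.commute)
    then show "\<lfloor>(x \<bullet> b) / \<delta>\<rfloor> \<in> {- int K..int K}" by (auto simp: le_floor_iff floor_le_iff)
  qed
  then have "(\<Sum>b\<in>Basis. (\<delta> * of_int (k b)) *\<^sub>R b) \<in> grid \<delta> K" (is "?y \<in> _")
    unfolding grid_def by blast
  moreover have "norm (?y - x) \<le> (\<Sum>b\<in>Basis. \<bar>(?y - x) \<bullet> b\<bar>)" by (rule norm_le_l1)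
  moreover have "(\<Sum>b\<in>Basis. \<bar>(?y - x) \<bullet> b\<bar>) \<le> (\<Sum>b\<in>(Basis :: 'a set). \<delta>)"
  proof (rule sum_mono)
    fix b :: 'a assume b: "b \<in> Basis"
    have "(?y - x) \<bullet> b = \<delta> * (of_int (k b) - (x \<bullet> b) / \<delta>)"
      using b assms(1) unfolding inner_diff_left grid_inner[OF b] by (simp add: algebra_simps)
    also have "\<bar>\<dots>\<bar> \<le> \<delta> * 1"
      using assms(1) b unfolding abs_mult by (intro mult_mono) (auto simp: k_def, linarith+)
    finally show "\<bar>(?y - x) \<bullet> b\<bar> \<le> \<delta>" by simp
  qed
  ultimately show thesis using that[of ?y] by simp
qed

section \<open>Agreement of iterated substitutes\<close>

context scaling_substitution
begin

lemma tiling_omega_iterate: "tiling S \<Longrightarrow> tiling ((omega ^^ n) S)"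
  by (induction n) (simp_all add: tiling_omega)

lemma omega_iterate_shift:
  "tiling S \<Longrightarrow> (omega ^^ n) (shift_tiles v S) = shift_tiles (\<theta> ^ n *\<^sub>R v) ((omega ^^ n) S)"
  by (induction n) (simp_all add: omega_shift tiling_omega_iterate)

text \<open>The common tile contains the ball of radius \<open>r\<close> about the origin, so the
  iterated substitutes agree on the ball of radius \<open>\<bar>\<theta>\<bar> ^ n * r\<close>. The
  term \<open>support_bound\<close> accounts for tiles whose position is in the window while the
  point used to recognise them is not.\<close>

lemma tdist_omega_iterate_le:
  assumes S: "tiling S1" "tiling S2" and x: "(x, i) \<in> Lam S1" "(x, i) \<in> Lam S2"
    and r: "\<And>z. norm z < r \<Longrightarrow> z - x \<in> A i" and e: "e > 0" "1 / e + support_bound \<le> \<bar>\<theta>\<bar> ^ n * r"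
  shows "tdist ((omega ^^ n) S1) ((omega ^^ n) S2) \<le> e"
proof -
  have *: "(y, k) \<in> Lam ((omega ^^ n) S2)"
    if S: "tiling S1" "(x, i) \<in> Lam S1" "(x, i) \<in> Lam S2" and y: "norm y < 1 / e" "(y, k) \<in> Lam ((omega ^^ n) S1)"
    for S1 S2 y k
  proof -
    \<comment> \<open>An interior point of the tile at \<open>y\<close> identifies it by
      \<open>tiling_unique\<close> with a tile of the common supertile.\<close>
    obtain a where a: "a \<in> interior (A k)" using interior_nonempty by blast
    define z where "z = (1 / \<theta> ^ n) *\<^sub>R (y + a)"
    have z: "\<theta> ^ n *\<^sub>R z = y + a" by (simp add: z_def)
    have "norm a \<le> support_bound" using a interior_subset support_bound(2) by blast
    then have "norm (y + a) < \<bar>\<theta>\<bar> ^ n * r" using y(1) e(2) norm_triangle_ineq[of y a] by linarith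
    then have "\<bar>\<theta>\<bar> ^ n * norm z < \<bar>\<theta>\<bar> ^ n * r" unfolding z[symmetric] by (simp add: power_abs)
    then have "norm z < r" using abs_theta by (simp add: mult_less_cancel_left_pos)
    then have "z - x \<in> A i" by (rule r)
    then obtain k' u where u: "u \<in> digits n k' i" "\<theta> ^ n *\<^sub>R (z - x) - u \<in> A k'" by (rule inflation_iterateE)
    have *: "(\<theta> ^ n *\<^sub>R x + u, k') \<in> Lam ((omega ^^ n) S)" if "(x, i) \<in> Lam S" for S
      unfolding Lam_omega_iterate using that u(1) by blast
    have "(y + a) - y \<in> interior (A k)" using a by simp
    moreover have "(y + a) - (\<theta> ^ n *\<^sub>R x + u) \<in> A k'"
      using u(2) unfolding scaleR_diff_right z by (simp add: algebra_simps)
    ultimately have "y = \<theta> ^ n *\<^sub>R x + u \<and> k = k'"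
      by (rule tiling_unique[OF tiling_omega_iterate[OF S(1)] y(2) *[OF S(2)]])
    then show ?thesis using *[OF S(3)] by simp
  qed
  show ?thesis
    by (rule tdist_le_if_agree[OF e(1)]) (use *[OF S(1) x] *[OF S(2) x(2,1)] in blast)
qed

end

section \<open>Relative density of types and recurrent differences\<close>

locale scaling_tiling = scaling_substitution A \<theta> D
  for A :: "'k::finite \<Rightarrow> 'a::euclidean_space set" and \<theta> D +
  fixes T :: "('a, 'k) tile set"
  assumes substitution_T: "substitution_tiling T"
begin

lemma tiling_T: "tiling T" and omega_T: "omega T = T"
  using substitution_T by (simp_all add: substitution_tiling_def)

lemma omega_iterate_T [simp]: "(omega ^^ n) T = T"
  by (induction n) (simp_all add: omega_T)

lemma Lam_T_iff: "(y, i) \<in> Lam T \<longleftrightarrow> (\<exists>x j. \<exists>u\<in>digits n i j. (x, j) \<in> Lam T \<and> y = \<theta> ^ n *\<^sub>R x + u)"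
  using Lam_omega_iterate[of y i n T] by simp

lemma Lam_T_digit: "(x, j) \<in> Lam T \<Longrightarrow> u \<in> digits n i j \<Longrightarrow> (\<theta> ^ n *\<^sub>R x + u, i) \<in> Lam T"
  using Lam_T_iff by blast

lemma omega_iterate_shift_T: "(omega ^^ n) (shift_tiles v T) = shift_tiles (\<theta> ^ n *\<^sub>R v) T"
  by (simp add: omega_iterate_shift tiling_T)

definition recurrent :: "'a \<Rightarrow> bool" where
  "recurrent \<xi> \<longleftrightarrow> (\<exists>i c. \<forall>y. \<exists>w. norm (w - y) \<le> c \<and> (w, i) \<in> Lam T \<and> (w + \<xi>, i) \<in> Lam T)"

text \<open>Every supertile of order \<open>level\<close> contains all types, and the supertile
  covering \<open>y\<close> has bounded size.\<close>

lemma types_relatively_dense: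
  obtains c where "c > 0" "\<And>i y. \<exists>w. norm (w - y) \<le> c \<and> (w, i) \<in> Lam T"
proof -
  have "bounded (\<Union>i. \<Union>j. digits level i j)" by (intro finite_imp_bounded) simp
  then obtain B where "\<forall>u\<in>(\<Union>i. \<Union>j. digits level i j). norm u \<le> B"
    unfolding bounded_iff by blast
  then have B: "norm u \<le> B" if "u \<in> digits level i j" for u i j using that by blast
  define c where "c = \<bar>\<theta>\<bar> ^ level * support_bound + \<bar>B\<bar>"
  have "c > 0" using support_bound(1) abs_theta by (auto simp: c_def intro!: add_pos_nonneg)
  moreover have "\<exists>w. norm (w - y) \<le> c \<and> (w, i) \<in> Lam T" for i y
  proof -
    define z where "z = (1 / \<theta> ^ level) *\<^sub>R y"
    have z: "\<theta> ^ level *\<^sub>R z = y" by (simp add: z_def)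
    obtain x j where x: "(x, j) \<in> Lam T" "norm (z - x) \<le> support_bound"
      using tiling_cover_norm[OF tiling_T] by metis
    obtain u where u: "u \<in> digits level i j" using level(2)[of i j] by blast
    have "norm (\<theta> ^ level *\<^sub>R x + u - y) = norm (u - \<theta> ^ level *\<^sub>R (z - x))"
      unfolding z[symmetric] by (simp add: algebra_simps)
    also have "\<dots> \<le> norm u + \<bar>\<theta>\<bar> ^ level * norm (z - x)"
      using norm_triangle_ineq4[of u "\<theta> ^ level *\<^sub>R (z - x)"] by (simp add: power_abs)
    also have "\<dots> \<le> B + \<bar>\<theta>\<bar> ^ level * support_bound"
      using x(2) B[OF u] by (intro add_mono mult_left_mono) auto
    also have "\<dots> \<le> c" by (simp add: c_def)
    finally show ?thesis using Lam_T_digit[OF x(1) u] by blast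
  qed
  ultimately show thesis using that by blast
qed

lemma Lam_T_nonempty: "\<exists>x. (x, i) \<in> Lam T"
  using types_relatively_dense by metis

text \<open>The pair of tiles reappears in every supertile of order \<open>n\<close> and type
  \<open>l\<close>, and those are relatively dense.\<close>

lemma recurrent_if_within_supertile:
  assumes "u \<in> digits n i l" "u' \<in> digits n i l"
  shows "recurrent (u' - u)"
proof -
  obtain c where c: "c > 0" "\<And>i y. \<exists>w. norm (w - y) \<le> c \<and> (w, i) \<in> Lam T"
    using types_relatively_dense by blast
  have "\<exists>w. norm (w - y) \<le> \<bar>\<theta>\<bar> ^ n * c + norm u \<and> (w, i) \<in> Lam T \<and> (w + (u' - u), i) \<in> Lam T" for y
  proof -
    define z where "z = (1 / \<theta> ^ n) *\<^sub>R y"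
    have z: "\<theta> ^ n *\<^sub>R z = y" by (simp add: z_def)
    obtain w where w: "norm (w - z) \<le> c" "(w, l) \<in> Lam T" using c(2) by blast
    have "norm (\<theta> ^ n *\<^sub>R w + u - y) = norm (\<theta> ^ n *\<^sub>R (w - z) + u)"
      unfolding z[symmetric] by (simp add: algebra_simps)
    also have "\<dots> \<le> \<bar>\<theta>\<bar> ^ n * norm (w - z) + norm u"
      using norm_triangle_ineq[of "\<theta> ^ n *\<^sub>R (w - z)" u] by (simp add: power_abs)
    also have "\<dots> \<le> \<bar>\<theta>\<bar> ^ n * c + norm u" using w(1) by (simp add: mult_left_mono)
    finally show ?thesis
      using Lam_T_digit[OF w(2) assms(1)] Lam_T_digit[OF w(2) assms(2)]
      by (intro exI[of _ "\<theta> ^ n *\<^sub>R w + u"]) simp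
  qed
  then show ?thesis unfolding recurrent_def by blast
qed

text \<open>The radius is split in two: one \<open>r\<close> allows a ball about the origin, the
  other may be spent on approximating the position of the tile.\<close>

lemma inner_ball:
  obtains p r where "r > 0" "\<And>a. norm (a - p) < 2 * r \<Longrightarrow> a \<in> A i"
proof -
  obtain p r where pr: "r > 0" "ball p r \<subseteq> A i"
    using interior_nonempty[of i] by (metis all_not_in_conv mem_interior)
  show thesis
    using pr by (intro that[of "r / 2" p]) (auto simp: subset_iff dist_norm norm_minus_commute)
qed

text \<open>Two tiles of type \<open>i\<close> in one large supertile are chosen displaced roughly
  along \<alpha>.\<close>

lemma recurrent_inner_nonzero:
  assumes "\<alpha> \<noteq> 0"
  obtains \<xi> where "recurrent \<xi>" "\<xi> \<bullet> \<alpha> \<noteq> 0"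
proof -
  obtain c where c: "c > 0" "\<And>i y. \<exists>w. norm (w - y) \<le> c \<and> (w, i) \<in> Lam T"
    using types_relatively_dense by blast
  define i :: "'k" where "i = undefined"
  obtain p r where pr: "r > 0" "\<And>a. norm (a - p) < 2 * r \<Longrightarrow> a \<in> A i" using inner_ball[of i] by metis
  define e where "e = (1 / norm \<alpha>) *\<^sub>R \<alpha>"
  have e: "norm e = 1" "e \<bullet> \<alpha> = norm \<alpha>"
    using assms by (simp_all add: e_def dot_square_norm power2_eq_square)
  \<comment> \<open>Each of the two tiles is located up to an error \<open>c\<close>, so the inner
    product with \<alpha> remains at least \<open>norm \<alpha>\<close>.\<close>
  define s where "s = 2 * c + 1"
  obtain n where n: "(s + c + support_bound) / r < \<bar>\<theta>\<bar> ^ n"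
    using real_arch_pow[OF abs_theta] by blast
  obtain x where x: "(x, i) \<in> Lam T" using Lam_T_nonempty by blast
  define P where "P = \<theta> ^ n *\<^sub>R (x + p)"
  \<comment> \<open>All tiles of type \<open>i\<close> near \<open>P\<close> belong to the single
    supertile at \<open>x\<close>, by the choice of \<open>n\<close>.\<close>
  have digit: "\<exists>u\<in>digits n i i. w = \<theta> ^ n *\<^sub>R x + u" if w: "(w, i) \<in> Lam T" "norm (w - P) \<le> s + c" for w
  proof -
    obtain a where a: "a \<in> interior (A i)" using interior_nonempty by blast
    define z where "z = (1 / \<theta> ^ n) *\<^sub>R (w + a - P)"
    have z: "\<theta> ^ n *\<^sub>R z = w + a - P" by (simp add: z_def)
    have "norm a \<le> support_bound" using a interior_subset support_bound(2) by blast
    then have "norm (w + a - P) \<le> s + c + support_bound"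
      using w(2) norm_triangle_ineq[of "w - P" a] by (simp add: algebra_simps)
    also have "\<dots> < \<bar>\<theta>\<bar> ^ n * r" using n pr(1) by (simp add: pos_divide_less_eq)
    finally have "\<bar>\<theta>\<bar> ^ n * norm z < \<bar>\<theta>\<bar> ^ n * r" unfolding z[symmetric] by (simp add: power_abs)
    then have "norm z < r" using abs_theta by (simp add: mult_less_cancel_left_pos)
    then have "z + p \<in> A i" using pr by simp
    then obtain k u where u: "u \<in> digits n k i" "\<theta> ^ n *\<^sub>R (z + p) - u \<in> A k" by (rule inflation_iterateE)
    have "(w + a) - w \<in> interior (A i)" using a by simp
    moreover have eq: "(w + a) - (\<theta> ^ n *\<^sub>R x + u) = \<theta> ^ n *\<^sub>R (z + p) - u"
      unfolding scaleR_add_right z P_def by (simp add: algebra_simps)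
    have "(w + a) - (\<theta> ^ n *\<^sub>R x + u) \<in> A k" unfolding eq by (rule u(2))
    ultimately have "w = \<theta> ^ n *\<^sub>R x + u \<and> i = k"
      by (rule tiling_unique[OF tiling_T w(1) Lam_T_digit[OF x u(1)]])
    then show ?thesis using u(1) by blast
  qed
  obtain w where w: "norm (w - P) \<le> c" "(w, i) \<in> Lam T" using c(2) by blast
  obtain w' where w': "norm (w' - (P + s *\<^sub>R e)) \<le> c" "(w', i) \<in> Lam T" using c(2) by blast
  have s: "s > 0" using c(1) by (simp add: s_def)
  have "norm (w' - P) \<le> s + c"
    using norm_triangle_ineq[of "w' - (P + s *\<^sub>R e)" "s *\<^sub>R e"] w'(1) e s by (simp add: algebra_simps)
  then obtain u' where u': "u' \<in> digits n i i" "w' = \<theta> ^ n *\<^sub>R x + u'" using digit w' by blast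
  obtain u where u: "u \<in> digits n i i" "w = \<theta> ^ n *\<^sub>R x + u" using digit[OF w(2)] w(1) s by force
  have "(w' - w) \<bullet> \<alpha> = s * norm \<alpha> + (w' - (P + s *\<^sub>R e)) \<bullet> \<alpha> - (w - P) \<bullet> \<alpha>"
    by (simp add: algebra_simps inner_diff_left inner_add_left e(2))
  moreover have "\<bar>(w' - (P + s *\<^sub>R e)) \<bullet> \<alpha>\<bar> \<le> c * norm \<alpha>"
    using Cauchy_Schwarz_ineq2 mult_right_mono[OF w'(1) norm_ge_zero] order_trans by blast
  moreover have "\<bar>(w - P) \<bullet> \<alpha>\<bar> \<le> c * norm \<alpha>"
    using Cauchy_Schwarz_ineq2 mult_right_mono[OF w(1) norm_ge_zero] order_trans by blast
  ultimately have "(w' - w) \<bullet> \<alpha> \<ge> s * norm \<alpha> - 2 * c * norm \<alpha>" by linarith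
  also have "s * norm \<alpha> - 2 * c * norm \<alpha> = norm \<alpha>" by (simp add: s_def algebra_simps)
  finally have "(w' - w) \<bullet> \<alpha> > 0" using assms zero_less_norm_iff by (metis less_le_trans)
  moreover have "w' - w = u' - u" using u(2) u'(2) by simp
  ultimately show thesis
    using that[of "u' - u"] recurrent_if_within_supertile[OF u(1) u'(1)] by simp
qed

end

section \<open>Nearly equal translates and patterns common to the whole hull\<close>

context scaling_tiling
begin

lemma orbit_approximation:
  assumes S: "S \<in> tiling_space T" and e: "e > 0"
  obtains y where "\<And>v. norm v \<le> b \<Longrightarrow> tdist (shift_tiles v S) (shift_tiles (v - y) T) \<le> e"
proof -
  obtain d where d: "d > 0" "\<And>S1 S2 v. tdist S1 S2 < d \<Longrightarrow> norm v \<le> b \<Longrightarrow>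
      tdist (shift_tiles v S1) (shift_tiles v S2) \<le> e"
    using tdist_shift_uniform[OF e, of b] by metis
  obtain y where "tdist S (shift_tiles (- y) T) < d"
    using S d(1) tiling_space_iff[OF tiling_T] by blast
  then show thesis using d(2)[of S "shift_tiles (- y) T"] by (intro that[of y]) simp
qed

lemma ex_large_power:
  obtains n0 where "\<And>n. n \<ge> n0 \<Longrightarrow> c \<le> \<bar>\<theta>\<bar> ^ n"
proof -
  obtain n0 where "c < \<bar>\<theta>\<bar> ^ n0" using real_arch_pow[OF abs_theta] by blast
  moreover have "\<bar>\<theta>\<bar> ^ n0 \<le> \<bar>\<theta>\<bar> ^ n" if "n \<ge> n0" for n
    using that abs_theta by (intro power_increasing) auto
  ultimately show thesis by (intro that[of n0]) force
qed

text \<open>\<open>F\<close> is chosen before inflation and does not depend on \<open>e\<close>,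
  \<open>n\<close> or \<open>S\<close>. This allows \<open>eigenvalue_circle_dist\<close> to fix its
  approximation error in terms of \<open>card F\<close> before choosing \<open>n\<close>.\<close>

lemma recurrent_close:
  assumes "recurrent \<xi>"
  obtains F where "finite F" "\<And>e. e > 0 \<Longrightarrow> \<exists>n0. \<forall>n\<ge>n0. \<forall>S\<in>tiling_space T. \<exists>x\<in>F.
    tdist (shift_tiles (- (\<theta> ^ n *\<^sub>R x)) S) (shift_tiles (- (\<theta> ^ n *\<^sub>R (x + \<xi>))) S) \<le> e"
proof -
  obtain i c where c: "\<And>y. \<exists>w. norm (w - y) \<le> c \<and> (w, i) \<in> Lam T \<and> (w + \<xi>, i) \<in> Lam T"
    using assms unfolding recurrent_def by blast
  obtain p r where pr: "r > 0" "\<And>a. norm (a - p) < 2 * r \<Longrightarrow> a \<in> A i" using inner_ball[of i] by metis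
  \<comment> \<open>Relative to the origin the wanted tile sits anywhere in this ball; a finite net
    of mesh \<open>r\<close> captures its position well enough.\<close>
  have "compact (cball (0 :: 'a) (c + norm p))" by simp
  then obtain F where F: "finite F" "cball (0 :: 'a) (c + norm p) \<subseteq> (\<Union>x\<in>F. ball x r)"
    using pr(1) unfolding compact_eq_totally_bounded by blast
  show thesis
  proof (rule that[OF F(1)])
    fix e :: real assume e: "e > 0"
    obtain n0 where n0: "\<And>n. n \<ge> n0 \<Longrightarrow> (3 / e + support_bound) / r \<le> \<bar>\<theta>\<bar> ^ n"
      using ex_large_power by metis
    show "\<exists>n0. \<forall>n\<ge>n0. \<forall>S\<in>tiling_space T. \<exists>x\<in>F.
      tdist (shift_tiles (- (\<theta> ^ n *\<^sub>R x)) S) (shift_tiles (- (\<theta> ^ n *\<^sub>R (x + \<xi>))) S) \<le> e"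
    proof (intro exI[of _ n0] allI impI ballI)
      fix n S assume "n \<ge> n0" and S: "S \<in> tiling_space T"
      have "bounded ((\<lambda>x. \<theta> ^ n *\<^sub>R x) ` F \<union> (\<lambda>x. \<theta> ^ n *\<^sub>R (x + \<xi>)) ` F)"
        using F(1) by (intro finite_imp_bounded) simp
      then obtain b where "\<forall>v\<in>(\<lambda>x. \<theta> ^ n *\<^sub>R x) ` F \<union> (\<lambda>x. \<theta> ^ n *\<^sub>R (x + \<xi>)) ` F. norm v \<le> b"
        unfolding bounded_iff by blast
      then have b: "norm (\<theta> ^ n *\<^sub>R x) \<le> b" "norm (\<theta> ^ n *\<^sub>R (x + \<xi>)) \<le> b" if "x \<in> F" for x
        using that by blast+
      have "e / 3 > 0" using e by simp
      from orbit_approximation[OF S this, of b] obtain y where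
        y: "\<And>v. norm v \<le> b \<Longrightarrow> tdist (shift_tiles v S) (shift_tiles (v - y) T) \<le> e / 3" by metis
      define y' where "y' = (1 / \<theta> ^ n) *\<^sub>R y"
      have y': "\<theta> ^ n *\<^sub>R y' = y" by (simp add: y'_def)
      obtain w where w: "norm (w - y') \<le> c" "(w, i) \<in> Lam T" "(w + \<xi>, i) \<in> Lam T" using c by blast
      have "w - y' + p \<in> cball 0 (c + norm p)"
        using w(1) norm_triangle_ineq[of "w - y'" p] by simp
      then obtain x where x: "x \<in> F" "dist x (w - y' + p) < r" using F(2) by auto
      have large: "3 / e + support_bound \<le> \<bar>\<theta>\<bar> ^ n * r"
        using n0[OF \<open>n \<ge> n0\<close>] pr(1) by (simp add: pos_divide_le_eq)
      \<comment> \<open>Before inflation the two translates share the tile at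
        \<open>w - y' - x\<close>: in the first it comes from \<open>w\<close>, in the second from
        \<open>w + \<xi>\<close>.\<close>
      have "tdist ((omega ^^ n) (shift_tiles (- x - y') T)) ((omega ^^ n) (shift_tiles (- (x + \<xi>) - y') T)) \<le> e / 3"
      proof (rule tdist_omega_iterate_le[where x = "w - y' - x" and i = i and r = r])
        show "z - (w - y' - x) \<in> A i" if "norm z < r" for z
        proof (rule pr(2))
          have eq: "z - (w - y' - x) - p = z + (x - (w - y' + p))" by simp
          show "norm (z - (w - y' - x) - p) < 2 * r"
            unfolding eq using norm_triangle_ineq[of z "x - (w - y' + p)"] that x(2)[unfolded dist_norm] by linarith
        qed
      qed (use w large e in \<open>auto simp: tiling_T algebra_simps\<close>)
      then have "tdist (shift_tiles (- (\<theta> ^ n *\<^sub>R x) - y) T) (shift_tiles (- (\<theta> ^ n *\<^sub>R (x + \<xi>)) - y) T) \<le> e / 3"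
        by (simp add: omega_iterate_shift_T scaleR_diff_right scaleR_add_right y')
      moreover have "tdist (shift_tiles (- (\<theta> ^ n *\<^sub>R x)) S) (shift_tiles (- (\<theta> ^ n *\<^sub>R x) - y) T) \<le> e / 3"
        using b(1)[OF x(1)] by (intro y) simp
      moreover have "tdist (shift_tiles (- (\<theta> ^ n *\<^sub>R (x + \<xi>))) S) (shift_tiles (- (\<theta> ^ n *\<^sub>R (x + \<xi>)) - y) T) \<le> e / 3"
        using b(2)[OF x(1)] by (intro y) simp
      ultimately have "tdist (shift_tiles (- (\<theta> ^ n *\<^sub>R x)) S) (shift_tiles (- (\<theta> ^ n *\<^sub>R (x + \<xi>))) S) \<le> e"
        using tdist_triangle[of "shift_tiles (- (\<theta> ^ n *\<^sub>R x)) S" "shift_tiles (- (\<theta> ^ n *\<^sub>R (x + \<xi>))) S"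
            "shift_tiles (- (\<theta> ^ n *\<^sub>R x) - y) T"]
          tdist_triangle[of "shift_tiles (- (\<theta> ^ n *\<^sub>R x) - y) T" "shift_tiles (- (\<theta> ^ n *\<^sub>R (x + \<xi>))) S"
            "shift_tiles (- (\<theta> ^ n *\<^sub>R (x + \<xi>)) - y) T"]
          tdist_sym[of "shift_tiles (- (\<theta> ^ n *\<^sub>R (x + \<xi>))) S" "shift_tiles (- (\<theta> ^ n *\<^sub>R (x + \<xi>)) - y) T"]
        by linarith
      then show "\<exists>x\<in>F. tdist (shift_tiles (- (\<theta> ^ n *\<^sub>R x)) S) (shift_tiles (- (\<theta> ^ n *\<^sub>R (x + \<xi>))) S) \<le> e"
        using x(1) by blast
    qed
  qed
qed

text \<open>This takes the place of unique ergodicity in the proof that invariant functions are constant.\<close>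
lemma common_pattern:
  obtains c0 :: real where "c0 > 0"
    "\<And>e. e > 0 \<Longrightarrow> \<exists>(G :: 'a set) (\<Gamma> :: 'a set) R. finite G \<and> G \<noteq> {} \<and> finite \<Gamma> \<and> c0 * card G \<le> card \<Gamma> \<and>
      (\<forall>v. shift_tiles v R \<in> tiling_space T) \<and>
      (\<forall>S\<in>tiling_space T. \<exists>t. \<forall>\<gamma>\<in>\<Gamma>. t + \<gamma> \<in> G \<and> tdist (shift_tiles (- (t + \<gamma>)) S) (shift_tiles (- \<gamma>) R) \<le> e)"
proof -
  obtain c where c: "c > 0" "\<And>i y. \<exists>w. norm (w - y) \<le> c \<and> (w, i) \<in> Lam T"
    using types_relatively_dense by blast
  define i :: 'k where "i = undefined"
  obtain p r where pr: "r > 0" "\<And>a. norm (a - p) < 2 * r \<Longrightarrow> a \<in> A i" using inner_ball[of i] by metis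
  obtain z0 where z0: "(z0, i) \<in> Lam T" using Lam_T_nonempty by blast
  define d where "d = DIM('a)"
  have d: "d > 0" by (simp add: d_def)
  \<comment> \<open>\<open>m\<close> is the ratio between the region where a supertile centre may
    lie and the grid cube surely inside that supertile. It depends on neither \<open>e\<close> nor
    \<open>n\<close>, which makes the proportion \<open>c0\<close> uniform.\<close>
  define m where "m = nat \<lceil>4 * d * (c + norm p) / r\<rceil>"
  have m: "4 * d * (c + norm p) / r \<le> m" unfolding m_def by (rule real_nat_ceiling_ge)
  define c0 where "c0 = 1 / real (m + 1) ^ d"
  show thesis
  proof (rule that[of c0])
    show "c0 > 0" by (simp add: c0_def)
    fix e :: real assume e: "e > 0"
    \<comment> \<open>Rounding a position to the grid costs at most
      \<open>d * \<delta> = e / 3\<close>.\<close>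
    define \<delta> where "\<delta> = e / (3 * d)"
    have \<delta>: "\<delta> > 0" "d * \<delta> = e / 3" using e d by (simp_all add: \<delta>_def)
    obtain n1 where n1: "\<And>n. n \<ge> n1 \<Longrightarrow> (3 / e + support_bound) / r \<le> \<bar>\<theta>\<bar> ^ n"
      using ex_large_power by metis
    obtain n2 where n2: "\<And>n. n \<ge> n2 \<Longrightarrow> 2 * d * \<delta> / r \<le> \<bar>\<theta>\<bar> ^ n"
      using ex_large_power by metis
    define n where "n = max n1 n2"
    have large: "3 / e + support_bound \<le> \<bar>\<theta>\<bar> ^ n * r"
      using n1[of n] pr(1) by (simp add: n_def pos_divide_le_eq)
    have large2: "2 * d * \<delta> \<le> \<bar>\<theta>\<bar> ^ n * r"
      using n2[of n] pr(1) by (simp add: n_def pos_divide_le_eq)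
    \<comment> \<open>The factor \<open>2\<close> keeps the grid cube strictly inside the ball of
      radius \<open>\<bar>\<theta>\<bar> ^ n * r\<close>; together with \<open>K \<ge> 1\<close> it
      still fills a fixed share of it.\<close>
    define K where "K = nat \<lfloor>\<bar>\<theta>\<bar> ^ n * r / (2 * d * \<delta>)\<rfloor>"
    have pos: "2 * d * \<delta> > 0" using d \<delta> by simp
    have ge1: "1 \<le> \<bar>\<theta>\<bar> ^ n * r / (2 * d * \<delta>)" using large2 pos by (simp add: pos_le_divide_eq)
    then have "real K = of_int \<lfloor>\<bar>\<theta>\<bar> ^ n * r / (2 * d * \<delta>)\<rfloor>" unfolding K_def by simp
    then have K: "real K \<le> \<bar>\<theta>\<bar> ^ n * r / (2 * d * \<delta>)" "\<bar>\<theta>\<bar> ^ n * r / (2 * d * \<delta>) < real K + 1"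
      by linarith+
    have K1: "1 \<le> real K"
    proof -
      have "1 \<le> \<lfloor>\<bar>\<theta>\<bar> ^ n * r / (2 * d * \<delta>)\<rfloor>" using ge1 by simp
      then show ?thesis using \<open>real K = of_int _\<close> by linarith
    qed
    have Kr: "d * (\<delta> * K) < \<bar>\<theta>\<bar> ^ n * r"
    proof -
      have "2 * (d * (\<delta> * K)) \<le> \<bar>\<theta>\<bar> ^ n * r"
        using K(1) pos by (simp add: pos_le_divide_eq algebra_simps)
      moreover have "0 < d * (\<delta> * K)" using d \<delta> K1 by simp
      ultimately show ?thesis by linarith
    qed
    have Km: "\<bar>\<theta>\<bar> ^ n * (c + norm p) \<le> \<delta> * real (m * K)"
    proof -
      have "\<bar>\<theta>\<bar> ^ n * r / (2 * d * \<delta>) \<le> 2 * K" using K(2) K1 by linarith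
      then have "\<bar>\<theta>\<bar> ^ n * r \<le> 4 * d * \<delta> * K" using pos by (simp add: pos_divide_le_eq algebra_simps)
      then have "\<bar>\<theta>\<bar> ^ n \<le> 4 * d * \<delta> * K / r" using pr(1) by (simp add: pos_le_divide_eq)
      then have "\<bar>\<theta>\<bar> ^ n * (c + norm p) \<le> 4 * d * \<delta> * K / r * (c + norm p)"
        using c(1) by (intro mult_right_mono) auto
      also have "\<dots> = (\<delta> * K) * (4 * d * (c + norm p) / r)" by simp
      also have "\<dots> \<le> (\<delta> * K) * m" using m \<delta>(1) by (intro mult_left_mono) auto
      finally show ?thesis by (simp add: algebra_simps)
    qed
    \<comment> \<open>\<Gamma> lies around the centre of a supertile of type \<open>i\<close> at the
      origin, \<open>R\<close> is a translate of \<open>T\<close> having that supertile, and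
      \<open>G\<close> is large enough to contain a shifted copy of \<Gamma> for every
      \<open>S\<close>.\<close>
    define G :: "'a set" where "G = grid \<delta> (m * K + K)"
    define \<Gamma> where "\<Gamma> = (\<lambda>g. \<theta> ^ n *\<^sub>R p + g) ` (grid \<delta> K :: 'a set)"
    define R where "R = shift_tiles (- (\<theta> ^ n *\<^sub>R z0)) T"
    have cardG: "card G = (2 * (m * K + K) + 1) ^ d" by (simp add: G_def card_grid[OF \<delta>(1)] d_def)
    have card\<Gamma>: "card \<Gamma> = (2 * K + 1) ^ d"
      unfolding \<Gamma>_def by (subst card_image) (auto simp: card_grid[OF \<delta>(1)] d_def inj_on_def)
    have "finite G" "finite \<Gamma>" by (simp_all add: G_def \<Gamma>_def)
    moreover have "G \<noteq> {}" using cardG by (metis card.empty power_eq_0_iff add_is_0 one_neq_zero)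
    moreover have "c0 * card G \<le> card \<Gamma>"
    proof -
      have "card G \<le> ((m + 1) * (2 * K + 1)) ^ d"
        unfolding cardG by (intro power_mono) (auto simp: algebra_simps)
      then have "real (card G) \<le> real (m + 1) ^ d * real (card \<Gamma>)"
        unfolding card\<Gamma> power_mult_distrib by (metis of_nat_le_iff of_nat_mult of_nat_power)
      then show ?thesis by (simp add: c0_def pos_divide_le_eq mult.commute)
    qed
    moreover have "\<forall>v. shift_tiles v R \<in> tiling_space T"
      by (simp add: R_def orbit_in_tiling_space tiling_T)
    moreover have "\<exists>t. \<forall>\<gamma>\<in>\<Gamma>. t + \<gamma> \<in> G \<and> tdist (shift_tiles (- (t + \<gamma>)) S) (shift_tiles (- \<gamma>) R) \<le> e"
      if S: "S \<in> tiling_space T" for S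
    proof -
      define b where "b = Max (norm ` G)"
      have b: "norm x \<le> b" if "x \<in> G" for x
        using \<open>finite G\<close> that unfolding b_def by (auto intro!: Max_ge)
      have "e / 3 > 0" using e by simp
      from orbit_approximation[OF S this, of b] obtain y where
        y: "\<And>v. norm v \<le> b \<Longrightarrow> tdist (shift_tiles v S) (shift_tiles (v - y) T) \<le> e / 3" by metis
      define y' where "y' = (1 / \<theta> ^ n) *\<^sub>R y"
      have y': "\<theta> ^ n *\<^sub>R y' = y" by (simp add: y'_def)
      obtain w where w: "norm (w - y') \<le> c" "(w, i) \<in> Lam T" using c(2) by blast
      define q where "q = w - y'"
      have "norm (\<theta> ^ n *\<^sub>R (q + p)) \<le> \<bar>\<theta>\<bar> ^ n * (c + norm p)"
        using w(1) norm_triangle_ineq[of q p] by (simp add: q_def power_abs mult_left_mono)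
      also have "\<dots> \<le> \<delta> * real (m * K)" by (rule Km)
      finally obtain g where g: "g \<in> grid \<delta> (m * K)" "norm (g - \<theta> ^ n *\<^sub>R (q + p)) \<le> real DIM('a) * \<delta>"
        by (rule grid_approx[OF \<delta>(1)])
      \<comment> \<open>The displacement from the supertile at the origin to the one found in
        \<open>S\<close>, with its centre rounded to \<open>g\<close> so that all
        \<open>t + \<gamma>\<close> are grid points.\<close>
      define t where "t = g - \<theta> ^ n *\<^sub>R p"
      have "t + \<gamma> \<in> G \<and> tdist (shift_tiles (- (t + \<gamma>)) S) (shift_tiles (- \<gamma>) R) \<le> e" if "\<gamma> \<in> \<Gamma>" for \<gamma>
      proof -
        obtain h where h: "h \<in> grid \<delta> K" "\<gamma> = \<theta> ^ n *\<^sub>R p + h" using \<open>\<gamma> \<in> \<Gamma>\<close> by (auto simp: \<Gamma>_def)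
        have t\<gamma>: "t + \<gamma> = g + h" by (simp add: t_def h(2))
        then have mem: "t + \<gamma> \<in> G" using grid_add[OF g(1) h(1)] by (simp add: G_def)
        define v where "v = (1 / \<theta> ^ n) *\<^sub>R \<gamma>"
        have v: "\<theta> ^ n *\<^sub>R v = \<gamma>" by (simp add: v_def)
        have vp: "norm (v - p) < r"
        proof -
          have "\<bar>\<theta>\<bar> ^ n * norm (v - p) = norm (\<theta> ^ n *\<^sub>R (v - p))" by (simp add: power_abs)
          also have "\<dots> = norm h" unfolding scaleR_diff_right v h(2) by simp
          also have "\<dots> < \<bar>\<theta>\<bar> ^ n * r" using norm_grid[OF \<delta>(1) h(1)] Kr by (simp add: d_def)
          finally show ?thesis using abs_theta by (simp add: mult_less_cancel_left_pos)
        qed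
        have "tdist ((omega ^^ n) (shift_tiles (- (q + v) - y') T)) ((omega ^^ n) (shift_tiles (- v - z0) T)) \<le> e / 3"
        proof (rule tdist_omega_iterate_le[where x = "- v" and i = i and r = r])
          show "z - (- v) \<in> A i" if "norm z < r" for z
          proof (rule pr(2))
            have eq: "z - (- v) - p = z + (v - p)" by simp
            show "norm (z - (- v) - p) < 2 * r"
              unfolding eq using norm_triangle_ineq[of z "v - p"] that vp by linarith
          qed
        qed (use w z0 large e in \<open>auto simp: tiling_T q_def algebra_simps\<close>)
        then have 1: "tdist (shift_tiles (- (\<theta> ^ n *\<^sub>R q + \<gamma>) - y) T) (shift_tiles (- \<gamma>) R) \<le> e / 3"
          by (simp add: omega_iterate_shift_T scaleR_diff_right scaleR_add_right y' v R_def)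
        have 2: "tdist (shift_tiles (- (t + \<gamma>)) S) (shift_tiles (- (t + \<gamma>) - y) T) \<le> e / 3"
          using b[OF mem] by (intro y) (simp only: norm_minus_cancel)
        let ?u = "(t + \<gamma>) - (\<theta> ^ n *\<^sub>R q + \<gamma>)"
        have "?u = g - \<theta> ^ n *\<^sub>R (q + p)" by (simp add: t_def algebra_simps)
        then have nu: "norm ?u \<le> e / 3" using g(2) \<delta>(2) by (simp add: d_def)
        have "tdist (shift_tiles (- (t + \<gamma>) - y) T) (shift_tiles ?u (shift_tiles (- (t + \<gamma>) - y) T)) \<le> norm ?u"
          by (rule tdist_shift_le)
        moreover have "shift_tiles ?u (shift_tiles (- (t + \<gamma>) - y) T) = shift_tiles (- (\<theta> ^ n *\<^sub>R q + \<gamma>) - y) T"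
          by (simp add: algebra_simps)
        ultimately have 3: "tdist (shift_tiles (- (t + \<gamma>) - y) T) (shift_tiles (- (\<theta> ^ n *\<^sub>R q + \<gamma>) - y) T) \<le> e / 3"
          using nu by (metis order_trans)
        have "tdist (shift_tiles (- (t + \<gamma>)) S) (shift_tiles (- \<gamma>) R) \<le> e"
          using 1 2 3 tdist_triangle[of "shift_tiles (- (t + \<gamma>)) S" "shift_tiles (- \<gamma>) R" "shift_tiles (- (t + \<gamma>) - y) T"]
            tdist_triangle[of "shift_tiles (- (t + \<gamma>) - y) T" "shift_tiles (- \<gamma>) R" "shift_tiles (- (\<theta> ^ n *\<^sub>R q + \<gamma>) - y) T"]
          by linarith
        then show ?thesis using mem by blast
      qed
      then show ?thesis by blast
    qed
    ultimately show "\<exists>(G :: 'a set) (\<Gamma> :: 'a set) R. finite G \<and> G \<noteq> {} \<and> finite \<Gamma> \<and> c0 * card G \<le> card \<Gamma> \<and>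
      (\<forall>v. shift_tiles v R \<in> tiling_space T) \<and>
      (\<forall>S\<in>tiling_space T. \<exists>t. \<forall>\<gamma>\<in>\<Gamma>. t + \<gamma> \<in> G \<and> tdist (shift_tiles (- (t + \<gamma>)) S) (shift_tiles (- \<gamma>) R) \<le> e)"
      by blast
  qed
qed

end

section \<open>Ergodicity and eigenvalues\<close>

lemma exp_eq_cis: "exp (2 * pi * \<i> * of_real t) = cis (2 * pi * t)"
  by (simp add: cis_conv_exp mult_ac)

text \<open>Markov's inequality for counting measure.\<close>

lemma card_large_deviations:
  fixes h :: "'b \<Rightarrow> real" and c :: real
  assumes "finite G" "e > 0" "\<And>y. y \<in> G \<Longrightarrow> 0 \<le> h y" "sum h G < e * c"
  shows "card {y \<in> G. h y > e} < c"
proof -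
  have "e * card {y \<in> G. h y > e} = (\<Sum>y\<in>{y \<in> G. h y > e}. e)" by simp
  also have "\<dots> \<le> (\<Sum>y\<in>{y \<in> G. h y > e}. h y)" by (intro sum_mono) auto
  also have "\<dots> \<le> sum h G" using assms by (intro sum_mono2) auto
  finally have "e * card {y \<in> G. h y > e} < e * c" using assms(4) by linarith
  then show ?thesis using assms(2) by (simp add: mult_less_cancel_left_pos)
qed

locale scaling_system = scaling_tiling A \<theta> D T + tiling_system A T \<mu>
  for A :: "'k::finite \<Rightarrow> 'a::euclidean_space set" and \<theta> D T \<mu>
begin

text \<open>For a typical tiling \<open>h\<close> is near \<open>g\<close> at all but few shifts
  from \<open>G\<close>. The common pattern occupies a proportion \<open>c0\<close> of
  \<open>G\<close>, so for two such tilings some \<open>\<gamma>\<close> is good for both; then both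
  values of \<open>h\<close> are near \<open>g\<close> at the same translate of
  \<open>R\<close>.\<close>

lemma invariant_AE_const:
  fixes h :: "('a, 'k) tile set \<Rightarrow> complex"
  assumes h: "integrable \<mu> h" and inv: "\<And>v. AE S in \<mu>. h (shift_tiles v S) = h S"
  shows "\<exists>c. AE S in \<mu>. h S = c"
proof (rule AE_constI)
  show "h \<in> borel_measurable \<mu>" using h by simp
  fix e :: real assume e: "e > 0"
  obtain c0 :: real where c0: "c0 > 0" and pattern: "\<And>e. e > 0 \<Longrightarrow> \<exists>(G :: 'a set) (\<Gamma> :: 'a set) R.
      finite G \<and> G \<noteq> {} \<and> finite \<Gamma> \<and> c0 * card G \<le> card \<Gamma> \<and>
      (\<forall>v. shift_tiles v R \<in> tiling_space T) \<and>
      (\<forall>S\<in>tiling_space T. \<exists>t. \<forall>\<gamma>\<in>\<Gamma>. t + \<gamma> \<in> G \<and> tdist (shift_tiles (- (t + \<gamma>)) S) (shift_tiles (- \<gamma>) R) \<le> e)"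
    using common_pattern by blast
  define e1 where "e1 = e / 4"
  have e1: "e1 > 0" using e by (simp add: e1_def)
  \<comment> \<open>Fewer than half of \<open>c0 * card G\<close> shifts may be off by more than
    \<open>e1\<close>. The bound \<open>e\<close> yields the final measure estimate, the bound
    \<open>1 / 2\<close> the existence of the reference tiling \<open>S0\<close>.\<close>
  define e2 where "e2 = c0 / 2 * e1 * min e (1 / 2)"
  have e2: "e2 > 0" using c0 e1 e by (simp add: e2_def)
  obtain g where g: "integrable \<mu> g" "unif_cont (tiling_space T) tdist g" "(\<integral>S. cmod (h S - g S) \<partial>\<mu>) < e2"
    using approx_unif_cont[OF h e2] by blast
  obtain d where d: "d > 0" "\<And>S S'. S \<in> tiling_space T \<Longrightarrow> S' \<in> tiling_space T \<Longrightarrow> tdist S S' < d \<Longrightarrow> cmod (g S - g S') \<le> e1"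
    using g(2) e1 unfolding unif_cont_def by metis
  have "d / 2 > 0" using d(1) by simp
  from pattern[OF this] obtain G \<Gamma> :: "'a set" and R where G: "finite G" "G \<noteq> {}" "finite \<Gamma>" "c0 * card G \<le> card \<Gamma>"
    and R: "\<And>v. shift_tiles v R \<in> tiling_space T"
    and close: "\<And>S. S \<in> tiling_space T \<Longrightarrow>
      \<exists>t. \<forall>\<gamma>\<in>\<Gamma>. t + \<gamma> \<in> G \<and> tdist (shift_tiles (- (t + \<gamma>)) S) (shift_tiles (- \<gamma>) R) \<le> d / 2"
    by metis
  define t where "t = e1 * (c0 / 2 * card G)"
  have cardG: "real (card G) > 0" using G by (simp add: card_gt_0_iff)
  have t: "t > 0" using e1 c0 cardG by (simp add: t_def)
  define \<Phi> where "\<Phi> S = (\<Sum>y\<in>G. cmod (h (shift_tiles (- y) S) - g (shift_tiles (- y) S)))" for S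
  have inv_G: "AE S in \<mu>. \<forall>y\<in>G. h (shift_tiles (- y) S) = h S"
    using inv G(1) by (intro AE_finite_allI) auto
  have int_hg: "integrable \<mu> (\<lambda>S. cmod (h (shift_tiles v S) - g (shift_tiles v S)))" for v
    using integrable_shift[of "\<lambda>S. cmod (h S - g S)" v] h g(1) by simp
  have int\<Phi>: "integrable \<mu> \<Phi>" unfolding \<Phi>_def by (intro Bochner_Integration.integrable_sum int_hg)
  have \<Phi>0: "\<Phi> S \<ge> 0" for S unfolding \<Phi>_def by (intro sum_nonneg) auto
  have "(\<integral>S. \<Phi> S \<partial>\<mu>) = (\<Sum>y\<in>G. \<integral>S. cmod (h (shift_tiles (- y) S) - g (shift_tiles (- y) S)) \<partial>\<mu>)"
    unfolding \<Phi>_def by (intro Bochner_Integration.integral_sum int_hg)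
  also have "\<dots> = (\<Sum>y\<in>G. \<integral>S. cmod (h S - g S) \<partial>\<mu>)"
    using h g(1) by (intro sum.cong refl integral_shift) auto
  also have "\<dots> < card G * e2" using g(3) cardG by simp
  also have "\<dots> = t * min e (1 / 2)" by (simp add: t_def e2_def)
  finally have \<Phi>_less: "(\<integral>S. \<Phi> S \<partial>\<mu>) < t * min e (1 / 2)" .
  have osc: "cmod (h S - h S') \<le> e"
    if S: "S \<in> tiling_space T" "\<forall>y\<in>G. h (shift_tiles (- y) S) = h S" "\<Phi> S < t"
      and S': "S' \<in> tiling_space T" "\<forall>y\<in>G. h (shift_tiles (- y) S') = h S'" "\<Phi> S' < t" for S S'
  proof -
    define bad where "bad S = {y \<in> G. cmod (h (shift_tiles (- y) S) - g (shift_tiles (- y) S)) > e1}" for S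
    have card_bad: "card (bad S) < c0 / 2 * card G" if "\<Phi> S < t" for S
      using that G(1) e1 unfolding bad_def
      by (intro card_large_deviations) (auto simp: \<Phi>_def t_def)
    obtain s where s: "\<And>\<gamma>. \<gamma> \<in> \<Gamma> \<Longrightarrow> s + \<gamma> \<in> G"
      "\<And>\<gamma>. \<gamma> \<in> \<Gamma> \<Longrightarrow> tdist (shift_tiles (- (s + \<gamma>)) S) (shift_tiles (- \<gamma>) R) \<le> d / 2"
      using close[OF S(1)] by blast
    obtain s' where s': "\<And>\<gamma>. \<gamma> \<in> \<Gamma> \<Longrightarrow> s' + \<gamma> \<in> G"
      "\<And>\<gamma>. \<gamma> \<in> \<Gamma> \<Longrightarrow> tdist (shift_tiles (- (s' + \<gamma>)) S') (shift_tiles (- \<gamma>) R) \<le> d / 2"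
      using close[OF S'(1)] by blast
    define B where "B = {\<gamma> \<in> \<Gamma>. s + \<gamma> \<in> bad S} \<union> {\<gamma> \<in> \<Gamma>. s' + \<gamma> \<in> bad S'}"
    have fin_bad: "finite (bad S)" for S using G(1) by (simp add: bad_def)
    have "card {\<gamma> \<in> \<Gamma>. s + \<gamma> \<in> bad S} \<le> card (bad S)"
      by (rule card_inj_on_le[where f = "(+) s"]) (auto simp: fin_bad)
    moreover have "card {\<gamma> \<in> \<Gamma>. s' + \<gamma> \<in> bad S'} \<le> card (bad S')"
      by (rule card_inj_on_le[where f = "(+) s'"]) (auto simp: fin_bad)
    moreover have "card B \<le> card {\<gamma> \<in> \<Gamma>. s + \<gamma> \<in> bad S} + card {\<gamma> \<in> \<Gamma>. s' + \<gamma> \<in> bad S'}"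
      unfolding B_def by (rule card_Un_le)
    \<comment> \<open>Each tiling spoils less than half of the guaranteed size of \<Gamma>.\<close>
    ultimately have "card B < card \<Gamma>"
      using card_bad[OF S(3)] card_bad[OF S'(3)] G(4) by linarith
    moreover have "finite B" using G(3) by (simp add: B_def)
    ultimately have "\<not> \<Gamma> \<subseteq> B" using card_mono[of B \<Gamma>] by linarith
    then obtain \<gamma> where \<gamma>: "\<gamma> \<in> \<Gamma>" "\<gamma> \<notin> B" by blast
    have near: "cmod (h U - g (shift_tiles (- \<gamma>) R)) \<le> 2 * e1"
      if U: "U \<in> tiling_space T" "\<forall>y\<in>G. h (shift_tiles (- y) U) = h U" "s + \<gamma> \<in> G" "s + \<gamma> \<notin> bad U"
        "tdist (shift_tiles (- (s + \<gamma>)) U) (shift_tiles (- \<gamma>) R) \<le> d / 2" for U s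
    proof -
      have "cmod (h U - g (shift_tiles (- (s + \<gamma>)) U)) \<le> e1"
        using U(2-4) by (auto simp: bad_def)
      moreover have "cmod (g (shift_tiles (- (s + \<gamma>)) U) - g (shift_tiles (- \<gamma>) R)) \<le> e1"
        using U(5) d(1) by (intro d(2) shift_in_X U(1) R) linarith
      ultimately show ?thesis
        using norm_triangle_ineq[of "h U - g (shift_tiles (- (s + \<gamma>)) U)"
            "g (shift_tiles (- (s + \<gamma>)) U) - g (shift_tiles (- \<gamma>) R)"] by simp
    qed
    have "cmod (h S - g (shift_tiles (- \<gamma>) R)) \<le> 2 * e1"
      using \<gamma> by (intro near[of S s] S s) (auto simp: B_def)
    moreover have "cmod (h S' - g (shift_tiles (- \<gamma>) R)) \<le> 2 * e1"
      using \<gamma> by (intro near[of S' s'] S' s') (auto simp: B_def)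
    ultimately show ?thesis
      using norm_triangle_ineq4[of "h S - g (shift_tiles (- \<gamma>) R)" "h S' - g (shift_tiles (- \<gamma>) R)"]
      by (simp add: e1_def)
  qed
  have "t * min e (1 / 2) \<le> t * 1" using t by (intro mult_left_mono) auto
  then have "(\<integral>S. \<Phi> S \<partial>\<mu>) < t" using \<Phi>_less by simp
  from ex_less_if_integral_less[OF inv_G int\<Phi> this] obtain S0 where
    S0: "S0 \<in> tiling_space T" "\<forall>y\<in>G. h (shift_tiles (- y) S0) = h S0" "\<Phi> S0 < t" by blast
  have "AE S in \<mu>. S \<in> {S \<in> space \<mu>. cmod (h S - h S0) > e} \<longrightarrow> S \<in> {S \<in> space \<mu>. t \<le> \<Phi> S}"
    using inv_G
  proof eventually_elim
    case (elim S)
    then show ?case using osc[OF _ _ _ S0, of S] by (force simp: space_\<mu> not_le)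
  qed
  then have "measure \<mu> {S \<in> space \<mu>. cmod (h S - h S0) > e} \<le> measure \<mu> {S \<in> space \<mu>. t \<le> \<Phi> S}"
    using borel_measurable_integrable[OF int\<Phi>] by (intro finite_measure_mono_AE) measurable
  also have "\<dots> \<le> (\<integral>S. \<Phi> S \<partial>\<mu>) / t"
    by (rule integral_Markov_inequality_measure[OF int\<Phi> sets.top]) (use \<Phi>0 t in auto)
  also have "\<dots> \<le> e"
  proof -
    have "t * min e (1 / 2) \<le> t * e" using t by (intro mult_left_mono) auto
    then have "(\<integral>S. \<Phi> S \<partial>\<mu>) \<le> e * t" using \<Phi>_less by (simp only: mult.commute[of e])
    then show ?thesis using t by (simp add: pos_divide_le_eq)
  qed
  finally show "\<exists>c. measure \<mu> {S \<in> space \<mu>. cmod (h S - c) > e} \<le> e" by blast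
qed

section \<open>Eigenfunctions and the phases of inflated recurrent vectors\<close>

lemma eigenfunction_integrable:
  assumes "eigenfunction \<mu> \<alpha> f"
  shows "integrable \<mu> f"
proof (rule Bochner_Integration.integrable_bound)
  show "integrable \<mu> (\<lambda>S. 1 + (cmod (f S))\<^sup>2)" using assms by (simp add: eigenfunction_def)
  show "f \<in> borel_measurable \<mu>" using assms by (simp add: eigenfunction_def)
  have "x \<le> 1 + x\<^sup>2" for x :: real
    using zero_le_power2[of "x - 1 / 2"] by (simp add: power2_eq_square algebra_simps)
  then show "AE S in \<mu>. norm (f S) \<le> norm (1 + (cmod (f S))\<^sup>2)" by simp
qed

lemma eigenfunction_shift:
  assumes "eigenfunction \<mu> \<alpha> f"
  shows "AE S in \<mu>. f (shift_tiles (- x) S) = cis (2 * pi * (x \<bullet> \<alpha>)) * f S"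
  using assms unfolding eigenfunction_def exp_eq_cis by blast

lemma eigenfunction_norm_const:
  assumes "eigenfunction \<mu> \<alpha> f"
  obtains c where "c > 0" "AE S in \<mu>. cmod (f S) = c"
proof -
  have "integrable \<mu> (\<lambda>S. complex_of_real (cmod (f S)))"
    using eigenfunction_integrable[OF assms] by simp
  moreover have "AE S in \<mu>. complex_of_real (cmod (f (shift_tiles v S))) = complex_of_real (cmod (f S))" for v
    using eigenfunction_shift[OF assms, of "- v"] by eventually_elim (simp add: norm_mult)
  ultimately obtain c where c: "AE S in \<mu>. complex_of_real (cmod (f S)) = c"
    using invariant_AE_const by blast
  then have c': "AE S in \<mu>. cmod (f S) = Re c" by eventually_elim auto
  have "Re c > 0"
  proof (rule ccontr)
    assume "\<not> Re c > 0"
    then have "AE S in \<mu>. f S = 0"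
      using c' by (auto elim!: eventually_mono) (metis norm_le_zero_iff not_less)
    then show False using assms by (simp add: eigenfunction_def)
  qed
  then show thesis using c' that by blast
qed

text \<open>The translates \<open>S1\<close> and \<open>S2\<close> nearly coincide, so
  \<open>f\<close> should take nearly equal values there, while the eigenvalue equation says that
  the values differ by the phase factor. The choices are made in the order \<open>F\<close>,
  \<open>g\<close>, \<open>d\<close>, \<open>n\<close>.\<close>

lemma eigenvalue_circle_dist:
  assumes "eigenvalue \<mu> \<alpha>" "recurrent \<xi>"
  shows "(\<lambda>n. circle_dist ((\<xi> \<bullet> \<alpha>) * \<theta> ^ n)) \<longlonglongrightarrow> 0"
proof (rule LIMSEQ_I)
  fix e0 :: real assume e0: "e0 > 0"
  obtain f where f: "eigenfunction \<mu> \<alpha> f" using assms(1) unfolding eigenvalue_def by blast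
  obtain c where c: "c > 0" "AE S in \<mu>. cmod (f S) = c" using eigenfunction_norm_const[OF f] .
  \<comment> \<open>Three errors of size \<open>e\<close>, divided by the constant modulus
    \<open>c\<close> of \<open>f\<close>, add up to less than \<open>e0\<close>.\<close>
  define e where "e = c * e0 / 4"
  have e: "e > 0" using c e0 by (simp add: e_def)
  obtain F where F: "finite F" and close: "\<And>e. e > 0 \<Longrightarrow> \<exists>n0. \<forall>n\<ge>n0. \<forall>S\<in>tiling_space T. \<exists>x\<in>F.
    tdist (shift_tiles (- (\<theta> ^ n *\<^sub>R x)) S) (shift_tiles (- (\<theta> ^ n *\<^sub>R (x + \<xi>))) S) \<le> e"
    using recurrent_close[OF assms(2)] by blast
  \<comment> \<open>At most \<open>2 * card F\<close> translates are evaluated; the summand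
    \<open>1\<close> keeps the total strictly below \<open>e\<close>.\<close>
  define e2 where "e2 = e / (2 * card F + 1)"
  have e2: "e2 > 0" using e by (simp add: e2_def)
  obtain g where g: "integrable \<mu> g" "unif_cont (tiling_space T) tdist g" "(\<integral>S. cmod (f S - g S) \<partial>\<mu>) < e2"
    using approx_unif_cont[OF eigenfunction_integrable[OF f] e2] by blast
  obtain d where d: "d > 0" "\<And>S S'. S \<in> tiling_space T \<Longrightarrow> S' \<in> tiling_space T \<Longrightarrow> tdist S S' < d \<Longrightarrow> cmod (g S - g S') \<le> e"
    using g(2) e unfolding unif_cont_def by metis
  have "d / 2 > 0" using d(1) by simp
  from close[OF this] obtain n0 where n0: "\<And>n S. n \<ge> n0 \<Longrightarrow> S \<in> tiling_space T \<Longrightarrow> \<exists>x\<in>F.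
    tdist (shift_tiles (- (\<theta> ^ n *\<^sub>R x)) S) (shift_tiles (- (\<theta> ^ n *\<^sub>R (x + \<xi>))) S) \<le> d / 2" by blast
  have "circle_dist ((\<xi> \<bullet> \<alpha>) * \<theta> ^ n) < e0" if n: "n \<ge> n0" for n
  proof -
    define V where "V = (\<lambda>x. \<theta> ^ n *\<^sub>R x) ` F \<union> (\<lambda>x. \<theta> ^ n *\<^sub>R (x + \<xi>)) ` F"
    have V: "finite V" "card V \<le> 2 * card F"
    proof -
      show "finite V" using F by (simp add: V_def)
      have "card V \<le> card ((\<lambda>x. \<theta> ^ n *\<^sub>R x) ` F) + card ((\<lambda>x. \<theta> ^ n *\<^sub>R (x + \<xi>)) ` F)"
        unfolding V_def by (rule card_Un_le)
      also have "\<dots> \<le> card F + card F" using F by (intro add_mono card_image_le)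
      finally show "card V \<le> 2 * card F" by simp
    qed
    define \<Phi> where "\<Phi> S = (\<Sum>y\<in>V. cmod (f (shift_tiles (- y) S) - g (shift_tiles (- y) S)))" for S
    have int_fg: "integrable \<mu> (\<lambda>S. cmod (f (shift_tiles v S) - g (shift_tiles v S)))" for v
      using integrable_shift[of "\<lambda>S. cmod (f S - g S)" v] eigenfunction_integrable[OF f] g(1) by simp
    have int\<Phi>: "integrable \<mu> \<Phi>" unfolding \<Phi>_def by (intro Bochner_Integration.integrable_sum int_fg)
    have "(\<integral>S. \<Phi> S \<partial>\<mu>) = (\<Sum>y\<in>V. \<integral>S. cmod (f (shift_tiles (- y) S) - g (shift_tiles (- y) S)) \<partial>\<mu>)"
      unfolding \<Phi>_def by (intro Bochner_Integration.integral_sum int_fg)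
    also have "\<dots> = (\<Sum>y\<in>V. \<integral>S. cmod (f S - g S) \<partial>\<mu>)"
      using eigenfunction_integrable[OF f] g(1) by (intro sum.cong refl integral_shift) auto
    also have "\<dots> \<le> (2 * card F) * e2"
      using g(3) V(2) by (simp, intro mult_mono) (auto simp flip: of_nat_mult)
    also have "\<dots> < e" using e unfolding e2_def by (simp add: field_simps)
    finally have less: "(\<integral>S. \<Phi> S \<partial>\<mu>) < e" .
    have "AE S in \<mu>. \<forall>x\<in>F. cmod (f (shift_tiles (- (\<theta> ^ n *\<^sub>R x)) S)) = c"
      using AE_shift[OF c(2)] F by (intro AE_finite_allI) auto
    moreover have shift: "AE S in \<mu>. f (shift_tiles (- (\<theta> ^ n *\<^sub>R \<xi>)) (shift_tiles v S))
        = cis (2 * pi * ((\<theta> ^ n *\<^sub>R \<xi>) \<bullet> \<alpha>)) * f (shift_tiles v S)" for v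
      using AE_shift[OF eigenfunction_shift[OF f, of "\<theta> ^ n *\<^sub>R \<xi>"], of v] .
    have "AE S in \<mu>. \<forall>x\<in>F. f (shift_tiles (- (\<theta> ^ n *\<^sub>R \<xi>)) (shift_tiles (- (\<theta> ^ n *\<^sub>R x)) S))
        = cis (2 * pi * ((\<theta> ^ n *\<^sub>R \<xi>) \<bullet> \<alpha>)) * f (shift_tiles (- (\<theta> ^ n *\<^sub>R x)) S)"
      by (intro AE_finite_allI F shift)
    ultimately have "AE S in \<mu>. (\<forall>x\<in>F. cmod (f (shift_tiles (- (\<theta> ^ n *\<^sub>R x)) S)) = c) \<and>
      (\<forall>x\<in>F. f (shift_tiles (- (\<theta> ^ n *\<^sub>R \<xi>)) (shift_tiles (- (\<theta> ^ n *\<^sub>R x)) S))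
        = cis (2 * pi * ((\<theta> ^ n *\<^sub>R \<xi>) \<bullet> \<alpha>)) * f (shift_tiles (- (\<theta> ^ n *\<^sub>R x)) S))"
      by eventually_elim blast
    from ex_less_if_integral_less[OF this int\<Phi> less] obtain S where S: "S \<in> tiling_space T"
      "\<And>x. x \<in> F \<Longrightarrow> cmod (f (shift_tiles (- (\<theta> ^ n *\<^sub>R x)) S)) = c"
      "\<And>x. x \<in> F \<Longrightarrow> f (shift_tiles (- (\<theta> ^ n *\<^sub>R \<xi>)) (shift_tiles (- (\<theta> ^ n *\<^sub>R x)) S))
        = cis (2 * pi * ((\<theta> ^ n *\<^sub>R \<xi>) \<bullet> \<alpha>)) * f (shift_tiles (- (\<theta> ^ n *\<^sub>R x)) S)"
      "\<Phi> S < e" by blast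
    obtain x where x: "x \<in> F"
      "tdist (shift_tiles (- (\<theta> ^ n *\<^sub>R x)) S) (shift_tiles (- (\<theta> ^ n *\<^sub>R (x + \<xi>))) S) \<le> d / 2"
      using n0[OF n S(1)] by blast
    define S1 where "S1 = shift_tiles (- (\<theta> ^ n *\<^sub>R x)) S"
    define S2 where "S2 = shift_tiles (- (\<theta> ^ n *\<^sub>R (x + \<xi>))) S"
    have term_le: "cmod (f (shift_tiles (- y) S) - g (shift_tiles (- y) S)) \<le> e" if "y \<in> V" for y
    proof -
      have "cmod (f (shift_tiles (- y) S) - g (shift_tiles (- y) S)) \<le> \<Phi> S"
        unfolding \<Phi>_def using that V(1) by (intro member_le_sum) auto
      then show ?thesis using S(4) by simp
    qed
    have "\<theta> ^ n *\<^sub>R x \<in> V" "\<theta> ^ n *\<^sub>R (x + \<xi>) \<in> V" using x(1) by (auto simp: V_def)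
    from term_le[OF this(1)] term_le[OF this(2)]
    have 1: "cmod (f S1 - g S1) \<le> e" "cmod (f S2 - g S2) \<le> e" by (simp_all add: S1_def S2_def)
    have 2: "cmod (g S1 - g S2) \<le> e"
      using x(2) d(1) unfolding S1_def S2_def by (intro d(2) shift_in_X S(1)) linarith
    have "f S1 - f S2 = (f S1 - g S1) + (g S1 - g S2) - (f S2 - g S2)" by simp
    then have "cmod (f S1 - f S2) \<le> 3 * e"
      using 1 2 norm_triangle_ineq4[of "(f S1 - g S1) + (g S1 - g S2)" "f S2 - g S2"]
        norm_triangle_ineq[of "f S1 - g S1" "g S1 - g S2"] by simp
    moreover have "shift_tiles (- (\<theta> ^ n *\<^sub>R \<xi>)) S1 = S2"
      by (simp add: S1_def S2_def algebra_simps)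
    then have "f S2 = cis (2 * pi * ((\<xi> \<bullet> \<alpha>) * \<theta> ^ n)) * f S1"
      using S(3)[OF x(1)] by (simp add: S1_def mult.commute)
    then have "f S2 - f S1 = (cis (2 * pi * ((\<xi> \<bullet> \<alpha>) * \<theta> ^ n)) - 1) * f S1" by (simp add: algebra_simps)
    then have "cmod (f S1 - f S2) = circle_dist ((\<xi> \<bullet> \<alpha>) * \<theta> ^ n) * c"
      using S(2)[OF x(1)] by (simp add: norm_minus_commute norm_mult circle_dist_def S1_def)
    ultimately have "circle_dist ((\<xi> \<bullet> \<alpha>) * \<theta> ^ n) * c \<le> 3 / 4 * e0 * c" by (simp add: e_def algebra_simps)
    then have "circle_dist ((\<xi> \<bullet> \<alpha>) * \<theta> ^ n) \<le> 3 / 4 * e0" using c(1) by simp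
    then show ?thesis using e0 by linarith
  qed
  then show "\<exists>n0. \<forall>n\<ge>n0. norm (circle_dist ((\<xi> \<bullet> \<alpha>) * \<theta> ^ n) - 0) < e0" by auto
qed

theorem pisot_if_not_weakly_mixing:
  assumes "eigenvalue \<mu> \<alpha>" "\<alpha> \<noteq> 0"
  shows "pisot \<bar>\<theta>\<bar>"
proof -
  obtain \<xi> where "recurrent \<xi>" "\<xi> \<bullet> \<alpha> \<noteq> 0" using recurrent_inner_nonzero[OF assms(2)] .
  then show ?thesis
    using pisot_if_circle_dist_tendsto_0[OF abs_theta algebraic_int_theta] eigenvalue_circle_dist[OF assms(1)]
    by blast
qed

end

section \<open>Uniformity over return vectors\<close>

context scaling_tiling
begin

text \<open>Repetitivity is applied to the patch consisting of the two tiles; the support of a tile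
  lies within \<open>support_bound\<close> of its position.\<close>

lemma recurrent_if_repetitive:
  assumes "repetitive T" and L: "(w, i) \<in> Lam T" "(w + \<xi>, i) \<in> Lam T"
  shows "recurrent \<xi>"
proof -
  define P where "P = {shift_tile w (prototile i), shift_tile (w + \<xi>) (prototile i)}"
  have PT: "P \<subseteq> T" using L by (auto simp: P_def Lam_def)
  have "patch P"
    unfolding patch_def
    using PT tiling_T unfolding tiling_def disjoint_interiors_def by (auto simp: P_def)
  then obtain M where M: "\<And>y. \<exists>g. shift_tiles g P \<subseteq> T \<and> (\<Union>t\<in>shift_tiles g P. fst t) \<subseteq> ball y M"
    using assms(1) PT unfolding repetitive_def by blast
  obtain a where a: "a \<in> A i" using nonempty by blast
  have "\<exists>w. norm (w - y) \<le> M + support_bound \<and> (w, i) \<in> Lam T \<and> (w + \<xi>, i) \<in> Lam T" for y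
  proof -
    obtain g where g: "shift_tiles g P \<subseteq> T" "(\<Union>t\<in>shift_tiles g P. fst t) \<subseteq> ball y M" using M by blast
    have mem: "shift_tile (g + w) (prototile i) \<in> shift_tiles g P"
      "shift_tile (g + (w + \<xi>)) (prototile i) \<in> shift_tiles g P"
      by (simp_all add: P_def shift_tiles_def)
    have "g + w + a \<in> fst (shift_tile (g + w) (prototile i))"
      using a by (simp add: shift_tile_prototile mem_translation_iff)
    then have "g + w + a \<in> ball y M" using g(2) mem(1) by blast
    then have "norm (g + w + a - y) < M" by (simp add: dist_norm norm_minus_commute)
    moreover have "norm (g + w - y) \<le> norm (g + w + a - y) + norm a"
      using norm_triangle_ineq4[of "g + w + a - y" a] by (simp add: algebra_simps)
    ultimately have "norm (g + w - y) \<le> M + support_bound" using support_bound(2)[OF a] by linarith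
    moreover have "(g + w, i) \<in> Lam T" "(g + w + \<xi>, i) \<in> Lam T"
      using mem g(1) by (auto simp: Lam_def add.assoc)
    ultimately show ?thesis by blast
  qed
  then show ?thesis unfolding recurrent_def by blast
qed

text \<open>
  With \<open>q = \<theta>\<^sup>l\<close> and a distinguished tile of type \<open>i0\<close> in each level \<open>l\<close> supertile, the control
  points \<open>x + c i\<close> are mapped by \<open>q\<close> to control points of type \<open>i0\<close>. Hence differences of control
  points become return vectors after multiplication by \<open>q\<close>, and the control point of every tile
  is a polynomial in \<open>q\<close> whose coefficients lie in a finite set of such differences.
\<close>
lemma control_points:
  obtains c :: "'k \<Rightarrow> 'a" and W :: "'a set" where
    "finite W"
    "\<And>w. w \<in> W \<Longrightarrow> \<exists>x i y j. (x, i) \<in> Lam T \<and> (y, j) \<in> Lam T \<and> w = (x + c i) - (y + c j)"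
    "\<And>x i y j. (x, i) \<in> Lam T \<Longrightarrow> (y, j) \<in> Lam T \<Longrightarrow>
      \<exists>k z. (z, k) \<in> Lam T \<and> (z + \<theta> ^ level *\<^sub>R ((x + c i) - (y + c j)), k) \<in> Lam T"
    "\<And>y i. (y, i) \<in> Lam T \<Longrightarrow> \<exists>x j. \<exists>u\<in>digits level i j. (x, j) \<in> Lam T \<and> y = \<theta> ^ level *\<^sub>R x + u \<and>
      (y + c i) - \<theta> ^ level *\<^sub>R (x + c j) \<in> W"
proof -
  define q where "q = \<theta> ^ level"
  have "\<bar>q\<bar> > 1" using abs_theta level(1) by (simp add: q_def power_abs)
  then have q: "q \<noteq> 0" "q - 1 \<noteq> 0" by auto
  define i0 :: 'k where "i0 = undefined"
  have "\<forall>j. \<exists>u. u \<in> digits level i0 j" using level(2) by blast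
  from choice[OF this] obtain e where e: "\<And>j. e j \<in> digits level i0 j" by blast
  \<comment> \<open>Inflating \<open>x + c j\<close> shall give the control point of the
    distinguished tile, so \<open>q\<close> times \<open>c j\<close> must equal
    \<open>e j + c i0\<close>. For \<open>j = i0\<close> this determines \<open>c i0\<close>, which
    is \<open>c0\<close>.\<close>
  define c0 where "c0 = (1 / (q - 1)) *\<^sub>R e i0"
  define c where "c j = (1 / q) *\<^sub>R (e j + c0)" for j
  have qc: "q *\<^sub>R c j = e j + c0" for j using q by (simp add: c_def)
  have "(q - 1) *\<^sub>R c0 = e i0" using q by (simp add: c0_def)
  then have "q *\<^sub>R c i0 = q *\<^sub>R c0" unfolding qc by (simp add: algebra_simps)
  then have c0: "c i0 = c0" using q by simp
  define W where "W = (\<Union>i. \<Union>j. (\<lambda>u. u + c i - q *\<^sub>R c j) ` digits level i j)"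
  show thesis
  proof (rule that[of W c])
    show "finite W" by (simp add: W_def)
    show "\<exists>x i y j. (x, i) \<in> Lam T \<and> (y, j) \<in> Lam T \<and> w = (x + c i) - (y + c j)" if w: "w \<in> W" for w
    proof -
      obtain i j u where u: "u \<in> digits level i j" "w = u + c i - q *\<^sub>R c j" using w by (auto simp: W_def)
      obtain x where x: "(x, j) \<in> Lam T" using Lam_T_nonempty by blast
      \<comment> \<open>A coefficient is the difference of the control points of two tiles of one
        supertile: the tile at digit \<open>u\<close> and the distinguished one.\<close>
      have "w = ((q *\<^sub>R x + u) + c i) - ((q *\<^sub>R x + e j) + c i0)"
        by (simp add: u(2) qc c0)
      then show ?thesis using Lam_T_digit[OF x u(1)] Lam_T_digit[OF x e] unfolding q_def by blast
    qed
    show "\<exists>k z. (z, k) \<in> Lam T \<and> (z + \<theta> ^ level *\<^sub>R ((x + c i) - (y + c j)), k) \<in> Lam T"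
      if L: "(x, i) \<in> Lam T" "(y, j) \<in> Lam T" for x i y j
    proof -
      have "q *\<^sub>R x + e i = (q *\<^sub>R y + e j) + q *\<^sub>R ((x + c i) - (y + c j))"
        by (simp add: scaleR_diff_right scaleR_add_right qc)
      then show ?thesis using Lam_T_digit[OF L(1) e] Lam_T_digit[OF L(2) e] unfolding q_def by metis
    qed
    show "\<exists>x j. \<exists>u\<in>digits level i j. (x, j) \<in> Lam T \<and> y = \<theta> ^ level *\<^sub>R x + u \<and>
      (y + c i) - \<theta> ^ level *\<^sub>R (x + c j) \<in> W" if y: "(y, i) \<in> Lam T" for y i
    proof -
      obtain x j u where u: "u \<in> digits level i j" "(x, j) \<in> Lam T" "y = \<theta> ^ level *\<^sub>R x + u"
        using y Lam_T_iff by metis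
      have eq: "(y + c i) - \<theta> ^ level *\<^sub>R (x + c j) = u + c i - q *\<^sub>R c j"
        by (simp add: u(3) q_def algebra_simps)
      have "(y + c i) - \<theta> ^ level *\<^sub>R (x + c j) \<in> W" unfolding eq W_def using u(1) by blast
      then show ?thesis using u by blast
    qed
  qed
qed

text \<open>Passing to parents \<open>N\<close> times gives a base \<open>q\<close> expansion. The
  bound on \<open>x\<close> solves the recursion
  \<open>norm x' \<le> (norm x + B) / \<bar>q\<bar>\<close>; once \<open>\<bar>q\<bar> ^ N\<close>
  exceeds \<open>norm y\<close>, the leading tile comes from a fixed finite set.\<close>

lemma control_expansion:
  fixes c :: "'k \<Rightarrow> 'a" and W :: "'a set" and q B :: real
  assumes step: "\<And>y i. (y, i) \<in> Lam T \<Longrightarrow> \<exists>x j u. (x, j) \<in> Lam T \<and> y = q *\<^sub>R x + u \<and> norm u \<le> B \<and>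
      (y + c i) - q *\<^sub>R (x + c j) \<in> W"
    and q: "\<bar>q\<bar> > 1" and y: "(y, i) \<in> Lam T"
  shows "\<exists>x j ws. (x, j) \<in> Lam T \<and> (\<forall>k<N. ws k \<in> W) \<and> norm x \<le> norm y / \<bar>q\<bar> ^ N + B / (\<bar>q\<bar> - 1) \<and>
    y + c i = q ^ N *\<^sub>R (x + c j) + (\<Sum>k<N. q ^ k *\<^sub>R ws k)"
proof (induction N)
  case 0
  obtain u :: 'a where "norm u \<le> B" using step[OF y] by blast
  then have "0 \<le> B" using norm_ge_zero order_trans by blast
  then have "0 \<le> B / (\<bar>q\<bar> - 1)" using q by simp
  then show ?case using y by (intro exI[of _ y] exI[of _ i]) simp
next
  case (Suc N)
  then obtain x j ws where x: "(x, j) \<in> Lam T" "\<And>k. k < N \<Longrightarrow> ws k \<in> W"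
    "norm x \<le> norm y / \<bar>q\<bar> ^ N + B / (\<bar>q\<bar> - 1)"
    "y + c i = q ^ N *\<^sub>R (x + c j) + (\<Sum>k<N. q ^ k *\<^sub>R ws k)" by blast
  obtain x' j' u where x': "(x', j') \<in> Lam T" "x = q *\<^sub>R x' + u" "norm u \<le> B"
    "(x + c j) - q *\<^sub>R (x' + c j') \<in> W" using step[OF x(1)] by blast
  define w where "w = (x + c j) - q *\<^sub>R (x' + c j')"
  have "\<bar>q\<bar> * norm x' = norm (x - u)" using x'(2) by simp
  also have "\<dots> \<le> norm x + B" using norm_triangle_ineq4[of x u] x'(3) by linarith
  also have "\<dots> \<le> norm y / \<bar>q\<bar> ^ N + B / (\<bar>q\<bar> - 1) + B" using x(3) by simp
  also have "\<dots> = \<bar>q\<bar> * (norm y / \<bar>q\<bar> ^ Suc N + B / (\<bar>q\<bar> - 1))" using q by (simp add: field_simps)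
  finally have "norm x' \<le> norm y / \<bar>q\<bar> ^ Suc N + B / (\<bar>q\<bar> - 1)" using q by (simp add: mult_le_cancel_left_pos)
  moreover have "y + c i = q ^ Suc N *\<^sub>R (x' + c j') + (\<Sum>k<Suc N. q ^ k *\<^sub>R (ws(N := w)) k)"
  proof -
    have "q ^ N *\<^sub>R (x + c j) = q ^ Suc N *\<^sub>R (x' + c j') + q ^ N *\<^sub>R w"
      by (simp add: w_def scaleR_diff_right mult.commute)
    moreover have "(\<Sum>k<N. q ^ k *\<^sub>R (ws(N := w)) k) = (\<Sum>k<N. q ^ k *\<^sub>R ws k)"
      by (intro sum.cong) auto
    ultimately show ?thesis using x(4) by simp
  qed
  moreover have "\<forall>k<Suc N. (ws(N := w)) k \<in> W" using x(2) x'(4) by (auto simp: w_def less_Suc_eq)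
  ultimately show ?case using x'(1) by blast
qed

text \<open>All coefficients of the expansions lie in the finite set \<open>Z\<close>, and each has
  summable phases. The phase of a return vector is bounded by a tail of one convergent series,
  whatever the length of its expansion.\<close>

lemma uniform_return_vectors:
  fixes \<alpha> :: 'a
  assumes ret: "\<And>w i \<xi>. (w, i) \<in> Lam T \<Longrightarrow> (w + \<xi>, i) \<in> Lam T \<Longrightarrow>
      summable (\<lambda>n. circle_dist ((\<xi> \<bullet> \<alpha>) * \<theta> ^ n))" and e: "e > 0"
  shows "\<exists>n. \<forall>x y i. (x, i) \<in> Lam T \<longrightarrow> (y, i) \<in> Lam T \<longrightarrow> circle_dist (((x - y) \<bullet> \<alpha>) * \<theta> ^ n) \<le> e"
proof -
  define l where "l = level"
  define q where "q = \<theta> ^ l"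
  have q: "\<bar>q\<bar> > 1" using abs_theta level(1) by (simp add: q_def l_def power_abs)
  obtain c W where cW0: "finite W"
    "\<And>w. w \<in> W \<Longrightarrow> \<exists>x i y j. (x, i) \<in> Lam T \<and> (y, j) \<in> Lam T \<and> w = (x + c i) - (y + c j)"
    "\<And>x i y j. (x, i) \<in> Lam T \<Longrightarrow> (y, j) \<in> Lam T \<Longrightarrow>
      \<exists>k z. (z, k) \<in> Lam T \<and> (z + \<theta> ^ level *\<^sub>R ((x + c i) - (y + c j)), k) \<in> Lam T"
    "\<And>y i. (y, i) \<in> Lam T \<Longrightarrow> \<exists>x j. \<exists>u\<in>digits level i j. (x, j) \<in> Lam T \<and> y = \<theta> ^ level *\<^sub>R x + u \<and>
      (y + c i) - \<theta> ^ level *\<^sub>R (x + c j) \<in> W"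
    by (rule control_points, rule that)
  note cW = cW0[folded l_def, folded q_def]
  have "bounded (\<Union>i. \<Union>j. digits l i j)" by (intro finite_imp_bounded) simp
  then obtain B where "\<forall>u\<in>(\<Union>i. \<Union>j. digits l i j). norm u \<le> B" unfolding bounded_iff by blast
  then have B: "norm u \<le> B" if "u \<in> digits l i j" for u i j using that by blast
  have step: "\<exists>x j u. (x, j) \<in> Lam T \<and> y = q *\<^sub>R x + u \<and> norm u \<le> B \<and> (y + c i) - q *\<^sub>R (x + c j) \<in> W"
    if "(y, i) \<in> Lam T" for y i
    using cW(4)[OF that] B by blast
  define b where "b = 1 + B / (\<bar>q\<bar> - 1)"
  define K where "K = {(x, i). (x, i) \<in> Lam T \<and> norm x \<le> b}"
  have finK: "finite K" unfolding K_def by (rule finite_Lam_bounded[OF tiling_T])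
  define Z where "Z = W \<union> (\<lambda>((x, i), (y, j)). (x + c i) - (y + c j)) ` (K \<times> K)"
  have finZ: "finite Z" using cW(1) finK by (simp add: Z_def)
  \<comment> \<open>After multiplication by \<open>q\<close> the vector is a return vector, and this
    only shifts the index of its series by \<open>l\<close>.\<close>
  have summ: "summable (\<lambda>n. circle_dist ((w \<bullet> \<alpha>) * \<theta> ^ n))" if w: "w \<in> Z" for w
  proof -
    have "\<exists>x i y j. (x, i) \<in> Lam T \<and> (y, j) \<in> Lam T \<and> w = (x + c i) - (y + c j)"
    proof (cases "w \<in> W")
      case False
      then obtain p p' where "p \<in> K" "p' \<in> K" "w = (fst p + c (snd p)) - (fst p' + c (snd p'))"
        using w by (auto simp: Z_def)
      then show ?thesis
        by (intro exI[of _ "fst p"] exI[of _ "snd p"] exI[of _ "fst p'"] exI[of _ "snd p'"]) (auto simp: K_def)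
    qed (rule cW(2))
    then obtain x i y j where x: "(x, i) \<in> Lam T" "(y, j) \<in> Lam T" "w = (x + c i) - (y + c j)"
      by blast
    obtain k z where "(z, k) \<in> Lam T" "(z + q *\<^sub>R w, k) \<in> Lam T" using cW(3)[OF x(1,2)] x(3) by blast
    from ret[OF this] have "summable (\<lambda>n. circle_dist ((w \<bullet> \<alpha>) * \<theta> ^ (n + l)))"
      by (simp add: q_def power_add mult_ac)
    then show ?thesis by (simp only: summable_iff_shift[of "\<lambda>n. circle_dist ((w \<bullet> \<alpha>) * \<theta> ^ n)" l])
  qed
  define s where "s n = (\<Sum>w\<in>Z. circle_dist ((w \<bullet> \<alpha>) * \<theta> ^ n))" for n
  have s0: "s n \<ge> 0" for n unfolding s_def by (intro sum_nonneg) simp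
  have s_le: "circle_dist ((w \<bullet> \<alpha>) * \<theta> ^ n) \<le> s n" if "w \<in> Z" for w n
    unfolding s_def using that finZ by (intro member_le_sum) auto
  have summ_s: "summable s" unfolding s_def by (intro summable_sum summ)
  have "e / 2 > 0" using e by simp
  from suminf_exist_split[OF this summ_s] obtain n where n: "norm (\<Sum>i. s (i + n)) < e / 2" by blast
  have "circle_dist (((x - y) \<bullet> \<alpha>) * \<theta> ^ n) \<le> e" if L: "(x, i) \<in> Lam T" "(y, i) \<in> Lam T" for x y i
  proof -
    obtain N where N: "max (norm x) (norm y) < \<bar>q\<bar> ^ N" using real_arch_pow[OF q] by blast
    then have "norm x / \<bar>q\<bar> ^ N \<le> 1" "norm y / \<bar>q\<bar> ^ N \<le> 1" using q by simp_all
    then have le_b: "norm z \<le> norm x / \<bar>q\<bar> ^ N + B / (\<bar>q\<bar> - 1) \<Longrightarrow> norm z \<le> b"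
        "norm z \<le> norm y / \<bar>q\<bar> ^ N + B / (\<bar>q\<bar> - 1) \<Longrightarrow> norm z \<le> b" for z :: 'a
      unfolding b_def by linarith+
    obtain x' j ws where x0: "(x', j) \<in> Lam T" "\<forall>k<N. ws k \<in> W" "norm x' \<le> norm x / \<bar>q\<bar> ^ N + B / (\<bar>q\<bar> - 1)"
      "x + c i = q ^ N *\<^sub>R (x' + c j) + (\<Sum>k<N. q ^ k *\<^sub>R ws k)"
      using control_expansion[OF step q L(1), of N] by blast
    obtain y' j' ws' where y0: "(y', j') \<in> Lam T" "\<forall>k<N. ws' k \<in> W" "norm y' \<le> norm y / \<bar>q\<bar> ^ N + B / (\<bar>q\<bar> - 1)"
      "y + c i = q ^ N *\<^sub>R (y' + c j') + (\<Sum>k<N. q ^ k *\<^sub>R ws' k)"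
      using control_expansion[OF step q L(2), of N] by blast
    have x: "(x', j) \<in> K" and y: "(y', j') \<in> K"
      using x0(1) y0(1) le_b(1)[OF x0(3)] le_b(2)[OF y0(3)] by (auto simp: K_def)
    define \<kappa> where "\<kappa> = (x' + c j) - (y' + c j')"
    have \<kappa>: "\<kappa> \<in> Z" using x y unfolding Z_def \<kappa>_def by force
    \<comment> \<open>Both tiles have type \<open>i\<close>, so their control points differ by
      exactly \<open>x - y\<close>.\<close>
    have "x - y = (x + c i) - (y + c i)" by simp
    also have "\<dots> = q ^ N *\<^sub>R \<kappa> + (\<Sum>k<N. q ^ k *\<^sub>R ws k - q ^ k *\<^sub>R ws' k)"
      unfolding x0(4) y0(4) \<kappa>_def by (simp add: sum_subtractf scaleR_diff_right)
    finally have eq: "x - y = q ^ N *\<^sub>R \<kappa> + (\<Sum>k<N. q ^ k *\<^sub>R ws k - q ^ k *\<^sub>R ws' k)" .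
    have pow: "\<theta> ^ (l * k + n) = q ^ k * \<theta> ^ n" for k by (simp add: q_def power_mult power_add)
    have "((x - y) \<bullet> \<alpha>) * \<theta> ^ n = (\<kappa> \<bullet> \<alpha>) * \<theta> ^ (l * N + n)
        + (\<Sum>k<N. (ws k \<bullet> \<alpha>) * \<theta> ^ (l * k + n) + - ((ws' k \<bullet> \<alpha>) * \<theta> ^ (l * k + n)))"
      unfolding eq pow
      by (simp add: inner_add_left inner_sum_left inner_diff_left distrib_left sum_distrib_left
          right_diff_distrib mult_ac)
    also have "circle_dist \<dots> \<le> circle_dist ((\<kappa> \<bullet> \<alpha>) * \<theta> ^ (l * N + n))
        + (\<Sum>k<N. circle_dist ((ws k \<bullet> \<alpha>) * \<theta> ^ (l * k + n) + - ((ws' k \<bullet> \<alpha>) * \<theta> ^ (l * k + n))))"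
      by (rule order_trans[OF circle_dist_add add_left_mono[OF circle_dist_sum]])
    also have "\<dots> \<le> 2 * s (l * N + n) + (\<Sum>k<N. 2 * s (l * k + n))"
    proof (intro add_mono sum_mono)
      show "circle_dist ((\<kappa> \<bullet> \<alpha>) * \<theta> ^ (l * N + n)) \<le> 2 * s (l * N + n)"
        using s_le[OF \<kappa>, of "l * N + n"] s0[of "l * N + n"] by linarith
      fix k assume "k \<in> {..<N}"
      then have "ws k \<in> Z" "ws' k \<in> Z" using x0(2) y0(2) by (auto simp: Z_def)
      from s_le[OF this(1), of "l * k + n"] s_le[OF this(2), of "l * k + n"]
      show "circle_dist ((ws k \<bullet> \<alpha>) * \<theta> ^ (l * k + n) + - ((ws' k \<bullet> \<alpha>) * \<theta> ^ (l * k + n))) \<le> 2 * s (l * k + n)"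
        using circle_dist_add[of "(ws k \<bullet> \<alpha>) * \<theta> ^ (l * k + n)" "- ((ws' k \<bullet> \<alpha>) * \<theta> ^ (l * k + n))"]
        by simp
    qed
    also have "\<dots> = 2 * (\<Sum>k\<le>N. s (l * k + n))"
      by (simp add: sum_distrib_left flip: lessThan_Suc_atMost)
    \<comment> \<open>The indices \<open>l * k\<close> are distinct since \<open>level\<close> is
      positive, so the sum is bounded by the tail chosen below \<open>e / 2\<close>.\<close>
    also have "(\<Sum>k\<le>N. s (l * k + n)) = (\<Sum>j\<in>(\<lambda>k. l * k) ` {..N}. s (j + n))"
      using level(1) by (subst sum.reindex) (auto simp: inj_on_def l_def)
    also have "\<dots> \<le> (\<Sum>j. s (j + n))"
      using summ_s s0 by (intro sum_le_suminf) (auto simp: summable_iff_shift)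
    finally show ?thesis using n by simp
  qed
  then show ?thesis by blast
qed

section \<open>Uniform continuity of the substitution and of its inverse on the orbit\<close>

lemma tdist_omega_uniform:
  assumes "e > 0"
  obtains d where "d > 0" "\<And>S1 S2. tdist S1 S2 < d \<Longrightarrow> tdist (omega S1) (omega S2) \<le> e"
proof -
  have "bounded (\<Union>i. \<Union>j. D i j)" by (intro finite_imp_bounded) (simp add: finite_digits)
  then obtain B where "B > 0" "\<forall>u\<in>(\<Union>i. \<Union>j. D i j). norm u \<le> B" unfolding bounded_pos by blast
  then have B: "B > 0" "norm u \<le> B" if "u \<in> D i j" for u i j using that by blast+
  have Bpos: "B > 0" by fact
  \<comment> \<open>The first term controls displacements, which are stretched by
    \<bar>\<theta>\<bar>; the last makes the window contain every parent of a tile in the ball of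
    radius \<open>1 / e\<close>.\<close>
  define d where "d = min (e / \<bar>\<theta>\<bar>) (min (1 / sqrt 2) (\<bar>\<theta>\<bar> / (1 / e + B)))"
  have p: "1 / e + B > 0" using assms Bpos by (simp add: add_pos_pos)
  have d: "d > 0" "d \<le> e / \<bar>\<theta>\<bar>" "d \<le> 1 / sqrt 2" "d \<le> \<bar>\<theta>\<bar> / (1 / e + B)"
    using assms p abs_theta by (auto simp: d_def)
  have d1: "\<bar>\<theta>\<bar> * d \<le> e" using d(2) abs_theta by (simp add: pos_le_divide_eq mult.commute)
  have d2: "1 / e + B \<le> \<bar>\<theta>\<bar> * (1 / d)" using d(1,4) p by (simp add: field_simps)
  have *: "\<exists>y'. (y', i) \<in> Lam (omega S2) \<and> dist y y' < e"
    if cl: "close d S1 S2" and y: "(y, i) \<in> Lam (omega S1)" "norm y < 1 / e" for S1 S2 y i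
  proof -
    obtain x j u where x: "(x, j) \<in> Lam S1" "u \<in> D i j" "y = \<theta> *\<^sub>R x + u"
      using y(1) by (auto simp: Lam_omega)
    have "\<bar>\<theta>\<bar> * norm x = norm (y - u)" using x(3) by simp
    also have "\<dots> < 1 / e + B" using norm_triangle_ineq4[of y u] y(2) B(2)[OF x(2)] by linarith
    finally have "\<bar>\<theta>\<bar> * norm x < \<bar>\<theta>\<bar> * (1 / d)" using d2 by linarith
    then have "norm x < 1 / d"
      by (subst (asm) mult_less_cancel_left_pos) (use abs_theta in auto)
    then obtain x' where x': "(x', j) \<in> Lam S2" "dist x x' < d" using closeD[OF cl x(1)] by blast
    have "dist y (\<theta> *\<^sub>R x' + u) = \<bar>\<theta>\<bar> * dist x x'"
      by (simp add: x(3) dist_norm flip: scaleR_diff_right)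
    also have "\<dots> < \<bar>\<theta>\<bar> * d" using x'(2) abs_theta by (intro mult_strict_left_mono) auto
    also have "\<dots> \<le> e" by (rule d1)
    finally show ?thesis using x'(1) x(2) by (intro exI[of _ "\<theta> *\<^sub>R x' + u"]) (auto simp: Lam_omega)
  qed
  show thesis
  proof (rule that[OF d(1)])
    fix S1 S2 assume "tdist S1 S2 < d"
    then have cl: "close d S1 S2" using d(3) by (rule tdist_less_imp_close)
    have cl': "close d S2 S1" using cl close_sym by blast
    show "tdist (omega S1) (omega S2) \<le> e"
      by (intro tdist_le_close[OF assms] closeI) (use *[OF cl] *[OF cl'] in blast)+
  qed
qed

text \<open>A continuous injection of a compact space has a uniformly continuous inverse, here on
  the orbit, where \<omega> maps \<open>T - x\<close> to \<open>T - \<theta> x\<close>. A violation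
  yields two distinct limit tilings of the hull with the same image.\<close>

lemma recognizable_uniform:
  assumes rec: "recognizable T" and e: "e > 0"
  shows "\<exists>d>0. \<forall>x y. tdist (shift_tiles (- (\<theta> *\<^sub>R x)) T) (shift_tiles (- (\<theta> *\<^sub>R y)) T) < d \<longrightarrow>
    tdist (shift_tiles (- x) T) (shift_tiles (- y) T) < e"
proof (rule ccontr)
  assume "\<not> ?thesis"
  then have "\<exists>x y. tdist (shift_tiles (- (\<theta> *\<^sub>R x)) T) (shift_tiles (- (\<theta> *\<^sub>R y)) T) < d \<and>
    \<not> tdist (shift_tiles (- x) T) (shift_tiles (- y) T) < e" if "d > 0" for d
    using that by blast
  then have "\<forall>n. \<exists>x y. tdist (shift_tiles (- (\<theta> *\<^sub>R x)) T) (shift_tiles (- (\<theta> *\<^sub>R y)) T) < 1 / real (Suc n) \<and>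
    \<not> tdist (shift_tiles (- x) T) (shift_tiles (- y) T) < e"
    by (metis of_nat_0_less_iff zero_less_Suc zero_less_divide_1_iff)
  then obtain xs ys where xy: "\<And>n. tdist (shift_tiles (- (\<theta> *\<^sub>R xs n)) T) (shift_tiles (- (\<theta> *\<^sub>R ys n)) T) < 1 / real (Suc n)"
    "\<And>n. \<not> tdist (shift_tiles (- xs n) T) (shift_tiles (- ys n) T) < e" by metis
  obtain r S where r: "strict_mono r" "tiling S" "(\<lambda>n. tdist (shift_tiles (- xs (r n)) T) S) \<longlonglongrightarrow> 0"
    using convergent_subsequence[of "\<lambda>n. shift_tiles (- xs n) T"] tiling_T by auto
  obtain r' S' where r': "strict_mono r'" "tiling S'" "(\<lambda>n. tdist (shift_tiles (- ys (r (r' n))) T) S') \<longlonglongrightarrow> 0"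
    using convergent_subsequence[of "\<lambda>n. shift_tiles (- ys (r n)) T"] tiling_T by auto
  define f where "f = r \<circ> r'"
  have f: "strict_mono f" using r(1) r'(1) by (simp add: f_def strict_mono_o)
  have limS: "(\<lambda>n. tdist (shift_tiles (- xs (f n)) T) S) \<longlonglongrightarrow> 0"
    using LIMSEQ_subseq_LIMSEQ[OF r(3) r'(1)] by (simp add: f_def o_def)
  have limS': "(\<lambda>n. tdist (shift_tiles (- ys (f n)) T) S') \<longlonglongrightarrow> 0"
    using r'(3) by (simp add: f_def)
  have in_space: "U \<in> tiling_space T" if "tiling U" "(\<lambda>n. tdist (shift_tiles (- zs n) T) U) \<longlonglongrightarrow> 0" for U zs
    unfolding tiling_space_iff[OF tiling_T]
  proof (intro conjI allI impI that(1))
    fix e' :: real assume "e' > 0"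
    then have "\<forall>\<^sub>F n in sequentially. tdist (shift_tiles (- zs n) T) U < e'"
      by (rule order_tendstoD(2)[OF that(2)])
    then obtain n where "tdist (shift_tiles (- zs n) T) U < e'" using eventually_happens by force
    then show "\<exists>g. tdist U (shift_tiles (- g) T) < e'" using tdist_sym by metis
  qed
  have SS': "S \<in> tiling_space T" "S' \<in> tiling_space T"
    by (rule in_space[OF r(2) limS], rule in_space[OF r'(2) limS'])
  have "tdist (omega S) (omega S') \<le> 0 + e'" if e': "e' > 0" for e'
  proof -
    have "e' / 3 > 0" using e' by simp
    then obtain d where d: "d > 0" "\<And>S1 S2. tdist S1 S2 < d \<Longrightarrow> tdist (omega S1) (omega S2) \<le> e' / 3"
      using tdist_omega_uniform by metis
    have "(\<lambda>n. 1 / real (Suc n)) \<longlonglongrightarrow> 0" using LIMSEQ_inverse_real_of_nat by (simp add: inverse_eq_divide)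
    then have "(\<lambda>n. 1 / real (Suc (f n))) \<longlonglongrightarrow> 0" using LIMSEQ_subseq_LIMSEQ[OF _ f] by (auto simp: o_def)
    then have "\<forall>\<^sub>F n in sequentially. tdist (shift_tiles (- xs (f n)) T) S < d \<and>
        tdist (shift_tiles (- ys (f n)) T) S' < d \<and> 1 / real (Suc (f n)) < e' / 3"
      using \<open>e' / 3 > 0\<close> by (intro eventually_conj order_tendstoD(2)[OF limS d(1)] order_tendstoD(2)[OF limS' d(1)] order_tendstoD(2))
    then obtain n where n: "tdist (shift_tiles (- xs (f n)) T) S < d"
        "tdist (shift_tiles (- ys (f n)) T) S' < d" "1 / real (Suc (f n)) < e' / 3"
      using eventually_happens by force
    have om: "omega (shift_tiles (- x) T) = shift_tiles (- (\<theta> *\<^sub>R x)) T" for x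
      by (simp add: omega_shift tiling_T omega_T)
    have 1: "tdist (shift_tiles (- (\<theta> *\<^sub>R xs (f n))) T) (omega S) \<le> e' / 3"
      using d(2)[OF n(1)] by (simp add: om)
    have 2: "tdist (shift_tiles (- (\<theta> *\<^sub>R ys (f n))) T) (omega S') \<le> e' / 3"
      using d(2)[OF n(2)] by (simp add: om)
    have 3: "tdist (shift_tiles (- (\<theta> *\<^sub>R xs (f n))) T) (shift_tiles (- (\<theta> *\<^sub>R ys (f n))) T) \<le> e' / 3"
      using xy(1)[of "f n"] n(3) by linarith
    show ?thesis
      using 1 2 3 tdist_sym[of "omega S" "shift_tiles (- (\<theta> *\<^sub>R xs (f n))) T"]
        tdist_triangle[of "omega S" "omega S'" "shift_tiles (- (\<theta> *\<^sub>R xs (f n))) T"]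
        tdist_triangle[of "shift_tiles (- (\<theta> *\<^sub>R xs (f n))) T" "omega S'" "shift_tiles (- (\<theta> *\<^sub>R ys (f n))) T"]
      by linarith
  qed
  then have "tdist (omega S) (omega S') \<le> 0" by (rule field_le_epsilon)
  then have "tdist (omega S) (omega S') = 0" by (rule antisym) (rule tdist_nonneg)
  then have "omega S = omega S'"
    using tilings.zero[of "omega S" "omega S'"] tiling_omega r(2) r'(2) by simp
  then have "S = S'" using rec SS' unfolding recognizable_def inj_on_def by blast
  have "\<forall>\<^sub>F n in sequentially. tdist (shift_tiles (- xs (f n)) T) S < e / 2 \<and>
        tdist (shift_tiles (- ys (f n)) T) S' < e / 2"
    using e by (intro eventually_conj order_tendstoD(2)[OF limS] order_tendstoD(2)[OF limS']) auto
  then obtain n where "tdist (shift_tiles (- xs (f n)) T) S < e / 2" "tdist (shift_tiles (- ys (f n)) T) S' < e / 2"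
    using eventually_happens by force
  then have "tdist (shift_tiles (- xs (f n)) T) (shift_tiles (- ys (f n)) T) < e"
    using tdist_triangle[of "shift_tiles (- xs (f n)) T" "shift_tiles (- ys (f n)) T" S]
      tdist_sym[of S "shift_tiles (- ys (f n)) T"] \<open>S = S'\<close> by simp
  then show False using xy(2) by blast
qed

lemma recognizable_uniform_iterate:
  assumes rec: "recognizable T"
  shows "e > 0 \<Longrightarrow> \<exists>d>0. \<forall>x y. tdist (shift_tiles (- (\<theta> ^ n *\<^sub>R x)) T) (shift_tiles (- (\<theta> ^ n *\<^sub>R y)) T) < d \<longrightarrow>
    tdist (shift_tiles (- x) T) (shift_tiles (- y) T) < e"
proof (induction n)
  case 0
  then show ?case by (intro exI[of _ e]) simp
next
  case (Suc n)
  then obtain d where d: "d > 0" "\<And>x y. tdist (shift_tiles (- (\<theta> ^ n *\<^sub>R x)) T) (shift_tiles (- (\<theta> ^ n *\<^sub>R y)) T) < d \<Longrightarrow>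
    tdist (shift_tiles (- x) T) (shift_tiles (- y) T) < e" by blast
  obtain d' where d': "d' > 0" "\<And>x y. tdist (shift_tiles (- (\<theta> *\<^sub>R x)) T) (shift_tiles (- (\<theta> *\<^sub>R y)) T) < d' \<Longrightarrow>
    tdist (shift_tiles (- x) T) (shift_tiles (- y) T) < d" using recognizable_uniform[OF rec d(1)] by blast
  show ?case
  proof (intro exI[of _ d'] conjI allI impI d'(1))
    fix x y assume "tdist (shift_tiles (- (\<theta> ^ Suc n *\<^sub>R x)) T) (shift_tiles (- (\<theta> ^ Suc n *\<^sub>R y)) T) < d'"
    then have "tdist (shift_tiles (- (\<theta> *\<^sub>R (\<theta> ^ n *\<^sub>R x))) T) (shift_tiles (- (\<theta> *\<^sub>R (\<theta> ^ n *\<^sub>R y))) T) < d'" by simp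
    then show "tdist (shift_tiles (- x) T) (shift_tiles (- y) T) < e" using d(2) d'(2) by blast
  qed
qed

text \<open>Undoing \<open>n\<close> substitutions, the tilings at \<open>x / \<theta> ^ n\<close>
  and \<open>y / \<theta> ^ n\<close> are still close and have tiles of equal type near the origin.
  Hence \<open>x - y\<close> is an inflated return vector, with uniformly small phase, plus an
  inflated small vector.\<close>

lemma orbit_phase_uniform:
  fixes \<alpha> :: 'a
  assumes rec: "recognizable T"
    and ret: "\<And>w i \<xi>. (w, i) \<in> Lam T \<Longrightarrow> (w + \<xi>, i) \<in> Lam T \<Longrightarrow>
      summable (\<lambda>n. circle_dist ((\<xi> \<bullet> \<alpha>) * \<theta> ^ n))" and e: "e > 0"
  shows "\<exists>d>0. \<forall>x y. tdist (shift_tiles (- x) T) (shift_tiles (- y) T) < d \<longrightarrow> circle_dist ((x - y) \<bullet> \<alpha>) \<le> e"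
proof -
  have "e / 2 > 0" using e by simp
  obtain n where n: "\<And>x y i. (x, i) \<in> Lam T \<Longrightarrow> (y, i) \<in> Lam T \<Longrightarrow> circle_dist (((x - y) \<bullet> \<alpha>) * \<theta> ^ n) \<le> e / 2"
    using uniform_return_vectors[of \<alpha> "e / 2"] ret \<open>e / 2 > 0\<close> by blast
  define C where "C = 2 * pi * \<bar>\<theta>\<bar> ^ n * (norm \<alpha> + 1)"
  have C: "C > 0" using abs_theta norm_ge_zero[of \<alpha>] by (auto simp: C_def intro!: mult_pos_pos add_nonneg_pos)
  \<comment> \<open>\<eta> is chosen after \<open>n\<close>: the inflated discrepancy contributes at
    most \<open>C * \<eta> \<le> e / 2\<close>, and the window of radius \<open>1 / \<eta>\<close>
    contains the position of a tile covering the origin.\<close>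
  define \<eta> where "\<eta> = min (e / 2 / C) (min (1 / sqrt 2) (1 / (support_bound + 1)))"
  have sb: "support_bound + 1 > 0" using support_bound(1) by simp
  have \<eta>: "\<eta> > 0" "\<eta> \<le> e / 2 / C" "\<eta> \<le> 1 / sqrt 2" "\<eta> \<le> 1 / (support_bound + 1)"
    using C e sb by (auto simp: \<eta>_def)
  have \<eta>C: "C * \<eta> \<le> e / 2" using \<eta>(2) C by (simp add: pos_le_divide_eq mult_ac)
  have \<eta>sb: "support_bound < 1 / \<eta>"
  proof -
    have "support_bound + 1 \<le> 1 / \<eta>" using \<eta>(1,4) sb by (simp add: pos_le_divide_eq mult.commute)
    then show ?thesis by simp
  qed
  obtain d where d: "d > 0" "\<And>x y. tdist (shift_tiles (- (\<theta> ^ n *\<^sub>R x)) T) (shift_tiles (- (\<theta> ^ n *\<^sub>R y)) T) < d \<Longrightarrow>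
    tdist (shift_tiles (- x) T) (shift_tiles (- y) T) < \<eta>"
    using recognizable_uniform_iterate[OF rec \<eta>(1)] by blast
  have "circle_dist ((x - y) \<bullet> \<alpha>) \<le> e" if xy: "tdist (shift_tiles (- x) T) (shift_tiles (- y) T) < d" for x y
  proof -
    define x' where "x' = (1 / \<theta> ^ n) *\<^sub>R x"
    define y' where "y' = (1 / \<theta> ^ n) *\<^sub>R y"
    have x': "\<theta> ^ n *\<^sub>R x' = x" and y': "\<theta> ^ n *\<^sub>R y' = y" by (simp_all add: x'_def y'_def)
    have "tdist (shift_tiles (- x') T) (shift_tiles (- y') T) < \<eta>" using d(2)[of x' y'] xy x' y' by simp
    then have cl: "close \<eta> (shift_tiles (- x') T) (shift_tiles (- y') T)" using \<eta>(3) by (rule tdist_less_imp_close)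
    have "tiling (shift_tiles (- x') T)" by (simp add: tiling_T)
    then obtain w i where w: "(w, i) \<in> Lam (shift_tiles (- x') T)" "norm (0 - w) \<le> support_bound"
      using tiling_cover_norm by metis
    then have "norm w < 1 / \<eta>" using \<eta>sb by simp
    then obtain z where z: "(z, i) \<in> Lam (shift_tiles (- y') T)" "dist w z < \<eta>" using closeD[OF cl w(1)] by blast
    have L: "(w + x', i) \<in> Lam T" "(z + y', i) \<in> Lam T" using w(1) z(1) by simp_all
    have "x - y = \<theta> ^ n *\<^sub>R ((w + x') - (z + y')) + \<theta> ^ n *\<^sub>R (z - w)"
      unfolding x'[symmetric] y'[symmetric] by (simp add: algebra_simps)
    then have eq: "(x - y) \<bullet> \<alpha> = (((w + x') - (z + y')) \<bullet> \<alpha>) * \<theta> ^ n + ((z - w) \<bullet> \<alpha>) * \<theta> ^ n"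
      by (simp only: inner_add_left inner_scaleR_left mult.commute)
    have "circle_dist ((x - y) \<bullet> \<alpha>) \<le> circle_dist ((((w + x') - (z + y')) \<bullet> \<alpha>) * \<theta> ^ n)
        + circle_dist (((z - w) \<bullet> \<alpha>) * \<theta> ^ n)"
      unfolding eq by (rule circle_dist_add)
    also have "\<dots> \<le> e / 2 + circle_dist (((z - w) \<bullet> \<alpha>) * \<theta> ^ n)" using n[OF L] by simp
    also have "circle_dist (((z - w) \<bullet> \<alpha>) * \<theta> ^ n) \<le> 2 * pi * \<bar>((z - w) \<bullet> \<alpha>) * \<theta> ^ n\<bar>" by (rule circle_dist_le)
    also have "\<dots> = 2 * pi * \<bar>\<theta>\<bar> ^ n * \<bar>(z - w) \<bullet> \<alpha>\<bar>" by (simp add: abs_mult power_abs)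
    also have "\<dots> \<le> 2 * pi * \<bar>\<theta>\<bar> ^ n * (\<eta> * (norm \<alpha> + 1))"
    proof (intro mult_left_mono)
      have "\<bar>(z - w) \<bullet> \<alpha>\<bar> \<le> norm (z - w) * norm \<alpha>" by (rule Cauchy_Schwarz_ineq2)
      also have "\<dots> \<le> \<eta> * (norm \<alpha> + 1)"
        using z(2) \<eta>(1) by (intro mult_mono) (auto simp: dist_norm norm_minus_commute)
      finally show "\<bar>(z - w) \<bullet> \<alpha>\<bar> \<le> \<eta> * (norm \<alpha> + 1)" .
    qed simp
    also have "\<dots> = C * \<eta>" by (simp add: C_def)
    finally show ?thesis using \<eta>C by simp
  qed
  then show ?thesis using d(1) by blast
qed

end

section \<open>Continuous eigenfunctions\<close>

context scaling_system
begin

text \<open>The phase is uniformly continuous on the orbit, which is dense in the hull, so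
  completeness of the complex numbers extends it. Modulus \<open>1\<close> and equivariance pass to
  the limit.\<close>

lemma topological_eigenfunction_extension:
  fixes \<alpha> :: 'a
  assumes unif: "\<And>e. e > 0 \<Longrightarrow> \<exists>d>0. \<forall>x y. tdist (shift_tiles (- x) T) (shift_tiles (- y) T) < d \<longrightarrow>
    circle_dist ((x - y) \<bullet> \<alpha>) \<le> e"
  obtains g where "topological_eigenfunction T \<alpha> g" "unif_cont (tiling_space T) tdist g"
    "\<And>S. S \<in> tiling_space T \<Longrightarrow> cmod (g S) = 1"
proof -
  define \<phi> where "\<phi> y = cis (2 * pi * (y \<bullet> \<alpha>))" for y
  have orbit: "\<exists>y. tdist S (shift_tiles (- y) T) < e" if "S \<in> tiling_space T" "e > 0" for S e
    using that tiling_space_iff[OF tiling_T] by blast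
  have \<phi>_unif: "\<exists>d>0. \<forall>x y. tdist (shift_tiles (- x) T) (shift_tiles (- y) T) < d \<longrightarrow> cmod (\<phi> x - \<phi> y) \<le> e"
    if "e > 0" for e
    using unif[OF that] by (simp add: \<phi>_def inner_diff_left circle_dist_diff)
  \<comment> \<open>The limit is recorded as an estimate for all orbit points near \<open>S\<close>,
    the form used for continuity and equivariance alike.\<close>
  have "\<exists>z. \<forall>e>0. \<exists>d>0. \<forall>y. tdist S (shift_tiles (- y) T) < d \<longrightarrow> cmod (z - \<phi> y) \<le> e"
    if S: "S \<in> tiling_space T" for S
  proof -
    have "\<forall>n. \<exists>y. tdist S (shift_tiles (- y) T) < 1 / real (Suc n)" using orbit[OF S] by simp
    then obtain ys where ys: "\<And>n. tdist S (shift_tiles (- ys n) T) < 1 / real (Suc n)" by metis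
    have lim0: "(\<lambda>n. 1 / real (Suc n)) \<longlonglongrightarrow> 0"
      using LIMSEQ_inverse_real_of_nat by (simp add: inverse_eq_divide)
    have near: "\<forall>\<^sub>F n in sequentially. tdist S (shift_tiles (- ys n) T) < d" if "d > 0" for d
      using order_tendstoD(2)[OF lim0 that] by eventually_elim (use ys less_trans in blast)
    have join: "tdist (shift_tiles (- x) T) (shift_tiles (- y) T) < d"
      if "tdist S (shift_tiles (- x) T) < d / 2" "tdist S (shift_tiles (- y) T) < d / 2" for x y d
      using that tdist_triangle[of "shift_tiles (- x) T" "shift_tiles (- y) T" S]
        tdist_sym[of "shift_tiles (- x) T" S] by linarith
    have "Cauchy (\<lambda>n. \<phi> (ys n))"
    proof (rule metric_CauchyI)
      fix e :: real assume "e > 0"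
      then have "e / 2 > 0" by simp
      then obtain d where d: "d > 0" "\<And>x y. tdist (shift_tiles (- x) T) (shift_tiles (- y) T) < d \<Longrightarrow> cmod (\<phi> x - \<phi> y) \<le> e / 2"
        using \<phi>_unif by blast
      have "d / 2 > 0" using d(1) by simp
      from near[OF this] obtain N where "\<forall>n\<ge>N. tdist S (shift_tiles (- ys n) T) < d / 2"
        unfolding eventually_sequentially by blast
      then have "\<forall>m\<ge>N. \<forall>n\<ge>N. dist (\<phi> (ys m)) (\<phi> (ys n)) < e"
        using d(2) join \<open>e > 0\<close> unfolding dist_norm by (smt (verit) field_sum_of_halves)
      then show "\<exists>M. \<forall>m\<ge>M. \<forall>n\<ge>M. dist (\<phi> (ys m)) (\<phi> (ys n)) < e" by blast
    qed
    then obtain z where z: "(\<lambda>n. \<phi> (ys n)) \<longlonglongrightarrow> z" using Cauchy_convergent_iff convergent_def by blast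
    show ?thesis
    proof (intro exI[of _ z] allI impI)
      fix e :: real assume "e > 0"
      then obtain d where d: "d > 0" "\<And>x y. tdist (shift_tiles (- x) T) (shift_tiles (- y) T) < d \<Longrightarrow> cmod (\<phi> x - \<phi> y) \<le> e"
        using \<phi>_unif by blast
      have "cmod (z - \<phi> y) \<le> e" if y: "tdist S (shift_tiles (- y) T) < d / 2" for y
      proof (rule tendsto_upperbound[of "\<lambda>n. cmod (\<phi> (ys n) - \<phi> y)" _ sequentially])
        show "(\<lambda>n. cmod (\<phi> (ys n) - \<phi> y)) \<longlonglongrightarrow> cmod (z - \<phi> y)" by (intro tendsto_intros z)
        have "d / 2 > 0" using d(1) by simp
        from near[OF this] show "\<forall>\<^sub>F n in sequentially. cmod (\<phi> (ys n) - \<phi> y) \<le> e"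
          by eventually_elim (use d(2) join y in blast)
      qed simp
      then show "\<exists>d>0. \<forall>y. tdist S (shift_tiles (- y) T) < d \<longrightarrow> cmod (z - \<phi> y) \<le> e"
        using d(1) by (intro exI[of _ "d / 2"]) simp
    qed
  qed
  then have "\<forall>S\<in>tiling_space T. \<exists>z. \<forall>e>0. \<exists>d>0. \<forall>y. tdist S (shift_tiles (- y) T) < d \<longrightarrow> cmod (z - \<phi> y) \<le> e"
    by blast
  from bchoice[OF this] obtain g where g: "\<And>S e. S \<in> tiling_space T \<Longrightarrow> e > 0 \<Longrightarrow>
    \<exists>d>0. \<forall>y. tdist S (shift_tiles (- y) T) < d \<longrightarrow> cmod (g S - \<phi> y) \<le> e" by blast
  have uc: "unif_cont (tiling_space T) tdist g"
    unfolding unif_cont_def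
  proof (intro allI impI)
    fix e :: real assume "e > 0"
    then have e3: "e / 3 > 0" by simp
    then obtain d where d: "d > 0" "\<And>x y. tdist (shift_tiles (- x) T) (shift_tiles (- y) T) < d \<Longrightarrow> cmod (\<phi> x - \<phi> y) \<le> e / 3"
      using \<phi>_unif by blast
    have "cmod (g S - g S') \<le> e"
      if S: "S \<in> tiling_space T" "S' \<in> tiling_space T" "tdist S S' < d / 3" for S S'
    proof -
      obtain d1 where d1: "d1 > 0" "\<And>y. tdist S (shift_tiles (- y) T) < d1 \<Longrightarrow> cmod (g S - \<phi> y) \<le> e / 3"
        using g[OF S(1) e3] by blast
      obtain d2 where d2: "d2 > 0" "\<And>y. tdist S' (shift_tiles (- y) T) < d2 \<Longrightarrow> cmod (g S' - \<phi> y) \<le> e / 3"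
        using g[OF S(2) e3] by blast
      obtain x where x: "tdist S (shift_tiles (- x) T) < min d1 (d / 3)"
        using orbit[OF S(1), of "min d1 (d / 3)"] d(1) d1(1) by auto
      obtain y where y: "tdist S' (shift_tiles (- y) T) < min d2 (d / 3)"
        using orbit[OF S(2), of "min d2 (d / 3)"] d(1) d2(1) by auto
      have "tdist (shift_tiles (- x) T) (shift_tiles (- y) T) < d"
        using x y S(3) tdist_triangle[of "shift_tiles (- x) T" "shift_tiles (- y) T" S]
          tdist_triangle[of S "shift_tiles (- y) T" S'] tdist_sym[of "shift_tiles (- x) T" S] by linarith
      then have "cmod (\<phi> x - \<phi> y) \<le> e / 3" by (rule d(2))
      moreover have "cmod (g S - \<phi> x) \<le> e / 3" using x by (intro d1(2)) simp
      moreover have "cmod (g S' - \<phi> y) \<le> e / 3" using y by (intro d2(2)) simp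
      moreover have "g S - g S' = (g S - \<phi> x) + (\<phi> x - \<phi> y) - (g S' - \<phi> y)" by simp
      ultimately show ?thesis
        using norm_triangle_ineq4[of "(g S - \<phi> x) + (\<phi> x - \<phi> y)" "g S' - \<phi> y"]
          norm_triangle_ineq[of "g S - \<phi> x" "\<phi> x - \<phi> y"] by simp
    qed
    then show "\<exists>r>0. \<forall>x\<in>tiling_space T. \<forall>y\<in>tiling_space T. tdist x y < r \<longrightarrow> cmod (g x - g y) \<le> e"
      using d(1) by (intro exI[of _ "d / 3"]) simp
  qed
  have norm_g: "cmod (g S) = 1" if S: "S \<in> tiling_space T" for S
  proof -
    have "\<bar>cmod (g S) - 1\<bar> \<le> 0 + e" if e: "e > 0" for e
    proof -
      obtain d where "d > 0" "\<And>y. tdist S (shift_tiles (- y) T) < d \<Longrightarrow> cmod (g S - \<phi> y) \<le> e"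
        using g[OF S e] by blast
      then obtain y where "cmod (g S - \<phi> y) \<le> e" using orbit[OF S] by blast
      then show ?thesis using norm_triangle_ineq3[of "g S" "\<phi> y"] by (simp add: \<phi>_def)
    qed
    then have "\<bar>cmod (g S) - 1\<bar> \<le> 0" by (rule field_le_epsilon)
    then show ?thesis by simp
  qed
  have equivariant: "g (shift_tiles (- x) S) = \<phi> x * g S" if S: "S \<in> tiling_space T" for x S
  proof -
    have "cmod (g (shift_tiles (- x) S) - \<phi> x * g S) \<le> 0 + e" if "e > 0" for e
    proof -
      have e2: "e / 2 > 0" using that by simp
      obtain d1 where d1: "d1 > 0" "\<And>y. tdist S (shift_tiles (- y) T) < d1 \<Longrightarrow> cmod (g S - \<phi> y) \<le> e / 2"
        using g[OF S e2] by blast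
      obtain d2 where d2: "d2 > 0" "\<And>y. tdist (shift_tiles (- x) S) (shift_tiles (- y) T) < d2 \<Longrightarrow>
          cmod (g (shift_tiles (- x) S) - \<phi> y) \<le> e / 2"
        using g[OF shift_in_X[OF S] e2] by blast
      have "d2 / 2 > 0" using d2(1) by simp
      then obtain d3 where d3: "d3 > 0" "\<And>S1 S2 v. tdist S1 S2 < d3 \<Longrightarrow> norm v \<le> norm x \<Longrightarrow>
          tdist (shift_tiles v S1) (shift_tiles v S2) \<le> d2 / 2"
        using tdist_shift_uniform[of "d2 / 2" "norm x"] by blast
      obtain y where y: "tdist S (shift_tiles (- y) T) < min d1 d3"
        using orbit[OF S, of "min d1 d3"] d1(1) d3(1) by auto
      have "tdist (shift_tiles (- x) S) (shift_tiles (- x) (shift_tiles (- y) T)) \<le> d2 / 2"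
        using y by (intro d3(2)) auto
      then have "tdist (shift_tiles (- x) S) (shift_tiles (- (x + y)) T) < d2" using d2(1) by simp
      then have "cmod (g (shift_tiles (- x) S) - \<phi> (x + y)) \<le> e / 2" by (rule d2(2))
      moreover have "\<phi> (x + y) = \<phi> x * \<phi> y"
        by (simp add: \<phi>_def inner_add_left distrib_left cis_mult)
      moreover have "cmod (\<phi> x * g S - \<phi> x * \<phi> y) \<le> e / 2"
        using d1(2)[of y] y by (simp add: \<phi>_def norm_mult flip: right_diff_distrib)
      ultimately show ?thesis
        using norm_triangle_ineq4[of "g (shift_tiles (- x) S) - \<phi> x * \<phi> y" "\<phi> x * g S - \<phi> x * \<phi> y"] by simp
    qed
    then have "cmod (g (shift_tiles (- x) S) - \<phi> x * g S) \<le> 0" by (rule field_le_epsilon)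
    then show ?thesis by simp
  qed
  have "T \<in> tiling_space T" using orbit_in_tiling_space[OF tiling_T, of 0] by simp
  then have "\<exists>S\<in>tiling_space T. g S \<noteq> 0" using norm_g[of T] by (metis norm_zero zero_neq_one)
  moreover have "continuous_map (X_top T) euclidean g"
    using X.unif_cont_imp_continuous_map[OF uc] by (simp add: X_mtopology)
  ultimately have "topological_eigenfunction T \<alpha> g"
    unfolding topological_eigenfunction_def exp_eq_cis using equivariant by (simp add: \<phi>_def)
  then show thesis using uc norm_g that by blast
qed

text \<open>Multiplying \<open>f\<close> by the conjugate of the continuous eigenfunction
  \<open>g\<close> cancels the phases. The product is invariant, hence almost everywhere a constant
  \<open>c\<close>, and \<open>f\<close> equals \<open>c * g\<close> because \<open>g\<close> has
  modulus \<open>1\<close>.\<close>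

lemma eigenfunction_AE_continuous:
  assumes "repetitive T" "recognizable T" and f: "eigenfunction \<mu> \<alpha> f"
  shows "\<exists>g. topological_eigenfunction T \<alpha> g \<and> (AE S in \<mu>. f S = g S)"
proof -
  have ev: "eigenvalue \<mu> \<alpha>" using f unfolding eigenvalue_def by blast
  have ret: "summable (\<lambda>n. circle_dist ((\<xi> \<bullet> \<alpha>) * \<theta> ^ n))"
    if "(w, i) \<in> Lam T" "(w + \<xi>, i) \<in> Lam T" for w i \<xi>
    by (rule summable_circle_dist[OF abs_theta algebraic_int_theta
        eigenvalue_circle_dist[OF ev recurrent_if_repetitive[OF assms(1) that]]])
  have unif: "\<exists>d>0. \<forall>x y. tdist (shift_tiles (- x) T) (shift_tiles (- y) T) < d \<longrightarrow>
      circle_dist ((x - y) \<bullet> \<alpha>) \<le> e" if "e > 0" for e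
    using orbit_phase_uniform[OF assms(2) ret that] .
  obtain g where g: "topological_eigenfunction T \<alpha> g" "unif_cont (tiling_space T) tdist g"
    "\<And>S. S \<in> tiling_space T \<Longrightarrow> cmod (g S) = 1"
    by (rule topological_eigenfunction_extension[of \<alpha>], erule unif, rule that)
  have g_shift: "g (shift_tiles (- x) S) = cis (2 * pi * (x \<bullet> \<alpha>)) * g S" if "S \<in> tiling_space T" for x S
    using g(1) that unfolding topological_eigenfunction_def exp_eq_cis by blast
  have g_meas: "g \<in> borel_measurable \<mu>" by (rule X.unif_cont_measurable[OF g(2) space_\<mu> sets_\<mu>])
  have int: "integrable \<mu> (\<lambda>S. f S * cnj (g S))"
  proof (rule Bochner_Integration.integrable_bound[OF eigenfunction_integrable[OF f]])
    show "(\<lambda>S. f S * cnj (g S)) \<in> borel_measurable \<mu>"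
    proof (rule borel_measurable_times)
      have "cnj \<in> borel_measurable borel"
        by (intro borel_measurable_continuous_onI continuous_intros)
      then show "(\<lambda>S. cnj (g S)) \<in> borel_measurable \<mu>" by (rule measurable_compose[OF g_meas])
    qed (rule borel_measurable_integrable[OF eigenfunction_integrable[OF f]])
    show "AE S in \<mu>. norm (f S * cnj (g S)) \<le> norm (f S)"
      by (rule AE_I2) (simp add: space_\<mu> g(3) norm_mult)
  qed
  have "AE S in \<mu>. f (shift_tiles v S) * cnj (g (shift_tiles v S)) = f S * cnj (g S)" for v
    using eigenfunction_shift[OF f, of "- v"] AE_space
  proof eventually_elim
    case (elim S)
    have "cis t * cnj (cis t) = 1" for t by (simp add: cis_cnj cis_mult)
    then show ?case
      using elim g_shift[of S "- v"] by (simp add: space_\<mu> mult_ac)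
  qed
  from invariant_AE_const[OF int this] obtain c where c: "AE S in \<mu>. f S * cnj (g S) = c" by blast
  have fcg: "AE S in \<mu>. f S = c * g S"
    using c AE_space
  proof eventually_elim
    case (elim S)
    then have "cnj (g S) * g S = 1"
      using g(3)[of S] by (simp add: space_\<mu> mult.commute complex_norm_square[symmetric])
    then have "f S = f S * cnj (g S) * g S" by (simp add: mult.assoc)
    then show ?case using elim by simp
  qed
  \<comment> \<open>Needed because a topological eigenfunction must not vanish identically.\<close>
  have "c \<noteq> 0"
  proof
    assume "c = 0"
    then have "AE S in \<mu>. f S = 0" using fcg by simp
    then show False using f by (simp add: eigenfunction_def)
  qed
  moreover have "continuous_map (X_top T) euclidean (\<lambda>S. c * g S)"
    using X.unif_cont_imp_continuous_map[OF unif_cont_cmult[OF g(2)]] by (simp add: X_mtopology)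
  ultimately have "topological_eigenfunction T \<alpha> (\<lambda>S. c * g S)"
    using g(1) unfolding topological_eigenfunction_def by (simp add: mult.left_commute)
  then show ?thesis using fcg by blast
qed

end

theorem corollary5p7:
  fixes A :: "'k::finite \<Rightarrow> 'a::euclidean_space set"
    and D :: "'k \<Rightarrow> 'k \<Rightarrow> 'a set"
    and \<theta> :: real
    and T :: "('a, 'k) tile set"
    and \<mu> :: "('a, 'k) tile set measure"
  assumes "\<bar>\<theta>\<bar> > 1"
    and "tile_substitution A (\<lambda>x. \<theta> *\<^sub>R x) D"
    and "primitive D"
    and "tile_substitution.substitution_tiling A (\<lambda>x. \<theta> *\<^sub>R x) D T"
    and "prototiles.invariant_prob A T \<mu>"
  shows "((\<exists>\<alpha>. \<alpha> \<noteq> 0 \<and> eigenvalue \<mu> \<alpha>) \<longrightarrow> pisot \<bar>\<theta>\<bar>) \<and>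
    (prototiles.repetitive A T \<and> tile_substitution.recognizable A (\<lambda>x. \<theta> *\<^sub>R x) D T \<longrightarrow>
       (\<forall>\<alpha>. eigenvalue \<mu> \<alpha> \<longrightarrow> prototiles.topological_eigenvalue A T \<alpha>) \<and>
       (\<forall>\<alpha> f. eigenfunction \<mu> \<alpha> f \<longrightarrow>
          (\<exists>g. prototiles.topological_eigenfunction A T \<alpha> g \<and> (AE S in \<mu>. f S = g S))))"
proof -
  interpret tile_substitution A "\<lambda>x. \<theta> *\<^sub>R x" D by (rule assms(2))
  interpret scaling_system A \<theta> D T \<mu>
    using assms by unfold_locales (auto simp: substitution_tiling_def)
  show ?thesis
    using pisot_if_not_weakly_mixing eigenfunction_AE_continuous
    unfolding topological_eigenvalue_def eigenvalue_def by blast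
qed

end
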